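(* Let $T>0$. For each $D>0$ there is $\rho>0$ such that for all real-valued $f\in C^2([0,T])$ with $f'(0)=0=f'(T)$ and $\|f\|_{C^2}<D$ there is an $r\in(0,\rho)$ such that the $r$-lifting $L_r(c_f)$ of (the periodic continuation of) $c_f$ is simple and closed.
   Context: For $f\in C^2([0,T])$, $c_f:[0,\ell]\to\mathbb{R}^2$ denotes the injective arclength-parametrized curve with $c_f(0)=(0,f(0))$ whose image is the graph of $f$, and $\ell=\ell(c_f)$ is its length. The curve $c_f$ is identified with its periodic continuation $\mathbb{R}\to\mathbb{R}^2$, given by $c_f(t+j\ell)=c_f(t)+j\,(T,f(T)-f(0))$ for $t\in[0,\ell)$, $j\in\mathbb{Z}$ (a $C^1$, piecewise $C^2$ curve). $\mathbb{S}^2(r)$ denotes the sphere of radius $r$ centered at $0$ in $\mathbb{R}^3$, with a fixed orientation. For a regular $C^1$, piecewise $C^2$ plane curve $c$ defined on $\mathbb{R}$, the $r$-lifting $L_r(c):\mathbb{R}\to\mathbb{S}^2(r)$ is the curve with $L_r(c)(0)=(r,0,0)$, $(L_r(c))'(0)\in\mathbb{R}\cdot(0,1,0)$, $\|(L_r(c))'(t)\|=\|c'(t)\|$ for all $t$, and $\kappa_{L_r(c)}(t)=\kappa_c(t)$ for all $t$ (where defined), where $\kappa$ is the signed (geodesic) curvature in $\mathbb{S}^2(r)$ resp. $\mathbb{R}^2$. A curve $\gamma:\mathbb{R}\to\mathbb{S}^2(r)$ is simple and closed if there is $P>0$ with $\gamma(t+P)=\gamma(t)$ for all $t$ and $\gamma$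 is injective on $[0,P)$. $\|\cdot\|_{C^2}$ is the standard $C^2$ norm. *)

theory Defs
  imports "HOL-Analysis.Analysis"
begin

(* One-sided derivatives at the end points when I is a compact interval; meaningful only
   for nondegenerate intervals I (including UNIV). *)
definition deriv_on :: "real set \<Rightarrow> (real \<Rightarrow> 'a::real_normed_vector) \<Rightarrow> real \<Rightarrow> 'a" where
  "deriv_on I f x = vector_derivative f (at x within I)"

definition C1_on :: "real set \<Rightarrow> (real \<Rightarrow> 'a::real_normed_vector) \<Rightarrow> bool" where
  "C1_on I f \<longleftrightarrow> f differentiable_on I \<and> continuous_on I (deriv_on I f)"

definition C2_on :: "real set \<Rightarrow> (real \<Rightarrow> 'a::real_normed_vector) \<Rightarrow> bool" where
  "C2_on I f \<longleftrightarrow> f differentiable_on I \<and> C1_on I (deriv_on I f)"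

definition C2_norm :: "real set \<Rightarrow> (real \<Rightarrow> real) \<Rightarrow> real" where
  "C2_norm I f = (SUP x\<in>I. \<bar>f x\<bar>) + (SUP x\<in>I. \<bar>deriv_on I f x\<bar>)
     + (SUP x\<in>I. \<bar>deriv_on I (deriv_on I f) x\<bar>)"

(* The break points form a locally finite set, and on every closed interval between break
   points the curve is C^2 up to the (one-sided) end points. *)
definition piecewise_C2 :: "(real \<Rightarrow> 'a::real_normed_vector) \<Rightarrow> bool" where
  "piecewise_C2 c \<longleftrightarrow> (\<exists>S. (\<forall>a b. finite (S \<inter> {a..b})) \<and>
     (\<forall>a b. a < b \<longrightarrow> {a<..<b} \<inter> S = {} \<longrightarrow> C2_on {a..b} c))"

definition graph_length :: "real \<Rightarrow> (real \<Rightarrow> real) \<Rightarrow> real" where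
  "graph_length T f = integral {0..T} (\<lambda>x. sqrt (1 + (deriv_on {0..T} f x)\<^sup>2))"

definition arclength_param_graph :: "real \<Rightarrow> (real \<Rightarrow> real) \<Rightarrow> (real \<Rightarrow> real^2) \<Rightarrow> bool" where
  "arclength_param_graph T f c \<longleftrightarrow> (let I = {0..graph_length T f} in
     C1_on I c \<and> (\<forall>t\<in>I. norm (deriv_on I c t) = 1) \<and> inj_on c I \<and>
     c 0 = vector [0, f 0] \<and> c ` I = (\<lambda>x. vector [x, f x]) ` {0..T})"

(* For C^2 functions f on {0..T} with T > 0, arclength_param_graph determines the curve
   uniquely on {0..graph_length T f}; its values elsewhere are never used. *)
definition graph_curve :: "real \<Rightarrow> (real \<Rightarrow> real) \<Rightarrow> real \<Rightarrow> real^2" where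
  "graph_curve T f = (SOME c. arclength_param_graph T f c)"

definition periodic_graph_curve :: "real \<Rightarrow> (real \<Rightarrow> real) \<Rightarrow> real \<Rightarrow> real^2" where
  "periodic_graph_curve T f t =
     (let l = graph_length T f; j = real_of_int \<lfloor>t / l\<rfloor>
      in graph_curve T f (t - j * l) + j *\<^sub>R vector [T, f T - f 0])"

abbreviation velocity :: "(real \<Rightarrow> 'a::real_normed_vector) \<Rightarrow> real \<Rightarrow> 'a" where
  "velocity c \<equiv> deriv_on UNIV c"

abbreviation acceleration :: "(real \<Rightarrow> 'a::real_normed_vector) \<Rightarrow> real \<Rightarrow> 'a" where
  "acceleration c \<equiv> velocity (velocity c)"

definition twice_differentiable_at :: "(real \<Rightarrow> 'a::real_normed_vector) \<Rightarrow> real \<Rightarrow> bool" where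
  "twice_differentiable_at c t \<longleftrightarrow>
     (\<forall>\<^sub>F s in nhds t. c differentiable at s) \<and> velocity c differentiable at t"

definition plane_curvature :: "(real \<Rightarrow> real^2) \<Rightarrow> real \<Rightarrow> real" where
  "plane_curvature c t =
     (velocity c t $ 1 * acceleration c t $ 2 - velocity c t $ 2 * acceleration c t $ 1)
       / norm (velocity c t) ^ 3"

(* Signed geodesic curvature in the sphere of radius r about 0, oriented by the outward unit
   normal x /\<^sub>R r: the left-hand unit normal to the curve is the cross product of the outward
   normal with the unit tangent. The reflection (x, y, z) \<mapsto> (x, y, -z) exchanges the two
   orientations and preserves the initial conditions in r_lifting below, so simplicity and
   closedness of liftings do not depend on this choice. *)
definition sphere_curvature :: "real \<Rightarrow> (real \<Rightarrow> real^3) \<Rightarrow> real \<Rightarrow> real" where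
  "sphere_curvature r g t =
     (acceleration g t \<bullet> cross3 (g t /\<^sub>R r) (velocity g t)) / norm (velocity g t) ^ 3"

(* A relation rather than a function: the initial velocity is prescribed only up to sign, so
   there are two liftings, which differ by the half-turn about the first coordinate axis. *)
definition r_lifting :: "real \<Rightarrow> (real \<Rightarrow> real^2) \<Rightarrow> (real \<Rightarrow> real^3) \<Rightarrow> bool" where
  "r_lifting r c g \<longleftrightarrow>
     range g \<subseteq> sphere 0 r \<and> C1_on UNIV g \<and> piecewise_C2 g \<and>
     g 0 = vector [r, 0, 0] \<and> (\<exists>a. velocity g 0 = a *\<^sub>R vector [0, 1, 0]) \<and>
     (\<forall>t. norm (velocity g t) = norm (velocity c t)) \<and>
     (\<forall>t. twice_differentiable_at c t \<longrightarrow>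
        twice_differentiable_at g t \<and> sphere_curvature r g t = plane_curvature c t)"

definition simple_closed :: "(real \<Rightarrow> 'a) \<Rightarrow> bool" where
  "simple_closed g \<longleftrightarrow> (\<exists>P>0. (\<forall>t. g (t + P) = g t) \<and> inj_on g {0..<P})"

end

theory Submission
  imports Defs
begin

text \<open>Rolling a sphere of radius \<open>r\<close> along the graph without slipping and twisting traces the lifting.
  In the parameter \<open>x\<close> and with \<open>\<epsilon> = 1 / r\<close>, the rolling frame is a unit quaternion \<open>\<alpha> + \<beta> j\<close> solving
  a linear equation whose only coefficient is the periodic extension \<open>p\<close> of \<open>f'\<close>; curvature does not
  occur. For small \<open>\<epsilon>\<close>, that is, for a large sphere, the monodromy over one period is a rotation by an
  angle close to \<open>\<epsilon>\<close> times the length of \<open>(T, f T - f 0)\<close>. The angle depends continuously on \<open>\<epsilon>\<close>, so it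
  equals \<open>2 * pi / n\<close> for some \<open>\<epsilon>\<close>, with \<open>n\<close> and a lower bound for \<open>\<epsilon>\<close> depending only on \<open>T\<close> and \<open>D\<close>.
  The lifting then closes up after \<open>n\<close> periods. It is simple because, just as \<open>x\<close> increases along the
  graph, a suitable combination of the angle about the axis and the height along the axis increases
  along the lifting, by exactly \<open>2 * pi\<close> in total.\<close>

section \<open>Linear differential equations depending on a parameter\<close>

text \<open>The number n of periods and the range of \<epsilon> have to be fixed before f, so every
  estimate is uniform in p and involves only T and the bound D for p. The conditions f'(0) = 0 =
  f'(T) make p continuous across the periods.

  Quaternions serve two ends. The real part of the first component of the monodromy is the cosine of
  half the rotation angle, so the intermediate value theorem applies without a choice of branch for
  the angle. And multiplication by a constant from the left preserves the equation; a suitable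
  constant turns the monodromy into multiplication by \<open>cis \<tau>\<close>, so that estimates
  on [0, T] suffice for the whole line.

  The combination of angle and height comes from the flat limit. Along and across a line of slope l
  = (f T - f 0) / T, the point (x, y) has coordinates s = (x + l y) / q and h = (y - l x) / q with q
  = sqrt (1 + l^2). Along a graph s need not be monotone, but s - l h = q x is. On a large sphere
  the angle and the height take the roles of s and h, and the error stays below the gain.\<close>

lemma antiderivative_exists:
  fixes f :: "real \<Rightarrow> 'a::euclidean_space"
  assumes "continuous_on UNIV f"
  obtains F where "F 0 = 0" "\<And>x. (F has_vector_derivative f x) (at x)"
proof -
  have "isCont f x" for x
    using assms by (simp add: continuous_on_eq_continuous_at)
  then obtain F where F: "\<And>x. (F has_vector_derivative f x) (at x)"
    using einterval_antiderivative[of "-\<infinity>" \<infinity> f] by auto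
  have "((\<lambda>x. F x - F 0) has_vector_derivative f x) (at x)" for x
    using has_vector_derivative_diff[OF F[of x] has_vector_derivative_const[of "F 0"]] by simp
  then show ?thesis
    using that[of "\<lambda>x. F x - F 0"] by simp
qed

section \<open>Mean value estimates for vector-valued functions\<close>

lemma vector_derivative_bound:
  fixes F :: "real \<Rightarrow> 'a::real_normed_vector"
  assumes F: "\<And>x. a \<le> x \<Longrightarrow> x \<le> b \<Longrightarrow> (F has_vector_derivative f x) (at x)"
    and G: "\<And>x. a \<le> x \<Longrightarrow> x \<le> b \<Longrightarrow> (G has_real_derivative g x) (at x)"
    and le: "\<And>x. a \<le> x \<Longrightarrow> x \<le> b \<Longrightarrow> norm (f x) \<le> g x"
    and "a \<le> b"
  shows "norm (F b - F a) \<le> G b - G a"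
proof (cases "a = b")
  case False
  show ?thesis
  proof (rule differentiable_bound_general[where f' = f and \<phi>' = g])
    show "a < b" using False assms by simp
    show "continuous_on {a..b} F"
      by (rule continuous_at_imp_continuous_on)
        (use has_vector_derivative_continuous[OF F] in auto)
    show "continuous_on {a..b} G"
      by (rule continuous_at_imp_continuous_on) (use DERIV_isCont[OF G] in auto)
  qed (use F G le in \<open>auto simp: has_real_derivative_iff_has_vector_derivative\<close>)
qed auto

lemma vector_derivative_linear_bound:
  fixes F :: "real \<Rightarrow> 'a::real_normed_vector"
  assumes "\<And>x. a \<le> x \<Longrightarrow> x \<le> b \<Longrightarrow> (F has_vector_derivative f x) (at x)"
    and "\<And>x. a \<le> x \<Longrightarrow> x \<le> b \<Longrightarrow> norm (f x) \<le> K"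
    and "a \<le> b"
  shows "norm (F b - F a) \<le> K * (b - a)"
proof -
  have "((\<lambda>x. K * x) has_real_derivative K) (at x)" for x
    by (auto intro!: derivative_eq_intros)
  from vector_derivative_bound[OF assms(1) this assms(2,3)]
  show ?thesis by (simp add: algebra_simps)
qed

text \<open>Source of the factorials in the series below: each integration raises the power of |x|
  and divides by the new exponent. Negative x are reduced to positive ones by reflection.\<close>

lemma vector_derivative_power_bound:
  fixes F :: "real \<Rightarrow> 'a::real_normed_vector"
  assumes F: "\<And>x. (F has_vector_derivative f x) (at x)" "F 0 = 0"
    and le: "\<And>x. norm (f x) \<le> K * \<bar>x\<bar> ^ n"
  shows "norm (F x) \<le> K * \<bar>x\<bar> ^ Suc n / Suc n"
proof -
  have *: "norm (H x) \<le> K * x ^ Suc n / Suc n" if "0 \<le> x" "H 0 = 0"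
    "\<And>x. (H has_vector_derivative h x) (at x)" "\<And>x. norm (h x) \<le> K * \<bar>x\<bar> ^ n"
    for H h :: "real \<Rightarrow> 'a" and x
  proof -
    have "((\<lambda>x. K * x ^ Suc n / Suc n) has_real_derivative K * x ^ n) (at x)" for x
      by (rule derivative_eq_intros refl | simp)+
    then have "norm (H x - H 0) \<le> K * x ^ Suc n / Suc n - K * 0 ^ Suc n / Suc n"
      by (intro vector_derivative_bound[where f = h and g = "\<lambda>x. K * x ^ n"])
        (use that in \<open>auto intro: order_trans[OF that(4)]\<close>)
    then show ?thesis using that by simp
  qed
  show ?thesis
  proof (cases "0 \<le> x")
    case True
    then show ?thesis using *[of x F f] assms by simp
  next
    case False
    have "((\<lambda>x. F (- x)) has_vector_derivative - f (- x)) (at x)" for x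
    proof -
      have "(uminus has_vector_derivative (- 1)) (at x)"
        by (auto intro!: derivative_eq_intros)
      from vector_diff_chain_at[OF this F(1)[of "- x"]] show ?thesis by (simp add: o_def)
    qed
    then show ?thesis
      using *[of "- x" "\<lambda>x. F (- x)" "\<lambda>x. - f (- x)"] F(2) le[of "- _"] False by simp
  qed
qed

text \<open>The solution is the Peano--Baker series, a power series in the parameter.\<close>

lemma linear_ode_solution:
  fixes L :: "real \<Rightarrow> 'a::euclidean_space \<Rightarrow> 'a"
  assumes lin: "\<And>x. bounded_linear (L x)"
    and bound: "\<And>x v. norm (L x v) \<le> C * norm v"
    and cont: "\<And>y. continuous_on UNIV y \<Longrightarrow> continuous_on UNIV (\<lambda>x. L x (y x))"
  obtains Y :: "real \<Rightarrow> real \<Rightarrow> 'a" where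
    "\<And>\<epsilon>. Y \<epsilon> 0 = v0"
    "\<And>\<epsilon> x. (Y \<epsilon> has_vector_derivative \<epsilon> *\<^sub>R L x (Y \<epsilon> x)) (at x)"
    "\<And>x. continuous_on UNIV (\<lambda>\<epsilon>. Y \<epsilon> x)"
proof -
  define I :: "(real \<Rightarrow> 'a) \<Rightarrow> real \<Rightarrow> 'a" where
    "I f = (SOME F. F 0 = 0 \<and> (\<forall>x. (F has_vector_derivative f x) (at x)))" for f
  have I: "I f 0 = 0 \<and> (\<forall>x. (I f has_vector_derivative f x) (at x))"
    if f: "continuous_on UNIV f" for f
  proof -
    obtain F where "F 0 = 0" "\<And>x. (F has_vector_derivative f x) (at x)"
      by (rule antiderivative_exists[OF f]) (rule that)
    then have "F 0 = 0 \<and> (\<forall>x. (F has_vector_derivative f x) (at x))" by simp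
    then show ?thesis unfolding I_def by (rule someI[where P = "\<lambda>F. F 0 = 0 \<and> (\<forall>x. (F has_vector_derivative f x) (at x))"])
  qed
  \<comment> \<open>The n-fold iterated integral, which is the coefficient of
    \<open>\<epsilon> ^ n\<close> in the series.\<close>
  define y where "y n = ((\<lambda>w. I (\<lambda>x. L x (w x))) ^^ n) (\<lambda>_. v0)" for n
  have y0: "y 0 x = v0" for x
    by (simp add: y_def)
  have ySuc: "y (Suc n) = I (\<lambda>x. L x (y n x))" for n
    by (simp add: y_def)
  have ycont: "continuous_on UNIV (y n)" for n
  proof (induction n)
    case (Suc n)
    then have "(y (Suc n) has_vector_derivative L x (y n x)) (at x)" for x
      using I[OF cont] ySuc by simp
    then show ?case
      by (intro continuous_at_imp_continuous_on ballI has_vector_derivative_continuous)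
  qed (simp add: y_def)
  have yd: "y (Suc n) 0 = 0" "(y (Suc n) has_vector_derivative L x (y n x)) (at x)" for n x
    using I[OF cont[OF ycont]] ySuc by auto
  have C: "C \<ge> 0"
  proof -
    obtain b :: 'a where "b \<in> Basis" by fastforce
    then show ?thesis using order_trans[OF norm_ge_zero bound[of 0 b]] by simp
  qed
  define B where "B n x = norm v0 * (C * \<bar>x\<bar>) ^ n / fact n" for n x
  have yB: "norm (y n x) \<le> B n x" for n x
  proof (induction n arbitrary: x)
    case (Suc n)
    have "norm (L x (y n x)) \<le> (C * (norm v0 * C ^ n / fact n)) * \<bar>x\<bar> ^ n" for x
      using order_trans[OF bound mult_left_mono[OF Suc C]]
      by (simp add: B_def power_mult_distrib mult_ac)
    from vector_derivative_power_bound[OF yd(2) yd(1) this]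
    show ?case
      by (simp add: B_def power_mult_distrib field_simps)
  qed (simp add: B_def y0)
  define t where "t \<epsilon> n x = \<epsilon> ^ n *\<^sub>R y n x" for \<epsilon> :: real and n x
  define M where "M E R n = norm v0 * ((E * (C * R)) ^ n /\<^sub>R fact n)" for E R n
  have M: "summable (M E R)" for E R
    unfolding M_def by (intro summable_mult summable_exp_generic)
  have tM: "norm (t \<epsilon> n x) \<le> M E R n" if "\<bar>\<epsilon>\<bar> \<le> E" "\<bar>x\<bar> \<le> R" for \<epsilon> n x E R
  proof -
    have "norm (t \<epsilon> n x) \<le> \<bar>\<epsilon>\<bar> ^ n * B n x"
      using yB by (simp add: t_def power_abs mult_left_mono)
    also have "\<dots> = norm v0 * ((\<bar>\<epsilon>\<bar> * (C * \<bar>x\<bar>)) ^ n /\<^sub>R fact n)"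
      by (simp add: B_def field_simps power_mult_distrib)
    also have "\<dots> \<le> M E R n"
      unfolding M_def using that C
      by (intro mult_left_mono scaleR_left_mono power_mono mult_mono) auto
    finally show ?thesis .
  qed
  have ts: "summable (\<lambda>n. t \<epsilon> n x)" for \<epsilon> x
    using tM[OF order.refl order.refl] by (rule summable_comparison_test'[OF M])
  define Y where "Y \<epsilon> x = (\<Sum>n. t \<epsilon> n x)" for \<epsilon> x
  have "Y \<epsilon> 0 = v0" for \<epsilon>
  proof -
    have "t \<epsilon> n 0 = (if n = 0 then v0 else 0)" for n
      by (cases n) (auto simp: t_def y0 yd)
    then show ?thesis
      using sums_single[of 0 "\<lambda>_. v0"] unfolding Y_def by (simp add: sums_iff)
  qed
  moreover have "(Y \<epsilon> has_vector_derivative \<epsilon> *\<^sub>R L x (Y \<epsilon> x)) (at x)" for \<epsilon> x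
  proof -
    define R where "R = \<bar>x\<bar> + 1"
    \<comment> \<open>The termwise derivatives. The term for n = 0 is constant in z, and each later
      one is L applied to its predecessor, so the derived series is the original one shifted by one
      place.\<close>
    define t' where "t' n z = (case n of 0 \<Rightarrow> 0 | Suc m \<Rightarrow> \<epsilon> *\<^sub>R L z (t \<epsilon> m z))" for n z
    have td: "(t \<epsilon> n has_vector_derivative t' n z) (at z)" for n z
    proof (cases n)
      case 0
      then show ?thesis by (simp add: t_def[abs_def] t'_def y_def)
    next
      case (Suc m)
      have "((\<lambda>z. \<epsilon> ^ n *\<^sub>R y n z) has_vector_derivative \<epsilon> ^ n *\<^sub>R L z (y m z)) (at z)"
        using has_vector_derivative_scaleR[OF DERIV_const yd(2)[of m z], of "\<epsilon> ^ n"] Suc by simp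
      moreover have "\<epsilon> ^ n *\<^sub>R L z (y m z) = t' n z"
        using linear_cmul[OF bounded_linear.linear[OF lin]] by (simp add: t'_def t_def Suc)
      ultimately show ?thesis by (simp add: t_def[abs_def])
    qed
    have t's: "(\<lambda>n. t' n z) sums (\<epsilon> *\<^sub>R L z (Y \<epsilon> z))" for z
    proof -
      have "(\<lambda>n. t \<epsilon> n z) sums Y \<epsilon> z"
        using ts unfolding Y_def by (rule summable_sums)
      then have "(\<lambda>m. \<epsilon> *\<^sub>R L z (t \<epsilon> m z)) sums (\<epsilon> *\<^sub>R L z (Y \<epsilon> z))"
        by (intro sums_scaleR_right bounded_linear.sums[OF lin])
      then have "(\<lambda>m. t' (Suc m) z) sums (\<epsilon> *\<^sub>R L z (Y \<epsilon> z))"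
        by (simp add: t'_def)
      then show ?thesis
        using sums_Suc_iff[of "\<lambda>n. t' n z"] by (simp add: t'_def)
    qed
    define N where "N n = (case n of 0 \<Rightarrow> 0 | Suc m \<Rightarrow> \<bar>\<epsilon>\<bar> * (C * M \<bar>\<epsilon>\<bar> R m))" for n
    have "summable (\<lambda>m. N (Suc m))"
      unfolding N_def by (auto intro!: summable_mult M)
    then have N: "summable N" by (simp only: summable_Suc_iff)
    have t'N: "norm (t' n z) \<le> N n" if "z \<in> ball 0 R" for n z
    proof (cases n)
      case (Suc m)
      have "norm (t \<epsilon> m z) \<le> M \<bar>\<epsilon>\<bar> R m"
        using that by (intro tM) auto
      then have "norm (L z (t \<epsilon> m z)) \<le> C * M \<bar>\<epsilon>\<bar> R m"
        using order_trans[OF bound mult_left_mono[OF _ C]] by blast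
      then show ?thesis using Suc by (simp add: t'_def N_def mult_left_mono)
    qed (simp add: t'_def N_def)
    have "uniform_limit (ball 0 R) (\<lambda>n z. \<Sum>i<n. t' i z) (\<lambda>z. \<Sum>i. t' i z) sequentially"
      using t'N N by (rule Weierstrass_m_test)
    then have ul: "uniform_limit (ball 0 R) (\<lambda>n z. \<Sum>i<n. t' i z) (\<lambda>z. \<epsilon> *\<^sub>R L z (Y \<epsilon> z)) sequentially"
      using t's by (simp add: sums_iff)
    have "\<exists>g. \<forall>z\<in>ball 0 R. (\<lambda>n. t \<epsilon> n z) sums g z \<and>
        (g has_derivative (\<lambda>h. h *\<^sub>R (\<epsilon> *\<^sub>R L z (Y \<epsilon> z)))) (at z within ball 0 R)"
    proof (rule has_derivative_series)
      show "(t \<epsilon> n has_derivative (\<lambda>h. h *\<^sub>R t' n z)) (at z within ball 0 R)" for n z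
        using td has_vector_derivative_def has_derivative_at_withinI by blast
      show "(\<lambda>n. t \<epsilon> n x) sums Y \<epsilon> x"
        using ts unfolding Y_def by (rule summable_sums)
      show "x \<in> ball 0 R" by (simp add: R_def)
      fix e :: real assume "e > 0"
      with ul have "\<forall>\<^sub>F n in sequentially. \<forall>z\<in>ball (0::real) R. dist (\<Sum>i<n. t' i z) (\<epsilon> *\<^sub>R L z (Y \<epsilon> z)) < e"
        by (simp add: uniform_limit_iff)
      then show "\<forall>\<^sub>F n in sequentially. \<forall>z\<in>ball (0::real) R. \<forall>h.
          norm ((\<Sum>i<n. h *\<^sub>R t' i z) - h *\<^sub>R (\<epsilon> *\<^sub>R L z (Y \<epsilon> z))) \<le> e * norm h"
      proof (rule eventually_mono, intro ballI allI)
        fix n and z h :: real assume *: "\<forall>z\<in>ball (0::real) R. dist (\<Sum>i<n. t' i z) (\<epsilon> *\<^sub>R L z (Y \<epsilon> z)) < e" "z \<in> ball 0 R"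
        have "(\<Sum>i<n. h *\<^sub>R t' i z) - h *\<^sub>R (\<epsilon> *\<^sub>R L z (Y \<epsilon> z))
            = h *\<^sub>R ((\<Sum>i<n. t' i z) - \<epsilon> *\<^sub>R L z (Y \<epsilon> z))"
          by (simp add: scaleR_sum_right scaleR_diff_right)
        also have "norm \<dots> \<le> \<bar>h\<bar> * e"
          using * by (simp only: norm_scaleR dist_norm) (simp add: mult_left_mono less_imp_le)
        finally show "norm ((\<Sum>i<n. h *\<^sub>R t' i z) - h *\<^sub>R (\<epsilon> *\<^sub>R L z (Y \<epsilon> z))) \<le> e * norm h"
          by (simp add: mult_ac)
      qed
    qed auto
    then obtain g where g: "\<And>z. z \<in> ball 0 R \<Longrightarrow> (\<lambda>n. t \<epsilon> n z) sums g z"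
      "\<And>z. z \<in> ball 0 R \<Longrightarrow> (g has_derivative (\<lambda>h. h *\<^sub>R (\<epsilon> *\<^sub>R L z (Y \<epsilon> z)))) (at z within ball 0 R)"
      by blast
    have x: "x \<in> ball 0 R" by (simp add: R_def)
    have "(g has_vector_derivative \<epsilon> *\<^sub>R L x (Y \<epsilon> x)) (at x)"
      using g(2)[OF x] at_within_open[OF x open_ball] by (simp add: has_vector_derivative_def)
    then show ?thesis
    proof (rule has_vector_derivative_transform_within_open)
      show "open (ball 0 R)" "x \<in> ball 0 R" using x by auto
      show "g z = Y \<epsilon> z" if "z \<in> ball 0 R" for z
        using g(1)[OF that] by (simp add: Y_def sums_iff)
    qed
  qed
  moreover have "continuous_on UNIV (\<lambda>\<epsilon>. Y \<epsilon> x)" for x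
  proof -
    \<comment> \<open>With x fixed, the same majorant gives uniform convergence for \<epsilon> in
      any ball.\<close>
    have "continuous_on (ball 0 E) (\<lambda>\<epsilon>. Y \<epsilon> x)" for E
    proof (rule uniform_limit_theorem)
      show "uniform_limit (ball 0 E) (\<lambda>n \<epsilon>. \<Sum>i<n. t \<epsilon> i x) (\<lambda>\<epsilon>. Y \<epsilon> x) sequentially"
        unfolding Y_def
        by (rule Weierstrass_m_test[OF _ M[of E "\<bar>x\<bar>"]]) (auto intro: tM)
      show "\<forall>\<^sub>F n in sequentially. continuous_on (ball 0 E) (\<lambda>\<epsilon>. \<Sum>i<n. t \<epsilon> i x)"
        unfolding t_def by (intro always_eventually allI continuous_intros)
    qed simp
    then have "continuous_on (ball 0 (\<bar>\<epsilon>\<bar> + 1)) (\<lambda>\<epsilon>. Y \<epsilon> x)" for \<epsilon> by blast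
    then have "isCont (\<lambda>\<epsilon>. Y \<epsilon> x) \<epsilon>" for \<epsilon>
      using continuous_on_eq_continuous_at[OF open_ball, of 0 "\<bar>\<epsilon>\<bar> + 1"] by force
    then show ?thesis by (simp add: continuous_at_imp_continuous_on)
  qed
  ultimately show ?thesis using that by blast
qed

section \<open>The spinor equation of a rolling sphere\<close>

lemma constant_if_vector_derivative_zero:
  fixes f :: "real \<Rightarrow> 'a::real_normed_vector"
  assumes "\<And>x. (f has_vector_derivative 0) (at x)"
  shows "f x = f y"
  using has_vector_derivative_zero_constant[of UNIV f] assms by (metis UNIV_I convex_UNIV)

lemmas has_vector_derivative_cnj' = bounded_linear.has_vector_derivative[OF bounded_linear_cnj]

text \<open>The spin lift of the equations \<open>e\<^sub>1' = \<epsilon> (u + p v)\<close>, \<open>u' = - \<epsilon> e\<^sub>1\<close>, \<open>v' = - \<epsilon> p e\<^sub>1\<close> for the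
  position \<open>e\<^sub>1\<close> and a tangent frame \<open>u, v\<close> on the unit sphere.\<close>

definition spinor :: "(real \<Rightarrow> real) \<Rightarrow> real \<Rightarrow> (real \<Rightarrow> complex) \<Rightarrow> (real \<Rightarrow> complex) \<Rightarrow> bool" where
  "spinor p \<epsilon> \<alpha> \<beta> \<longleftrightarrow> (\<forall>x.
     (\<alpha> has_vector_derivative of_real (\<epsilon> / 2) * (of_real (p x) + \<i>) * \<beta> x) (at x) \<and>
     (\<beta> has_vector_derivative of_real (\<epsilon> / 2) * (\<i> - of_real (p x)) * \<alpha> x) (at x))"

lemma spinorD:
  assumes "spinor p \<epsilon> \<alpha> \<beta>"
  shows "(\<alpha> has_vector_derivative of_real (\<epsilon> / 2) * (of_real (p x) + \<i>) * \<beta> x) (at x)"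
    and "(\<beta> has_vector_derivative of_real (\<epsilon> / 2) * (\<i> - of_real (p x)) * \<alpha> x) (at x)"
  using assms by (auto simp: spinor_def)

lemma spinor_continuous:
  assumes "spinor p \<epsilon> \<alpha> \<beta>"
  shows "continuous_on S \<alpha>" "continuous_on S \<beta>"
  using has_vector_derivative_continuous[OF spinorD(1)[OF assms]]
    has_vector_derivative_continuous[OF spinorD(2)[OF assms]]
  by (auto intro: continuous_at_imp_continuous_on)

lemma cmod_of_real_plus_ii:
  "cmod (of_real p + \<i>) = sqrt (1 + p\<^sup>2)" "cmod (\<i> - of_real p) = sqrt (1 + p\<^sup>2)"
  by (simp_all add: cmod_def add.commute)

text \<open>Continuity in \<epsilon> at fixed x is recorded for A because the intermediate value
  theorem will be applied to \<open>Re (A \<epsilon> T)\<close>.\<close>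

lemma spinor_exists:
  assumes p: "continuous_on UNIV p" and D: "\<And>x. \<bar>p x\<bar> \<le> D"
  obtains A B :: "real \<Rightarrow> real \<Rightarrow> complex" where
    "\<And>\<epsilon>. spinor p \<epsilon> (A \<epsilon>) (B \<epsilon>)" "\<And>\<epsilon>. A \<epsilon> 0 = 1" "\<And>\<epsilon>. B \<epsilon> 0 = 0"
    "\<And>x. continuous_on UNIV (\<lambda>\<epsilon>. A \<epsilon> x)"
proof -
  define L :: "real \<Rightarrow> complex \<times> complex \<Rightarrow> complex \<times> complex" where
    "L x v = ((of_real (p x) + \<i>) / 2 * snd v, (\<i> - of_real (p x)) / 2 * fst v)" for x v
  obtain Y where Y: "\<And>\<epsilon>. Y \<epsilon> 0 = (1, 0)"
    "\<And>\<epsilon> x. (Y \<epsilon> has_vector_derivative \<epsilon> *\<^sub>R L x (Y \<epsilon> x)) (at x)"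
    "\<And>x. continuous_on UNIV (\<lambda>\<epsilon>. Y \<epsilon> x)"
  proof (rule linear_ode_solution[of L "sqrt (1 + D\<^sup>2)" "(1, 0)"])
    show "bounded_linear (L x)" for x
      unfolding L_def
      by (intro bounded_linear_Pair bounded_linear_const_mult bounded_linear_fst bounded_linear_snd)
    show "norm (L x v) \<le> sqrt (1 + D\<^sup>2) * norm v" for x v
    proof -
      \<comment> \<open>\<open>L x\<close> is \<open>sqrt (1 + (p x)\<^sup>2) / 2\<close> times a
        unitary map that exchanges the components.\<close>
      have eq: "norm (L x v) = sqrt (1 + (p x)\<^sup>2) / 2 * norm v"
      proof -
        have "norm (L x v) = sqrt ((sqrt (1 + (p x)\<^sup>2) / 2 * cmod (snd v))\<^sup>2 + (sqrt (1 + (p x)\<^sup>2) / 2 * cmod (fst v))\<^sup>2)"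
          by (simp only: L_def norm_prod_def norm_mult norm_divide cmod_of_real_plus_ii
              fst_conv snd_conv norm_numeral)
        also have "\<dots> = sqrt ((sqrt (1 + (p x)\<^sup>2) / 2)\<^sup>2 * ((cmod (fst v))\<^sup>2 + (cmod (snd v))\<^sup>2))"
          by (simp only: power_mult_distrib distrib_left add.commute)
        also have "\<dots> = sqrt (1 + (p x)\<^sup>2) / 2 * norm v"
          by (simp only: real_sqrt_mult) (simp add: norm_prod_def)
        finally show ?thesis .
      qed
      have "sqrt (1 + (p x)\<^sup>2) \<le> sqrt (1 + D\<^sup>2)"
        using D[of x] by (simp add: abs_le_square_iff[symmetric])
      then have "sqrt (1 + (p x)\<^sup>2) / 2 \<le> sqrt (1 + D\<^sup>2)"
        by (smt (verit) field_sum_of_halves real_sqrt_ge_zero zero_le_power2)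
      then show ?thesis
        unfolding eq by (intro mult_right_mono) auto
    qed
    show "continuous_on UNIV (\<lambda>x. L x (y x))" if "continuous_on UNIV y" for y
      unfolding L_def using that p by (intro continuous_intros) auto
  qed blast
  show ?thesis
  proof
    show "spinor p \<epsilon> (\<lambda>x. fst (Y \<epsilon> x)) (\<lambda>x. snd (Y \<epsilon> x))" for \<epsilon>
      unfolding spinor_def
      using bounded_linear.has_vector_derivative[OF bounded_linear_fst Y(2)[of \<epsilon>]]
        bounded_linear.has_vector_derivative[OF bounded_linear_snd Y(2)[of \<epsilon>]]
      by (auto simp: L_def scaleR_conv_of_real mult.assoc)
    show "continuous_on UNIV (\<lambda>\<epsilon>. fst (Y \<epsilon> x))" for x
      using Y(3) by (intro continuous_intros)
  qed (simp_all add: Y)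
qed

text \<open>The coefficient matrix is skew-Hermitian, since the conjugate of p + \<i> is the
  negative of \<i> - p.\<close>

lemma spinor_norm:
  assumes "spinor p \<epsilon> \<alpha> \<beta>"
  shows "(cmod (\<alpha> x))\<^sup>2 + (cmod (\<beta> x))\<^sup>2 = (cmod (\<alpha> 0))\<^sup>2 + (cmod (\<beta> 0))\<^sup>2"
proof -
  note d = spinorD[OF assms]
  note dc = d[THEN has_vector_derivative_cnj']
  have "((\<lambda>x. \<alpha> x * cnj (\<alpha> x) + \<beta> x * cnj (\<beta> x)) has_vector_derivative 0) (at x)" for x
    by (rule has_vector_derivative_eq_rhs[OF has_vector_derivative_add[OF
            has_vector_derivative_mult[OF d(1) dc(1)] has_vector_derivative_mult[OF d(2) dc(2)]]])
      (simp add: field_simps)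
  from constant_if_vector_derivative_zero[OF this, of x 0]
  have "complex_of_real ((cmod (\<alpha> x))\<^sup>2 + (cmod (\<beta> x))\<^sup>2) = of_real ((cmod (\<alpha> 0))\<^sup>2 + (cmod (\<beta> 0))\<^sup>2)"
    by (simp only: complex_norm_square of_real_add)
  then show ?thesis using of_real_eq_iff by blast
qed

text \<open>Multiplication of the quaternion \<open>\<alpha> + \<beta> j\<close> by the constant \<open>a + b j\<close> from the left.\<close>

lemma spinor_left_mult:
  assumes "spinor p \<epsilon> \<alpha> \<beta>"
  shows "spinor p \<epsilon> (\<lambda>x. a * \<alpha> x - b * cnj (\<beta> x)) (\<lambda>x. a * \<beta> x + b * cnj (\<alpha> x))"
proof -
  note d = spinorD[OF assms]
  note dc = d[THEN has_vector_derivative_cnj']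
  have "((\<lambda>x. a * \<alpha> x - b * cnj (\<beta> x)) has_vector_derivative
      of_real (\<epsilon> / 2) * (of_real (p x) + \<i>) * (a * \<beta> x + b * cnj (\<alpha> x))) (at x)" for x
    by (rule has_vector_derivative_eq_rhs[OF has_vector_derivative_diff[OF
            has_vector_derivative_mult_right[OF d(1)] has_vector_derivative_mult_right[OF dc(2)]]])
      (simp add: field_simps)
  moreover have "((\<lambda>x. a * \<beta> x + b * cnj (\<alpha> x)) has_vector_derivative
      of_real (\<epsilon> / 2) * (\<i> - of_real (p x)) * (a * \<alpha> x - b * cnj (\<beta> x))) (at x)" for x
    by (rule has_vector_derivative_eq_rhs[OF has_vector_derivative_add[OF
            has_vector_derivative_mult_right[OF d(2)] has_vector_derivative_mult_right[OF dc(1)]]])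
      (simp add: field_simps)
  ultimately show ?thesis by (simp add: spinor_def)
qed

lemma spinor_unique:
  assumes 1: "spinor p \<epsilon> \<alpha> \<beta>" and 2: "spinor p \<epsilon> \<alpha>' \<beta>'"
    and 0: "\<alpha> 0 = \<alpha>' 0" "\<beta> 0 = \<beta>' 0"
  shows "\<alpha> x = \<alpha>' x" "\<beta> x = \<beta>' x"
proof -
  have "spinor p \<epsilon> (\<lambda>x. \<alpha> x - \<alpha>' x) (\<lambda>x. \<beta> x - \<beta>' x)"
    unfolding spinor_def right_diff_distrib[of _ "\<alpha> _"] right_diff_distrib[of _ "\<beta> _"]
    by (intro allI conjI has_vector_derivative_diff spinorD[OF 1] spinorD[OF 2])
  from spinor_norm[OF this, of x] show "\<alpha> x = \<alpha>' x" "\<beta> x = \<beta>' x"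
    using 0 by (simp_all add: add_nonneg_eq_0_iff)
qed

text \<open>The translate by T solves the equation because p is periodic, the multiple by \<mu>
  because it is a left multiplication; the two agree at 0.\<close>

lemma spinor_floquet:
  assumes s: "spinor p \<epsilon> \<alpha> \<beta>" and per: "\<And>x. p (x + T) = p x"
    and T: "\<alpha> T = \<mu> * \<alpha> 0" "\<beta> T = \<mu> * \<beta> 0"
  shows "\<alpha> (x + T) = \<mu> * \<alpha> x" "\<beta> (x + T) = \<mu> * \<beta> x"
proof -
  have shift: "((\<lambda>x. f (x + T)) has_vector_derivative f' (x + T)) (at x)"
    if "\<And>x. (f has_vector_derivative f' x) (at x)" for f f' :: "real \<Rightarrow> complex" and x
  proof -
    have "((\<lambda>x. x + T) has_vector_derivative 1) (at x)"
      by (auto intro!: derivative_eq_intros)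
    from vector_diff_chain_at[OF this that[of "x + T"]] show ?thesis by (simp add: o_def)
  qed
  have 1: "spinor p \<epsilon> (\<lambda>x. \<alpha> (x + T)) (\<lambda>x. \<beta> (x + T))"
    using shift[OF spinorD(1)[OF s]] shift[OF spinorD(2)[OF s]] per by (simp add: spinor_def)
  have 2: "spinor p \<epsilon> (\<lambda>x. \<mu> * \<alpha> x) (\<lambda>x. \<mu> * \<beta> x)"
    using spinor_left_mult[OF s, of \<mu> 0] by simp
  show "\<alpha> (x + T) = \<mu> * \<alpha> x" "\<beta> (x + T) = \<mu> * \<beta> x"
    using spinor_unique[OF 1 2] T by simp_all
qed

text \<open>Three rounds of integration over one period, each feeding on the one before: |\<alpha>|
  \<le> 1 bounds \<beta>, this bounds \<alpha> - 1, and this bounds the deviation of \<beta> from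
  its part linear in \<epsilon>. Each round contributes a factor \<kappa> / 2.\<close>

lemma spinor_bounds:
  fixes T :: real
  assumes s: "spinor p \<epsilon> \<alpha> \<beta>" and 0: "\<alpha> 0 = 1" "\<beta> 0 = 0"
    and D: "\<And>x. \<bar>p x\<bar> \<le> D" and e: "0 \<le> \<epsilon>"
    and P: "\<And>x. (P has_real_derivative p x) (at x)"
  defines "C \<equiv> sqrt (1 + D\<^sup>2)"
  defines "\<kappa> \<equiv> \<epsilon> * C * T"
  assumes x: "0 \<le> x" "x \<le> T"
  shows "cmod (\<beta> x) \<le> \<kappa> / 2" and "cmod (\<alpha> x - 1) \<le> \<kappa>\<^sup>2 / 4"
    and "cmod (\<beta> x - of_real (\<epsilon> / 2) * (\<i> * of_real x - of_real (P x - P 0))) \<le> \<kappa> ^ 3 / 8"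
proof -
  note d = spinorD[OF s]
  have C: "C \<ge> 0" by (simp add: C_def)
  have T: "T \<ge> 0" using x by simp
  have \<kappa>: "\<kappa> \<ge> 0" using C T e by (simp add: \<kappa>_def)
  have pC: "cmod (of_real (p y) + \<i>) \<le> C" "cmod (\<i> - of_real (p y)) \<le> C" for y
    using D[of y] by (simp_all add: C_def cmod_of_real_plus_ii abs_le_square_iff[symmetric])
  have mm: "cmod (of_real (\<epsilon> / 2) * u * w) \<le> \<epsilon> / 2 * C * M" if "cmod u \<le> C" "cmod w \<le> M" for u w M
    using mult_mono[OF that C norm_ge_zero] e
    by (simp add: norm_mult mult_left_mono mult.assoc)
  have step: "\<epsilon> / 2 * C * M * x \<le> \<kappa> * M / 2" if "M \<ge> 0" "0 \<le> x" "x \<le> T" for x M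
  proof -
    have "(\<epsilon> / 2 * C * M) * x \<le> (\<epsilon> / 2 * C * M) * T"
      using that e C by (intro mult_left_mono) auto
    then show ?thesis by (simp add: \<kappa>_def mult_ac)
  qed
  have nrm: "(cmod (\<alpha> y))\<^sup>2 + (cmod (\<beta> y))\<^sup>2 = 1" for y
    using spinor_norm[OF s, of y] 0 by simp
  have a1: "cmod (\<alpha> y) \<le> 1" for y
    using nrm[of y] by (metis abs_le_square_iff abs_norm_cancel abs_one le_add_same_cancel1 one_power2 zero_le_power2)
  have b: "cmod (\<beta> y) \<le> \<kappa> / 2" if "0 \<le> y" "y \<le> T" for y
  proof -
    have "cmod (\<beta> y - \<beta> 0) \<le> \<epsilon> / 2 * C * 1 * (y - 0)"
      by (rule vector_derivative_linear_bound[OF d(2)], rule mm) (use that a1 pC in auto)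
    with step[OF _ that, of 1] show ?thesis by (simp add: 0)
  qed
  have a: "cmod (\<alpha> y - 1) \<le> \<kappa>\<^sup>2 / 4" if "0 \<le> y" "y \<le> T" for y
  proof -
    have "cmod (\<alpha> y - \<alpha> 0) \<le> \<epsilon> / 2 * C * (\<kappa> / 2) * (y - 0)"
      by (rule vector_derivative_linear_bound[OF d(1)], rule mm) (use that b pC in auto)
    with step[OF _ that, of "\<kappa> / 2"] show ?thesis using \<kappa> by (simp add: 0 power2_eq_square)
  qed
  show "cmod (\<beta> x) \<le> \<kappa> / 2" "cmod (\<alpha> x - 1) \<le> \<kappa>\<^sup>2 / 4"
    using a b x by auto
  \<comment> \<open>The remainder of \<beta> after its linear part; its derivative contains \<alpha>
    - 1 where that of \<beta> contains \<alpha>.\<close>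
  define F where "F y = \<beta> y - of_real (\<epsilon> / 2) * (\<i> * of_real y - of_real (P y - P 0))" for y
  have "(F has_vector_derivative of_real (\<epsilon> / 2) * (\<i> - of_real (p y)) * (\<alpha> y - 1)) (at y)" for y
  proof -
    have h1: "((\<lambda>y. complex_of_real (P y - P 0)) has_vector_derivative of_real (p y)) (at y)"
      using P[of y]
      by (intro has_vector_derivative_of_real) (auto intro!: derivative_eq_intros)
    have h2: "((\<lambda>y. \<i> * complex_of_real y) has_vector_derivative \<i> * of_real 1) (at y)"
      by (intro has_vector_derivative_mult_right has_vector_derivative_of_real) simp
    have "((\<lambda>y. \<beta> y - of_real (\<epsilon> / 2) * (\<i> * of_real y - of_real (P y - P 0)))
       has_vector_derivative of_real (\<epsilon> / 2) * (\<i> - of_real (p y)) * \<alpha> y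
         - of_real (\<epsilon> / 2) * (\<i> * of_real 1 - of_real (p y))) (at y)"
      by (rule has_vector_derivative_diff[OF d(2)
            has_vector_derivative_mult_right[OF has_vector_derivative_diff[OF h2 h1]]])
    then show ?thesis
      unfolding F_def by (rule has_vector_derivative_eq_rhs) (simp add: field_simps)
  qed
  then have "cmod (F x - F 0) \<le> \<epsilon> / 2 * C * (\<kappa>\<^sup>2 / 4) * (x - 0)"
    by (rule vector_derivative_linear_bound, intro mm) (use x a pC in auto)
  with step[OF _ x, of "\<kappa>\<^sup>2 / 4"] have "cmod (F x - F 0) \<le> \<kappa> ^ 3 / 8"
    by (simp add: power2_eq_square power3_eq_cube)
  then show "cmod (\<beta> x - of_real (\<epsilon> / 2) * (\<i> * of_real x - of_real (P x - P 0))) \<le> \<kappa> ^ 3 / 8"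
    by (simp add: F_def 0)
qed

section \<open>Winding about the axis of the monodromy\<close>

lemma shift_invariant_add_of_int:
  fixes T :: real
  assumes "\<And>x. P (x + T) \<longleftrightarrow> P x"
  shows "P (x + of_int j * T) \<longleftrightarrow> P x"
proof (induction j arbitrary: x rule: int_induct[where k = 0])
  case (step1 i)
  then show ?case using assms[of "x + of_int i * T"] by (simp add: algebra_simps)
next
  case (step2 i)
  then show ?case using assms[of "x + of_int (i - 1) * T"] by (simp add: algebra_simps)
qed simp

lemma floor_reduction:
  fixes T x :: real
  assumes "T > 0"
  obtains y where "0 \<le> y" "y < T" "x = y + of_int \<lfloor>x / T\<rfloor> * T"
proof
  show "0 \<le> x - of_int \<lfloor>x / T\<rfloor> * T"
    using assms of_int_floor_le[of "x / T"] by (simp add: pos_le_divide_eq[symmetric])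
  show "x - of_int \<lfloor>x / T\<rfloor> * T < T"
    using assms floor_correct[of "x / T"] by (simp add: pos_divide_less_eq algebra_simps)
qed simp

lemma shift_invariant_reduce:
  fixes T :: real
  assumes "T > 0" "\<And>x. P (x + T) \<longleftrightarrow> P x" "\<And>x. 0 \<le> x \<Longrightarrow> x \<le> T \<Longrightarrow> P x"
  shows "P x"
  by (rule floor_reduction[OF assms(1), of x])
    (metis assms(3) less_imp_le shift_invariant_add_of_int[of P T, OF assms(2)])

text \<open>The product of f and exp (- G) has derivative 0. This provides a continuous argument of
  a nowhere vanishing function on the whole line, namely Im G up to a constant.\<close>

lemma exp_antiderivative:
  fixes f :: "real \<Rightarrow> complex"
  assumes f: "\<And>x. (f has_vector_derivative g x * f x) (at x)"
    and G: "G 0 = 0" "\<And>x. (G has_vector_derivative g x) (at x)"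
  shows "f x = f 0 * exp (G x)"
proof -
  have "((\<lambda>x. exp (- G x)) has_vector_derivative - g x * exp (- G x)) (at x)" for x
    by (rule has_vector_derivative_eq_rhs,
        rule field_vector_diff_chain_at[OF has_vector_derivative_minus[OF G(2)] DERIV_exp, unfolded o_def])
      simp
  from has_vector_derivative_mult[OF f this]
  have "((\<lambda>x. f x * exp (- G x)) has_vector_derivative 0) (at x)" for x
    by (rule has_vector_derivative_eq_rhs) simp
  from constant_if_vector_derivative_zero[OF this, of x 0]
  have "f x * exp (- G x) = f 0" by (simp add: G)
  then show ?thesis by (simp add: exp_minus field_simps)
qed

lemma Im_of_real_mult: "Im (of_real r * z) = r * Im z"
  by simp

text \<open>The first summand is the imaginary part of the logarithmic derivative of the product of
  the two spinor components, the real part in the second is the derivative of the squared modulus of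
  the first component; both are divided by \<epsilon>.\<close>

definition winding_rate :: "real \<Rightarrow> real \<Rightarrow> complex \<Rightarrow> complex \<Rightarrow> real" where
  "winding_rate l p a b =
     Im ((of_real p + \<i>) * (b / a) + (\<i> - of_real p) * (a / b)) / 2
     - l * Re ((of_real p + \<i>) * (b * cnj a))"

text \<open>For a solution of Floquet type, \<open>\<alpha> \<beta>\<close> and \<open>|\<alpha>|\<^sup>2\<close> are, up to affine changes, the coordinates
  of the point of the sphere orthogonal to and along the axis of the monodromy rotation. The angle
  \<open>arg (\<alpha> \<beta>)\<close> about this axis need not be monotone along the curve, but \<open>arg (\<alpha> \<beta>) - l |\<alpha>|\<^sup>2\<close> is;
  its derivative is \<open>\<epsilon>\<close> times the winding rate.\<close>

lemma spinor_winding: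
  fixes T :: real and n :: nat
  assumes s: "spinor p \<epsilon> \<alpha> \<beta>" and p: "continuous_on UNIV p"
    and per: "\<And>x. p (x + T) = p x" and T: "T > 0"
    and flo: "\<alpha> T = cis \<tau> * \<alpha> 0" "\<beta> T = cis \<tau> * \<beta> 0"
    and \<tau>: "0 < \<tau>" "\<tau> < pi" "real n * \<tau> = pi"
    and nz0: "\<And>x. 0 \<le> x \<Longrightarrow> x \<le> T \<Longrightarrow> \<alpha> x \<noteq> 0 \<and> \<beta> x \<noteq> 0"
    and h0: "\<And>x. 0 \<le> x \<Longrightarrow> x \<le> T \<Longrightarrow> 0 < \<epsilon> * winding_rate l (p x) (\<alpha> x) (\<beta> x)"
      "\<And>x. 0 \<le> x \<Longrightarrow> x \<le> T \<Longrightarrow> \<epsilon> * winding_rate l (p x) (\<alpha> x) (\<beta> x) \<le> K"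
    and K: "K * T < 2 * pi"
    and xy: "x < y" "y < x + real n * T"
    and eq: "\<alpha> x * \<beta> x = \<alpha> y * \<beta> y" "cmod (\<alpha> x) = cmod (\<alpha> y)"
  shows False
proof -
  note d = spinorD[OF s]
  note fl = spinor_floquet[OF s per flo]
  define h where "h x = \<epsilon> * winding_rate l (p x) (\<alpha> x) (\<beta> x)" for x
  have cis0: "cis \<tau> \<noteq> 0" by simp
  have nz: "\<alpha> x \<noteq> 0 \<and> \<beta> x \<noteq> 0" for x
    by (rule shift_invariant_reduce[OF T, where P = "\<lambda>x. \<alpha> x \<noteq> 0 \<and> \<beta> x \<noteq> 0"]) (use nz0 fl in auto)
  \<comment> \<open>The phase gained over one period cancels in b / a, in a / b and in
    \<open>b * cnj a\<close>, so the rate is periodic.\<close>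
  have cc: "cis \<tau> * b * cnj (cis \<tau> * a) = b * cnj a" for a b
    by (simp add: cis_cnj mult_ac) (simp add: cis_mult flip: mult.assoc)
  have hper: "h (x + T) = h x" for x
    using cis0 by (simp only: h_def winding_rate_def fl per cc) simp
  have h: "0 < h x \<and> h x \<le> K" for x
  proof (rule shift_invariant_reduce[OF T, where P = "\<lambda>x. 0 < h x \<and> h x \<le> K"])
    show "0 < h x \<and> h x \<le> K" if "0 \<le> x" "x \<le> T" for x
      using h0 that by (simp add: h_def)
  qed (simp add: hper)
  define g where "g x = of_real (\<epsilon> / 2) * ((of_real (p x) + \<i>) * (\<beta> x / \<alpha> x) + (\<i> - of_real (p x)) * (\<alpha> x / \<beta> x))" for x
  have "continuous_on UNIV g"
    unfolding g_def using nz by (intro continuous_intros p spinor_continuous[OF s]) auto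
  then obtain G where G: "G 0 = 0" "\<And>x. (G has_vector_derivative g x) (at x)"
    using antiderivative_exists by metis
  have "((\<lambda>x. \<alpha> x * \<beta> x) has_vector_derivative g x * (\<alpha> x * \<beta> x)) (at x)" for x
    using nz[of x]
    by (intro has_vector_derivative_eq_rhs[OF has_vector_derivative_mult[OF d]])
      (simp add: g_def field_simps)
  from exp_antiderivative[OF this G]
  have expG: "\<alpha> x * \<beta> x = \<alpha> 0 * \<beta> 0 * exp (G x)" for x .
  \<comment> \<open>A factor z of modulus 1 between two values of \<alpha> \<beta> does not change
    Re G, so z is determined by the increment of Im G alone.\<close>
  have expdiff: "exp (\<i> * of_real (Im (G y) - Im (G x))) = z"
    if "\<alpha> y * \<beta> y = z * (\<alpha> x * \<beta> x)" "cmod z = 1" for x y z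
  proof -
    have "exp (G y - G x) = z"
      using that(1) expG[of x] expG[of y] nz[of 0] by (simp add: exp_diff field_simps)
    moreover from this that(2) have "Re (G y - G x) = 0"
      by (metis exp_eq_one_iff norm_exp_eq_Re)
    then have "G y - G x = \<i> * of_real (Im (G y) - Im (G x))"
      by (simp add: complex_eq_iff)
    ultimately show ?thesis by simp
  qed
  define \<Phi> where "\<Phi> x = Im (G x) - l * (cmod (\<alpha> x))\<^sup>2" for x
  have \<Phi>: "(\<Phi> has_real_derivative h x) (at x)" for x
  proof -
    have "((\<lambda>x. \<alpha> x * cnj (\<alpha> x)) has_vector_derivative
        of_real (\<epsilon> * Re ((of_real (p x) + \<i>) * (\<beta> x * cnj (\<alpha> x))))) (at x)"
      by (intro has_vector_derivative_eq_rhs[OF has_vector_derivative_mult[OF d(1) has_vector_derivative_cnj'[OF d(1)]]])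
        (simp add: complex_eq_iff field_simps)
    from bounded_linear.has_vector_derivative[OF bounded_linear_Re this]
    have 1: "((\<lambda>x. (cmod (\<alpha> x))\<^sup>2) has_vector_derivative
        \<epsilon> * Re ((of_real (p x) + \<i>) * (\<beta> x * cnj (\<alpha> x)))) (at x)"
      by (simp only: complex_norm_square[symmetric] Re_complex_of_real)
    have ring: "a = e / 2 * b \<Longrightarrow> a - l * (e * c) = e * (b / 2 - l * c)" for a b c e :: real
      by (simp add: algebra_simps)
    have "Im (g x) = \<epsilon> / 2 * Im ((of_real (p x) + \<i>) * (\<beta> x / \<alpha> x) + (\<i> - of_real (p x)) * (\<alpha> x / \<beta> x))"
      unfolding g_def by (rule Im_of_real_mult)
    then have "Im (g x) - l * (\<epsilon> * Re ((of_real (p x) + \<i>) * (\<beta> x * cnj (\<alpha> x)))) = h x"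
      unfolding h_def winding_rate_def by (rule ring)
    with bounded_linear.has_vector_derivative[OF bounded_linear_Im G(2)[of x]]
    have "((\<lambda>x. Im (G x) - l * (cmod (\<alpha> x))\<^sup>2) has_vector_derivative h x) (at x)"
      by (rule has_vector_derivative_eq_rhs[OF has_vector_derivative_diff[OF _ has_vector_derivative_mult_right[OF 1]]])
    then show ?thesis
      by (simp add: \<Phi>_def[abs_def] has_real_derivative_iff_has_vector_derivative)
  qed
  have mono: "\<Phi> x < \<Phi> y" if "x < y" for x y
    using that by (rule DERIV_pos_imp_increasing) (use \<Phi> h in blast)
  \<comment> \<open>The Floquet relation gives the increment modulo 2 pi only. Both the increment
    and 2 \<tau> lie strictly between 0 and 2 pi, the former by the bounds on h and K * T < 2 * pi,
    the latter by \<tau> < pi; hence they are equal.\<close>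
  have step: "\<Phi> (x + T) = \<Phi> x + 2 * \<tau>" for x
  proof -
    have "cmod (\<alpha> (x + T)) = cmod (\<alpha> x)" by (simp add: fl norm_mult)
    then have im: "Im (G (x + T)) - Im (G x) = \<Phi> (x + T) - \<Phi> x" by (simp add: \<Phi>_def)
    have "norm (\<Phi> (x + T) - \<Phi> x) \<le> K * (x + T - x)"
      by (rule vector_derivative_linear_bound[of _ _ _ h])
        (use \<Phi> h T in \<open>auto simp: has_real_derivative_iff_has_vector_derivative abs_le_iff\<close>,
          smt (verit) h)
    then have less: "\<Phi> (x + T) - \<Phi> x < 2 * pi" "0 < \<Phi> (x + T) - \<Phi> x"
      using K mono[of x "x + T"] T by auto
    have "cis (2 * \<tau>) = cis \<tau> * cis \<tau>" by (simp add: cis_mult)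
    then have "exp (\<i> * of_real (Im (G (x + T)) - Im (G x))) = cis (2 * \<tau>)"
      by (intro expdiff) (simp_all add: fl norm_mult)
    then have "exp (\<i> * of_real (\<Phi> (x + T) - \<Phi> x)) = exp (\<i> * of_real (2 * \<tau>))"
      by (simp only: im cis_conv_exp)
    then obtain k :: int where "\<i> * of_real (\<Phi> (x + T) - \<Phi> x)
        = \<i> * of_real (2 * \<tau>) + of_real (of_int (2 * k) * pi) * \<i>"
      by (auto simp only: exp_eq)
    then have k: "\<Phi> (x + T) - \<Phi> x = 2 * \<tau> + 2 * of_int k * pi"
      by (simp add: complex_eq_iff)
    have "of_int k * pi < 1 * pi" "-1 * pi < of_int k * pi"
      using k less \<tau> by linarith+
    then have "k = 0" by (simp only: mult_less_cancel_right_pos[OF pi_gt_zero])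
    with k show ?thesis by simp
  qed
  have "\<Phi> (x + real m * T) = \<Phi> x + 2 * (real m * \<tau>)" for m
  proof (induction m)
    case (Suc m)
    then show ?case using step[of "x + real m * T"] by (simp add: algebra_simps)
  qed simp
  then have "\<Phi> (x + real n * T) = \<Phi> x + 2 * pi" using \<tau> by simp
  then have less: "0 < \<Phi> y - \<Phi> x" "\<Phi> y - \<Phi> x < 2 * pi"
    using mono[OF xy(1)] mono[OF xy(2)] by auto
  \<comment> \<open>Coincidence of the two points makes the increment of \<Phi> an integral multiple
    of 2 pi, but it lies strictly between 0 and 2 pi.\<close>
  have "exp (\<i> * of_real (Im (G y) - Im (G x))) = 1"
    using eq by (intro expdiff) auto
  then obtain k :: int where "Im (G y) - Im (G x) = of_int (2 * k) * pi"
    by (auto simp: exp_eq_1)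
  moreover have "Im (G y) - Im (G x) = \<Phi> y - \<Phi> x" using eq by (simp add: \<Phi>_def)
  ultimately have "2 * (of_int k * pi) = \<Phi> y - \<Phi> x" by simp
  then have "0 * pi < of_int k * pi" "of_int k * pi < 1 * pi" using less by linarith+
  then have "0 < k" "k < 1"
    by (simp_all only: mult_less_cancel_right_pos[OF pi_gt_zero])
  then show False by simp
qed

section \<open>The winding rate near a straight line\<close>

lemma abs_Im_mult_le: "\<bar>Im (z * w)\<bar> \<le> C * E" and abs_Re_mult_le: "\<bar>Re (z * w)\<bar> \<le> C * E"
  if "cmod z \<le> C" "cmod w \<le> E"
proof -
  have "cmod (z * w) \<le> C * E"
    unfolding norm_mult using that order_trans[OF norm_ge_zero that(1)] by (intro mult_mono) auto
  then show "\<bar>Im (z * w)\<bar> \<le> C * E" "\<bar>Re (z * w)\<bar> \<le> C * E"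
    using abs_Im_le_cmod[of "z * w"] abs_Re_le_cmod[of "z * w"] by linarith+
qed

text \<open>Both the angular part and the correction contain p l / sqrt (1 + l^2), with opposite
  signs. That this cancels, whatever the slope p, is the reason for the coefficient l.\<close>

lemma winding_rate_straight:
  fixes l p :: real
  defines "S \<equiv> (1 + \<i> * of_real l) / of_real (sqrt (1 + l\<^sup>2))"
  shows "winding_rate l p 1 S = sqrt (1 + l\<^sup>2)"
proof -
  define q where "q = sqrt (1 + l\<^sup>2)"
  have q: "q > 0" "q * q = 1 + l * l"
    unfolding q_def by (auto simp: power2_eq_square add_pos_nonneg)
  have S: "S = Complex (1 / q) (l / q)"
    by (simp add: S_def q_def[symmetric] complex_eq_iff)
  have "inverse S = Complex (1 / q) (- l / q)"
  proof (rule inverse_unique)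
    have "(1 + l * l) / (q * q) = 1" using q by auto
    then show "S * Complex (1 / q) (- l / q) = 1"
      by (simp add: S complex_eq_iff add_divide_distrib)
  qed
  then have "winding_rate l p 1 S = Im ((of_real p + \<i>) * Complex (1 / q) (l / q)
      + (\<i> - of_real p) * Complex (1 / q) (- l / q)) / 2 - l * Re ((of_real p + \<i>) * Complex (1 / q) (l / q))"
    by (simp only: winding_rate_def S div_by_1 complex_cnj_one mult_1_right inverse_eq_divide)
  also have "\<dots> = (p * l * (1 / q) + 1 / q + (1 / q + p * l * (1 / q))) / 2 - l * (p * (1 / q) - l * (1 / q))"
    by simp
  also have "\<dots> = (1 + l * l) * (1 / q)"
    by (simp only: algebra_simps) simp
  also have "\<dots> = (1 + l * l) / q" by simp
  also have "\<dots> = q" using q by (simp only: q(2)[symmetric]) simp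
  finally show ?thesis by (simp add: q_def)
qed

text \<open>For fixed p and l the rate is linear in b / a, a / b and \<open>b * cnj a\<close>, each
  of which is within 3 e of its value at (1, S). The errors add up to at most 3 C e + 3 D C e, and
  both 1 and D are at most C.\<close>

lemma winding_rate_near_straight:
  fixes l p D e :: real
  defines "S \<equiv> (1 + \<i> * of_real l) / of_real (sqrt (1 + l\<^sup>2))"
  defines "C \<equiv> sqrt (1 + D\<^sup>2)"
  assumes p: "\<bar>p\<bar> \<le> D" and l: "\<bar>l\<bar> \<le> D"
    and a: "cmod (a - 1) \<le> e" and b: "cmod (b - S) \<le> e" and e: "e \<le> 1 / 10"
  shows "a \<noteq> 0" "b \<noteq> 0" "\<bar>winding_rate l p a b - sqrt (1 + l\<^sup>2)\<bar> \<le> 6 * C\<^sup>2 * e"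
proof -
  have "cmod (1 + \<i> * of_real l) = sqrt (1 + l\<^sup>2)" by (simp add: cmod_def)
  moreover have "sqrt (1 + l\<^sup>2) > 0" by (simp add: add_pos_nonneg)
  ultimately have S: "cmod S = 1" by (simp add: S_def norm_divide)
  have e0: "e \<ge> 0" using a norm_ge_zero order_trans by blast
  have na: "cmod a \<ge> 9 / 10" "cmod a \<le> 11 / 10"
    using a e norm_triangle_ineq3[of a 1] by auto
  have nb: "cmod b \<ge> 9 / 10" using b e norm_triangle_ineq3[of b S] S by auto
  show a0: "a \<noteq> 0" and b0: "b \<noteq> 0" using na nb by auto
  have S0: "S \<noteq> 0" using S by auto
  have "cmod (b - S * a) \<le> cmod (b - S) + cmod (S * (1 - a))"
    using norm_triangle_ineq[of "b - S" "S * (1 - a)"] by (simp add: algebra_simps)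
  then have bSa: "cmod (b - S * a) \<le> 2 * e"
    using a b S by (simp add: norm_mult norm_minus_commute)
  \<comment> \<open>Division by a number of modulus at least 9 / 10 enlarges 2 e to at most 20 e /
    9.\<close>
  have quot: "cmod (z / w) \<le> 3 * e" if "cmod z \<le> 2 * e" "cmod w \<ge> 9 / 10" for z w
  proof -
    have "3 * e * (9 / 10) \<le> 3 * e * cmod w" using that e0 by (intro mult_left_mono) auto
    then have "cmod z \<le> 3 * e * cmod w" using that e0 by linarith
    moreover have "cmod w > 0" using that by linarith
    ultimately show ?thesis by (simp add: norm_divide pos_divide_le_eq)
  qed
  have "b / a - S = (b - S * a) / a" using a0 by (simp add: field_simps)
  then have 1: "cmod (b / a - S) \<le> 3 * e" using quot[OF bSa na(1)] by simp
  have "a / b - 1 / S = (S * a - b) / (S * b)" using b0 S0 by (simp add: field_simps)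
  then have 2: "cmod (a / b - 1 / S) \<le> 3 * e"
    using quot[of "S * a - b" "S * b"] bSa nb S by (simp add: norm_mult norm_minus_commute)
  have "b * cnj a - S = (b - S) * cnj a + S * cnj (a - 1)" by (simp add: algebra_simps)
  then have "cmod (b * cnj a - S) \<le> cmod (b - S) * cmod a + cmod S * cmod (a - 1)"
    using norm_triangle_ineq[of "(b - S) * cnj a" "S * cnj (a - 1)"]
    by (simp only: norm_mult complex_mod_cnj)
  moreover have "cmod (b - S) * cmod a \<le> e * (11 / 10)"
    using b na e0 by (intro mult_mono) auto
  ultimately have 3: "cmod (b * cnj a - S) \<le> 3 * e" using a S e0 by simp
  have C: "cmod (of_real p + \<i>) \<le> C" "cmod (\<i> - of_real p) \<le> C"
    using p by (simp_all add: C_def cmod_of_real_plus_ii abs_le_square_iff[symmetric])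
  have "winding_rate l p a b - sqrt (1 + l\<^sup>2) = winding_rate l p a b - winding_rate l p 1 S"
    unfolding S_def by (simp add: winding_rate_straight)
  also have "\<dots> = Im ((of_real p + \<i>) * (b / a - S)) / 2 + Im ((\<i> - of_real p) * (a / b - 1 / S)) / 2
      - l * Re ((of_real p + \<i>) * (b * cnj a - S))"
    by (simp add: winding_rate_def algebra_simps add_divide_distrib diff_divide_distrib)
  finally have eq: "winding_rate l p a b - sqrt (1 + l\<^sup>2) = \<dots>" .
  have Z: "\<bar>l * Re ((of_real p + \<i>) * (b * cnj a - S))\<bar> \<le> D * (C * (3 * e))"
    using l abs_Re_mult_le[OF C(1) 3] by (auto simp: abs_mult intro: mult_mono)
  have D: "D \<ge> 0" "D \<le> C" "1 \<le> C"
    using l by (auto simp: C_def intro: real_le_rsqrt)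
  have "D * (C * (3 * e)) \<le> C * (C * (3 * e))" "1 * (C * (3 * e)) \<le> C * (C * (3 * e))"
    using D e0 by (intro mult_right_mono; simp)+
  moreover have "6 * C\<^sup>2 * e = C * (C * (3 * e)) + C * (C * (3 * e))"
    by (simp add: power2_eq_square)
  ultimately have le: "C * (3 * e) + D * (C * (3 * e)) \<le> 6 * C\<^sup>2 * e" by linarith
  have "\<bar>X / 2 + Y / 2 - Z\<bar> \<le> u + v" if "\<bar>X\<bar> \<le> u" "\<bar>Y\<bar> \<le> u" "\<bar>Z\<bar> \<le> v" for X Y Z u v :: real
    using that by linarith
  from this[OF abs_Im_mult_le[OF C(1) 1] abs_Im_mult_le[OF C(2) 2] Z]
  show "\<bar>winding_rate l p a b - sqrt (1 + l\<^sup>2)\<bar> \<le> 6 * C\<^sup>2 * e"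
    unfolding eq using le by (rule order_trans)
qed

section \<open>Diagonalizing the monodromy\<close>

text \<open>In quaternions, (1 + s j) (A + B j) = \<open>cis \<tau>\<close> (1 + s j). The number s
  is found by solving the first component; the second then holds because the unit norm gives (Im
  A)^2 - (sin \<tau>)^2 = - |B|^2.\<close>

lemma monodromy_eigenvector:
  assumes AB: "(cmod A)\<^sup>2 + (cmod B)\<^sup>2 = 1" and re: "Re A = cos \<tau>" and B: "B \<noteq> 0"
  defines "s \<equiv> \<i> * of_real (Im A - sin \<tau>) / cnj B"
  shows "A - s * cnj B = cis \<tau>" "B + s * cnj A = cis \<tau> * s"
proof -
  show "A - s * cnj B = cis \<tau>"
    using B re by (simp add: s_def complex_eq_iff)
  have "(Im A - sin \<tau>) * (Im A + sin \<tau>) = (Im A)\<^sup>2 - (sin \<tau>)\<^sup>2"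
    by (simp add: algebra_simps power2_eq_square)
  then have "(Im A - sin \<tau>) * (Im A + sin \<tau>) = - (cmod B)\<^sup>2"
    using AB re sin_squared_eq[of \<tau>] unfolding cmod_power2[of A] by simp
  then have AB': "complex_of_real ((Im A - sin \<tau>) * (Im A + sin \<tau>)) = - (B * cnj B)"
    by (simp only: of_real_minus complex_norm_square)
  have "cnj A - cis \<tau> = - \<i> * of_real (Im A + sin \<tau>)"
    using re by (simp add: complex_eq_iff)
  moreover have "\<i> * x / c * (- \<i> * y) = x * y / c" for x y c :: complex
  proof -
    have "(\<i> * x) * (- \<i> * y) = x * y" by (simp add: complex_eq_iff algebra_simps)
    then show ?thesis by (simp only: times_divide_eq_left)
  qed
  ultimately have "s * (cnj A - cis \<tau>) = of_real ((Im A - sin \<tau>) * (Im A + sin \<tau>)) / cnj B"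
    by (simp only: s_def of_real_mult)
  then have "s * (cnj A - cis \<tau>) = - B" using B unfolding AB' by simp
  then show "B + s * cnj A = cis \<tau> * s" by (simp add: algebra_simps)
qed

text \<open>S is the value of s in the limit of small \<epsilon>: there B is close to \<i> b0 S with
  b0 = \<epsilon> T sqrt (1 + l^2) / 2, while sin \<tau> is close to b0 and Im A is negligible. The
  bound on e2 keeps B, the denominator of s, away from 0.\<close>

lemma monodromy_eigenvector_estimate:
  fixes T \<epsilon> l k e1 e2 :: real
  assumes T: "T > 0" and \<epsilon>: "\<epsilon> > 0" and \<tau>: "0 < \<tau>" "\<tau> < pi"
    and AB: "(cmod A)\<^sup>2 + (cmod B)\<^sup>2 = 1" and re: "Re A = cos \<tau>"
    and A: "cmod (A - 1) \<le> e1"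
    and B: "cmod (B - of_real (\<epsilon> / 2) * (\<i> * of_real T - of_real (l * T))) \<le> e2"
    and small: "e2 \<le> \<epsilon> * T / 4"
  defines "S \<equiv> (1 + \<i> * of_real l) / of_real (sqrt (1 + l\<^sup>2))"
  defines "s \<equiv> \<i> * of_real (Im A - sin \<tau>) / cnj B"
  shows "cmod B \<ge> \<epsilon> * T / 4" "cmod (s - S) \<le> 8 * (e1 + e2) / (\<epsilon> * T)"
proof -
  define q where "q = sqrt (1 + l\<^sup>2)"
  have q: "q \<ge> 1" by (simp add: q_def)
  have q2: "q * q = 1 + l * l" by (simp add: q_def power2_eq_square[symmetric])
  have S: "cmod S = 1"
  proof -
    have "cmod (1 + \<i> * of_real l) = q" by (simp add: cmod_def q_def)
    then show ?thesis using q by (simp add: S_def norm_divide q_def[symmetric])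
  qed
  define b0 where "b0 = \<epsilon> * T * q / 2"
  have "\<epsilon> * T * 1 \<le> \<epsilon> * T * q" using T \<epsilon> q by (intro mult_left_mono) auto
  then have b0: "b0 \<ge> \<epsilon> * T / 2" by (simp add: b0_def)
  define B0 where "B0 = of_real (\<epsilon> / 2) * (\<i> * of_real T - of_real (l * T))"
  have B0: "B0 = \<i> * of_real b0 * S"
    using q by (simp add: B0_def b0_def S_def q_def[symmetric] field_simps)
  have "b0 \<ge> 0" using b0 T \<epsilon> by (smt (verit) divide_nonneg_pos mult_pos_pos)
  then have nB0: "cmod B0 = b0" by (simp add: B0 norm_mult S)
  have BB0: "cmod (B - B0) \<le> e2" using B by (simp add: B0_def)
  have nB: "\<bar>cmod B - b0\<bar> \<le> e2" using norm_triangle_ineq3[of B B0] BB0 nB0 by simp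
  then show B4: "cmod B \<ge> \<epsilon> * T / 4" using b0 small by (simp add: abs_le_iff)
  have \<epsilon>T: "\<epsilon> * T > 0" using \<epsilon> T by simp
  have B0': "B \<noteq> 0" using B4 \<epsilon>T by auto
  have \<eta>: "\<bar>Im A\<bar> \<le> e1" using A abs_Im_le_cmod[of "A - 1"] by simp
  have sin: "sin \<tau> > 0" using \<tau> by (rule sin_gt_zero)
  \<comment> \<open>As Re A = cos \<tau>, sin \<tau> is the hypotenuse over |B| and |Im A|, hence
    between |B| and |B| + |Im A|.\<close>
  have sin2: "(sin \<tau>)\<^sup>2 = (cmod B)\<^sup>2 + (Im A)\<^sup>2"
    using AB re sin_squared_eq[of \<tau>] unfolding cmod_power2[of A] by simp
  have "cmod B \<le> sin \<tau>"
    by (rule power2_le_imp_le) (use sin2 sin in \<open>simp_all only: le_add_same_cancel1 zero_le_power2 less_imp_le\<close>)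
  moreover have "sin \<tau> \<le> cmod B + \<bar>Im A\<bar>"
  proof (rule power2_le_imp_le)
    have "(cmod B + \<bar>Im A\<bar>)\<^sup>2 = (cmod B)\<^sup>2 + (Im A)\<^sup>2 + 2 * cmod B * \<bar>Im A\<bar>"
      by (simp only: power2_sum power2_abs)
    then show "(sin \<tau>)\<^sup>2 \<le> (cmod B + \<bar>Im A\<bar>)\<^sup>2" unfolding sin2 by simp
  qed simp
  ultimately have sb: "\<bar>sin \<tau> - b0\<bar> \<le> e1 + e2" using nB \<eta> by (auto simp: abs_le_iff)
  have SS: "S * cnj S = 1" using complex_norm_square[of S] S by simp
  have "S * cnj B0 = - \<i> * of_real b0 * (S * cnj S)" by (simp add: B0)
  then have h1: "S * cnj (B - B0) = S * cnj B + \<i> * of_real b0"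
    using SS by (simp add: algebra_simps)
  have h2: "s * cnj B = \<i> * of_real (Im A - sin \<tau>)"
    using B0' by (simp add: s_def)
  \<comment> \<open>Clearing the denominator leaves three errors, at most e1, e1 + e2 and e2.
    Dividing their sum 2 (e1 + e2) by |B|, which is at least \<epsilon> T / 4, produces the factor
    8.\<close>
  have "(s - S) * cnj B = \<i> * of_real (Im A) - \<i> * of_real (sin \<tau> - b0) - S * cnj (B - B0)"
    unfolding left_diff_distrib h1 h2 by (simp add: algebra_simps)
  also have "cmod \<dots> \<le> cmod (\<i> * of_real (Im A)) + cmod (\<i> * of_real (sin \<tau> - b0)) + cmod (S * cnj (B - B0))"
    by (rule order_trans[OF norm_triangle_ineq4 add_right_mono[OF norm_triangle_ineq4]])
  also have "\<dots> = \<bar>Im A\<bar> + \<bar>sin \<tau> - b0\<bar> + cmod (B - B0)"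
    by (simp only: norm_mult norm_ii norm_of_real complex_mod_cnj S mult_1)
  also have "\<dots> \<le> 2 * (e1 + e2)" using add_mono[OF add_mono[OF \<eta> sb] BB0] by simp
  finally have *: "cmod (s - S) * cmod B \<le> 2 * (e1 + e2)" by (simp add: norm_mult)
  have "cmod (s - S) * (\<epsilon> * T / 4) \<le> cmod (s - S) * cmod B"
    using B4 by (rule mult_left_mono) simp
  with * have "cmod (s - S) * (\<epsilon> * T) \<le> 8 * (e1 + e2)" by simp
  then show "cmod (s - S) \<le> 8 * (e1 + e2) / (\<epsilon> * T)"
    using \<epsilon>T by (simp add: pos_le_divide_eq)
qed

text \<open>In the applications \<kappa> / C is \<epsilon> T. The last bound then says that the
  remainder of B is at most \<epsilon> T / 4, half of the least possible modulus of its main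
  term.\<close>

lemma cube_le_of_small:
  fixes \<kappa> C :: real
  assumes C: "C \<ge> 1" and \<kappa>: "\<kappa> > 0" and small: "\<kappa> * C ^ 3 \<le> 1 / 100"
  shows "\<kappa> * C \<le> 1 / 100" "\<kappa>\<^sup>2 \<le> \<kappa> / 100" "\<kappa> ^ 3 / 8 \<le> \<kappa> / C / 4"
proof -
  have "\<kappa> * C \<le> \<kappa> * C ^ 3"
    using C \<kappa> power_increasing[of 1 3 C] by (intro mult_left_mono) auto
  then show \<kappa>C: "\<kappa> * C \<le> 1 / 100" using small by simp
  have "\<kappa> * 1 \<le> \<kappa> * C" using C \<kappa> by (intro mult_left_mono) auto
  then have "\<kappa> \<le> 1 / 100" using \<kappa>C by simp
  then show \<kappa>2: "\<kappa>\<^sup>2 \<le> \<kappa> / 100"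
    using \<kappa> mult_left_mono[of \<kappa> "1 / 100" \<kappa>] by (simp add: power2_eq_square)
  have "\<kappa> ^ 3 * C = (\<kappa> * C) * \<kappa>\<^sup>2" by (simp add: power2_eq_square power3_eq_cube)
  also have "\<dots> \<le> (1 / 100) * (\<kappa> / 100)" using \<kappa>C \<kappa>2 \<kappa> C by (intro mult_mono) auto
  finally have "\<kappa> ^ 3 * C \<le> 2 * \<kappa>" using \<kappa> by simp
  then have "\<kappa> ^ 3 \<le> 2 * \<kappa> / C" using C by (simp add: pos_le_divide_eq)
  then show "\<kappa> ^ 3 / 8 \<le> \<kappa> / C / 4" by simp
qed

section \<open>Closing up and the choice of the radius\<close>

text \<open>The third power of C adds up as follows: a is within 3 \<kappa> C of S, the transformed
  components are within e = 4 \<kappa> C of 1 and S on one period, and so the winding rate is within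
  6 C^2 e = 24 \<kappa> C^3 of a number that is at least 1.\<close>

lemma spinor_closed_of_trace:
  fixes T D \<epsilon> \<tau> :: real and n :: nat
  defines "C \<equiv> sqrt (1 + D\<^sup>2)"
  defines "\<kappa> \<equiv> \<epsilon> * C * T"
  assumes s: "spinor p \<epsilon> \<alpha> \<beta>" and 0: "\<alpha> 0 = 1" "\<beta> 0 = 0"
    and p: "continuous_on UNIV p" and per: "\<And>x. p (x + T) = p x" and D: "\<And>x. \<bar>p x\<bar> \<le> D"
    and T: "T > 0" and \<epsilon>: "\<epsilon> > 0" and small: "\<kappa> * C ^ 3 \<le> 1 / 100"
    and \<tau>: "0 < \<tau>" "\<tau> < pi" "real n * \<tau> = pi" and trace: "Re (\<alpha> T) = cos \<tau>"
  shows "\<alpha> (x + real n * T) = - \<alpha> x" "\<beta> (x + real n * T) = - \<beta> x"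
    and "x < y \<Longrightarrow> y < x + real n * T \<Longrightarrow> \<alpha> x * \<beta> x = \<alpha> y * \<beta> y \<Longrightarrow> cmod (\<alpha> x) \<noteq> cmod (\<alpha> y)"
proof -
  obtain P where P: "\<And>x. (P has_real_derivative p x) (at x)"
    using antiderivative_exists[OF p] by (metis has_real_derivative_iff_has_vector_derivative)
  define l where "l = (P T - P 0) / T"
  have lT: "l * T = P T - P 0" using T by (simp add: l_def)
  have "norm (P T - P 0) \<le> D * (T - 0)"
    by (rule vector_derivative_linear_bound[of _ _ _ p])
      (use P D T in \<open>auto simp: has_real_derivative_iff_has_vector_derivative\<close>)
  then have l: "\<bar>l\<bar> \<le> D" using T by (simp add: l_def abs_mult pos_divide_le_eq)
  have C: "C \<ge> 1" by (simp add: C_def)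
  have \<kappa>: "\<kappa> > 0" using C T \<epsilon> by (simp add: \<kappa>_def)
  note \<kappa>C = cube_le_of_small(1)[OF C \<kappa> small] and \<kappa>2 = cube_le_of_small(2)[OF C \<kappa> small]
  have \<kappa>le: "\<kappa> \<le> \<kappa> * C" using C \<kappa> by simp
  have \<epsilon>T: "\<epsilon> * T = \<kappa> / C" using C by (simp add: \<kappa>_def)
  note bd = spinor_bounds[OF s 0 D less_imp_le[OF \<epsilon>] P, of _ T, folded C_def \<kappa>_def]
  note nrm = spinor_norm[OF s]
  have nrm1: "(cmod (\<alpha> x))\<^sup>2 + (cmod (\<beta> x))\<^sup>2 = 1" for x using nrm[of x] by (simp add: 0)
  define S where "S = (1 + \<i> * of_real l) / of_real (sqrt (1 + l\<^sup>2))"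
  define a where "a = \<i> * of_real (Im (\<alpha> T) - sin \<tau>) / cnj (\<beta> T)"
  have e2: "\<kappa> ^ 3 / 8 \<le> \<epsilon> * T / 4"
    unfolding \<epsilon>T by (rule cube_le_of_small(3)[OF C \<kappa> small])
  note est = monodromy_eigenvector_estimate[OF T \<epsilon> \<tau>(1,2) nrm1[of T] trace
      bd(2)[OF less_imp_le[OF T] order.refl] _ e2, of l, folded S_def a_def, unfolded lT,
      OF bd(3)[OF less_imp_le[OF T] order.refl]]
  have B0: "\<beta> T \<noteq> 0"
    using est(1) T \<epsilon> by (metis divide_pos_pos mult_pos_pos norm_zero not_le zero_less_numeral)
  note eig = monodromy_eigenvector[OF nrm1[of T] trace B0, folded a_def]
  have aS: "cmod (a - S) \<le> 3 * (\<kappa> * C)"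
  proof -
    have "8 * (\<kappa>\<^sup>2 / 4 + \<kappa> ^ 3 / 8) / (\<epsilon> * T) = C * (2 * \<kappa> + \<kappa>\<^sup>2)"
      unfolding \<epsilon>T using \<kappa> C by (simp add: field_simps power2_eq_square power3_eq_cube)
    also have "\<dots> \<le> C * (3 * \<kappa>)" using \<kappa>2 \<kappa> C by (intro mult_left_mono) auto
    finally have "8 * (\<kappa>\<^sup>2 / 4 + \<kappa> ^ 3 / 8) / (\<epsilon> * T) \<le> 3 * (\<kappa> * C)"
      by (simp only: mult.commute mult.left_commute)
    with est(2) show ?thesis by (rule order_trans)
  qed
  have "cmod (1 + \<i> * of_real l) = sqrt (1 + l\<^sup>2)" by (simp add: cmod_def)
  moreover have "sqrt (1 + l\<^sup>2) > 0" by (simp add: add_pos_nonneg)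
  ultimately have S: "cmod S = 1" by (simp add: S_def norm_divide)
  have a2: "cmod a \<le> 2" using norm_triangle_ineq[of "a - S" S] aS S \<kappa>C by simp
  \<comment> \<open>Left multiplication by the quaternion 1 + a j, which is not normalized; its
    squared norm is 1 + |a|^2.\<close>
  define \<alpha>' \<beta>' where "\<alpha>' x = \<alpha> x - a * cnj (\<beta> x)" and "\<beta>' x = \<beta> x + a * cnj (\<alpha> x)" for x
  have s': "spinor p \<epsilon> \<alpha>' \<beta>'"
    using spinor_left_mult[OF s, of 1 a] by (simp add: \<alpha>'_def[abs_def] \<beta>'_def[abs_def])
  have flo: "\<alpha>' T = cis \<tau> * \<alpha>' 0" "\<beta>' T = cis \<tau> * \<beta>' 0"
    using eig by (simp_all add: \<alpha>'_def \<beta>'_def 0)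
  define e where "e = 4 * (\<kappa> * C)"
  have near: "cmod (\<alpha>' x - 1) \<le> e" "cmod (\<beta>' x - S) \<le> e" if "0 \<le> x" "x \<le> T" for x
  proof -
    note b = bd(1,2)[OF that]
    have "cmod (\<alpha>' x - 1) \<le> cmod (\<alpha> x - 1) + cmod (a * cnj (\<beta> x))"
      using norm_triangle_ineq4[of "\<alpha> x - 1" "a * cnj (\<beta> x)"] by (simp add: \<alpha>'_def algebra_simps)
    moreover have "cmod (a * cnj (\<beta> x)) \<le> 2 * (\<kappa> / 2)"
      unfolding norm_mult using a2 b by (intro mult_mono) auto
    ultimately show "cmod (\<alpha>' x - 1) \<le> e" unfolding e_def using b \<kappa>2 \<kappa>le \<kappa> by linarith
    have "\<beta>' x - S = \<beta> x + a * cnj (\<alpha> x - 1) + (a - S)" by (simp add: \<beta>'_def algebra_simps)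
    then have "cmod (\<beta>' x - S) \<le> cmod (\<beta> x) + cmod (a * cnj (\<alpha> x - 1)) + cmod (a - S)"
      by (simp only:) (meson add_right_mono norm_triangle_ineq order_trans)
    moreover have "cmod (a * cnj (\<alpha> x - 1)) \<le> 2 * (\<kappa>\<^sup>2 / 4)"
      unfolding norm_mult complex_mod_cnj using a2 b by (intro mult_mono) auto
    ultimately show "cmod (\<beta>' x - S) \<le> e" unfolding e_def using b(1) aS \<kappa>2 \<kappa>le \<kappa> by linarith
  qed
  have e10: "e \<le> 1 / 10" using \<kappa>C by (simp add: e_def)
  note wr = winding_rate_near_straight[OF D l near[unfolded S_def] e10, folded C_def]
  have "6 * C\<^sup>2 * e = 24 * (\<kappa> * C ^ 3)" by (simp add: e_def power2_eq_square power3_eq_cube)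
  then have e24: "6 * C\<^sup>2 * e \<le> 24 / 100" using small by simp
  have q: "1 \<le> sqrt (1 + l\<^sup>2)" "sqrt (1 + l\<^sup>2) \<le> C"
    using l by (auto simp: C_def abs_le_square_iff[symmetric])
  have rate: "0 < winding_rate l (p x) (\<alpha>' x) (\<beta>' x)" "winding_rate l (p x) (\<alpha>' x) (\<beta>' x) \<le> 2 * C"
    if "0 \<le> x" "x \<le> T" for x
    using order_trans[OF wr(3)[OF that that, of x] e24] q C by linarith+
  show "cmod (\<alpha> x) \<noteq> cmod (\<alpha> y)"
    if xy: "x < y" "y < x + real n * T" and ab: "\<alpha> x * \<beta> x = \<alpha> y * \<beta> y"
  proof
    assume ca: "cmod (\<alpha> x) = cmod (\<alpha> y)"
    then have cb: "(cmod (\<beta> x))\<^sup>2 = (cmod (\<beta> y))\<^sup>2"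
      using nrm1[of x] nrm1[of y] unfolding ca by linarith
    have aa: "\<alpha> x * cnj (\<alpha> x) = \<alpha> y * cnj (\<alpha> y)" "\<beta> x * cnj (\<beta> x) = \<beta> y * cnj (\<beta> y)"
      using ca cb by (simp_all only: complex_norm_square[symmetric])
    \<comment> \<open>On points of the sphere this left multiplication is a rotation up to scaling,
      so equality of points passes from the old components to the new ones.\<close>
    have "\<alpha>' z * \<beta>' z = \<alpha> z * \<beta> z - a * a * cnj (\<alpha> z * \<beta> z) + a * (\<alpha> z * cnj (\<alpha> z) - \<beta> z * cnj (\<beta> z))" for z
      by (simp add: \<alpha>'_def \<beta>'_def algebra_simps)
    then have 1: "\<alpha>' x * \<beta>' x = \<alpha>' y * \<beta>' y" by (simp only: ab aa)
    have "\<alpha>' z * cnj (\<alpha>' z) = \<alpha> z * cnj (\<alpha> z) + a * cnj a * (\<beta> z * cnj (\<beta> z))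
        - a * cnj (\<alpha> z * \<beta> z) - cnj a * (\<alpha> z * \<beta> z)" for z
      by (simp add: \<alpha>'_def algebra_simps)
    then have "\<alpha>' x * cnj (\<alpha>' x) = \<alpha>' y * cnj (\<alpha>' y)" by (simp only: ab aa)
    then have "complex_of_real ((cmod (\<alpha>' x))\<^sup>2) = of_real ((cmod (\<alpha>' y))\<^sup>2)"
      by (simp only: complex_norm_square)
    then have 2: "cmod (\<alpha>' x) = cmod (\<alpha>' y)" by (simp only: of_real_eq_iff) simp
    show False
    proof (rule spinor_winding[OF s' p per T flo \<tau> _ _ _ _ xy 1 2])
      show "\<alpha>' z \<noteq> 0 \<and> \<beta>' z \<noteq> 0" if "0 \<le> z" "z \<le> T" for z
        using wr(1,2)[OF that that] by simp
      show "0 < \<epsilon> * winding_rate l (p z) (\<alpha>' z) (\<beta>' z)" if "0 \<le> z" "z \<le> T" for z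
        using rate[OF that] \<epsilon> by simp
      show "\<epsilon> * winding_rate l (p z) (\<alpha>' z) (\<beta>' z) \<le> \<epsilon> * (2 * C)" if "0 \<le> z" "z \<le> T" for z
        using rate[OF that] \<epsilon> by simp
      have "\<epsilon> * (2 * C) * T = 2 * \<kappa>" by (simp add: \<kappa>_def)
      then show "\<epsilon> * (2 * C) * T < 2 * pi" using \<kappa>C \<kappa>le pi_gt3 by simp
    qed
  qed
  note fl = spinor_floquet[OF s' per flo]
  have "\<alpha>' (x + real m * T) = cis (real m * \<tau>) * \<alpha>' x \<and> \<beta>' (x + real m * T) = cis (real m * \<tau>) * \<beta>' x" for m
  proof (induction m)
    case (Suc m)
    have "x + real (Suc m) * T = x + real m * T + T" "cis (real (Suc m) * \<tau>) = cis \<tau> * cis (real m * \<tau>)"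
      by (simp_all add: algebra_simps cis_mult)
    then show ?case using Suc fl[of "x + real m * T"] by (simp only: mult.assoc)
  qed simp
  from this[of n] have neg: "\<alpha>' (x + real n * T) = - \<alpha>' x" "\<beta>' (x + real n * T) = - \<beta>' x"
    using \<tau>(3) by simp_all
  have "complex_of_real (1 + (cmod a)\<^sup>2) \<noteq> 0"
    by (smt (verit) of_real_eq_0_iff zero_le_power2)
  then have N: "1 + a * cnj a \<noteq> 0" by (simp only: complex_norm_square of_real_add of_real_1) simp
  \<comment> \<open>Undoes the left multiplication: the conjugate quaternion is applied, and the
    squared norm remains as a factor. The sign change after n periods, \<open>cis pi\<close>, thus
    carries over to \<alpha> and \<beta>.\<close>
  have rec: "(1 + a * cnj a) * \<alpha> z = \<alpha>' z + a * cnj (\<beta>' z)" "(1 + a * cnj a) * \<beta> z = \<beta>' z - a * cnj (\<alpha>' z)" for z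
    by (simp_all add: \<alpha>'_def \<beta>'_def algebra_simps)
  have "(1 + a * cnj a) * \<alpha> (x + real n * T) = (1 + a * cnj a) * (- \<alpha> x)"
    unfolding rec(1) neg mult_minus_right by simp
  then show "\<alpha> (x + real n * T) = - \<alpha> x" using N by (metis mult_left_cancel)
  have "(1 + a * cnj a) * \<beta> (x + real n * T) = (1 + a * cnj a) * (- \<beta> x)"
    unfolding rec(2) neg mult_minus_right by simp
  then show "\<beta> (x + real n * T) = - \<beta> x" using N by (metis mult_left_cancel)
qed

text \<open>The order of choices is \<epsilon>0, n, \<epsilon>1, all before p. At \<epsilon>0 the
  monodromy has turned too far for the angle prescribed by n, at \<epsilon>1 not far enough, and an
  intermediate \<epsilon> is right.\<close>

lemma spinor_closed:
  fixes T D :: real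
  assumes T: "T > 0" and D0: "D > 0"
  shows "\<exists>\<rho>>0. \<forall>p. continuous_on UNIV p \<and> (\<forall>x. p (x + T) = p x) \<and> (\<forall>x. \<bar>p x\<bar> \<le> D) \<longrightarrow>
    (\<exists>r\<in>{0<..<\<rho>}. \<exists>\<alpha> \<beta>. \<exists>n::nat. n > 0 \<and> spinor p (1 / r) \<alpha> \<beta> \<and> \<alpha> 0 = 1 \<and> \<beta> 0 = 0 \<and>
      (\<forall>x. \<alpha> (x + real n * T) = - \<alpha> x \<and> \<beta> (x + real n * T) = - \<beta> x) \<and>
      (\<forall>x y. x < y \<and> y < x + real n * T \<and> \<alpha> x * \<beta> x = \<alpha> y * \<beta> y \<longrightarrow> cmod (\<alpha> x) \<noteq> cmod (\<alpha> y)))"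
proof -
  define C where "C = sqrt (1 + D\<^sup>2)"
  have C: "C \<ge> 1" by (simp add: C_def)
  \<comment> \<open>The largest \<kappa> for which the closing criterion is available.\<close>
  define \<kappa>0 where "\<kappa>0 = 1 / (100 * C ^ 3)"
  have \<kappa>0: "\<kappa>0 > 0" "\<kappa>0 * C ^ 3 = 1 / 100" using C by (auto simp: \<kappa>0_def)
  define \<epsilon>0 where "\<epsilon>0 = \<kappa>0 / (C * T)"
  have \<epsilon>0: "\<epsilon>0 > 0" "\<epsilon>0 * C * T = \<kappa>0" using C T \<kappa>0 by (auto simp: \<epsilon>0_def)
  \<comment> \<open>A lower bound for \<open>cmod (B \<epsilon>0 T)\<close>: the main term has
    modulus at least 2 b and the remainder at most b. It forces
    \<open>cmod (A \<epsilon>0 T)\<close> below the square root of 1 - b^2, and n is taken so large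
    that cos (pi / n) exceeds this.\<close>
  define b where "b = \<epsilon>0 * T / 4"
  have b: "b > 0" using \<epsilon>0 T by (simp add: b_def)
  have "sqrt (1 - b\<^sup>2) < 1" using b by simp
  moreover have "(\<lambda>n. cos (pi / real n)) \<longlonglongrightarrow> cos 0"
    by (intro isCont_tendsto_compose[OF isCont_cos] lim_const_over_n)
  ultimately have "\<forall>\<^sub>F n in sequentially. sqrt (1 - b\<^sup>2) < cos (pi / real n)"
    by (intro order_tendstoD(1)[where y = "cos 0"]) auto
  moreover have "\<forall>\<^sub>F n::nat in sequentially. n \<ge> 2" by (rule eventually_ge_at_top)
  ultimately have "\<forall>\<^sub>F n in sequentially. sqrt (1 - b\<^sup>2) < cos (pi / real n) \<and> n \<ge> 2"
    by (rule eventually_conj)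
  then obtain n :: nat where n: "sqrt (1 - b\<^sup>2) < cos (pi / real n)" "n \<ge> 2"
    using eventually_happens' sequentially_bot by blast
  define \<tau> where "\<tau> = pi / real n"
  have \<tau>: "0 < \<tau>" "\<tau> < pi" "real n * \<tau> = pi"
    using n(2) by (auto simp: \<tau>_def pos_divide_less_eq)
  have cos1: "cos \<tau> < 1"
    using cos_monotone_0_pi[of 0 \<tau>] \<tau> by simp
  \<comment> \<open>Here the second order bound gives 1 - Re A \<le> (1 - cos \<tau>) / 4. The
    minimum ensures \<epsilon>1 \<le> \<epsilon>0.\<close>
  define \<epsilon>1 where "\<epsilon>1 = min \<epsilon>0 (sqrt (1 - cos \<tau>) / (C * T))"
  have \<epsilon>1: "\<epsilon>1 > 0" "\<epsilon>1 \<le> \<epsilon>0" using \<epsilon>0 cos1 C T by (auto simp: \<epsilon>1_def)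
  have "\<epsilon>1 * C * T \<le> sqrt (1 - cos \<tau>)"
  proof -
    have "\<epsilon>1 * (C * T) \<le> sqrt (1 - cos \<tau>) / (C * T) * (C * T)"
      using C T by (intro mult_right_mono) (auto simp: \<epsilon>1_def)
    then show ?thesis using C T by simp
  qed
  then have \<epsilon>1sq: "(\<epsilon>1 * C * T)\<^sup>2 \<le> 1 - cos \<tau>"
    using power_mono[of "\<epsilon>1 * C * T" "sqrt (1 - cos \<tau>)" 2] \<epsilon>1 C T cos1 by simp
  show ?thesis
  \<comment> \<open>The factor 2 makes the bound on the radius strict, as \<epsilon> may be equal to
    \<epsilon>1.\<close>
  proof (intro exI[of _ "2 / \<epsilon>1"] conjI allI impI, goal_cases)
    case 1
    show ?case using \<epsilon>1 by simp
  next
    case (2 p)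
    then have p: "continuous_on UNIV p" and per: "\<And>x. p (x + T) = p x" and D: "\<And>x. \<bar>p x\<bar> \<le> D"
      by auto
    obtain P where P: "\<And>x. (P has_real_derivative p x) (at x)"
      using antiderivative_exists[OF p] by (metis has_real_derivative_iff_has_vector_derivative)
    obtain A B where AB: "\<And>\<epsilon>. spinor p \<epsilon> (A \<epsilon>) (B \<epsilon>)" "\<And>\<epsilon>. A \<epsilon> 0 = 1" "\<And>\<epsilon>. B \<epsilon> 0 = 0"
      "\<And>x. continuous_on UNIV (\<lambda>\<epsilon>. A \<epsilon> x)"
      using spinor_exists[OF p D] by blast
    have T0: "0 \<le> T" using T by simp
    have le1: "cos \<tau> \<le> Re (A \<epsilon>1 T)"
    proof -
      have "cmod (A \<epsilon>1 T - 1) \<le> (\<epsilon>1 * C * T)\<^sup>2 / 4"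
        unfolding C_def by (rule spinor_bounds(2)[OF AB(1-3) D less_imp_le[OF \<epsilon>1(1)] P T0 order.refl])
      moreover have "1 - Re (A \<epsilon>1 T) \<le> cmod (A \<epsilon>1 T - 1)"
        using abs_Re_le_cmod[of "A \<epsilon>1 T - 1"] by simp
      ultimately show ?thesis using \<epsilon>1sq cos1 by linarith
    qed
    have le0: "Re (A \<epsilon>0 T) \<le> cos \<tau>"
    proof -
      define q where "q = complex_of_real (\<epsilon>0 / 2) * (\<i> * of_real T - of_real (P T - P 0))"
      have "cmod (B \<epsilon>0 T - q) \<le> (\<epsilon>0 * C * T) ^ 3 / 8"
        unfolding q_def C_def by (rule spinor_bounds(3)[OF AB(1-3) D less_imp_le[OF \<epsilon>0(1)] P T0 order.refl])
      also have "\<dots> \<le> \<kappa>0 / C / 4"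
        unfolding \<epsilon>0(2) by (rule cube_le_of_small(3)[OF C \<kappa>0(1)]) (simp add: \<kappa>0(2))
      also have "\<dots> = b" using C T by (simp add: b_def \<epsilon>0_def)
      finally have "cmod (B \<epsilon>0 T - q) \<le> b" .
      moreover have "2 * b \<le> cmod q"
        using abs_Im_le_cmod[of q] \<epsilon>0(1) T by (simp add: q_def b_def mult.commute)
      ultimately have "b \<le> cmod (B \<epsilon>0 T)"
        using norm_triangle_ineq2[of q "B \<epsilon>0 T"] by (simp add: norm_minus_commute)
      then have "b\<^sup>2 \<le> (cmod (B \<epsilon>0 T))\<^sup>2" using b by (intro power_mono) auto
      then have "(cmod (A \<epsilon>0 T))\<^sup>2 \<le> 1 - b\<^sup>2"
        using spinor_norm[OF AB(1), of \<epsilon>0 T] AB(2,3)[of \<epsilon>0] by simp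
      then have "cmod (A \<epsilon>0 T) \<le> sqrt (1 - b\<^sup>2)" by (rule real_le_rsqrt)
      then show ?thesis
        using n(1) abs_Re_le_cmod[of "A \<epsilon>0 T"] unfolding \<tau>_def by linarith
    qed
    have "\<forall>x. \<epsilon>1 \<le> x \<and> x \<le> \<epsilon>0 \<longrightarrow> isCont (\<lambda>\<epsilon>. Re (A \<epsilon> T)) x"
      using AB(4)[of T] by (auto simp: continuous_on_eq_continuous_at intro!: continuous_intros)
    from IVT2[of "\<lambda>\<epsilon>. Re (A \<epsilon> T)", OF le0 le1 \<epsilon>1(2) this]
    obtain \<epsilon> where \<epsilon>: "\<epsilon>1 \<le> \<epsilon>" "\<epsilon> \<le> \<epsilon>0" "Re (A \<epsilon> T) = cos \<tau>"
      by blast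
    have \<epsilon>pos: "\<epsilon> > 0" using \<epsilon> \<epsilon>1 by simp
    have "\<epsilon> * C * T \<le> \<epsilon>0 * C * T" using \<epsilon> C T by (intro mult_right_mono) auto
    then have "\<epsilon> * C * T * C ^ 3 \<le> \<epsilon>0 * C * T * C ^ 3" by (rule mult_right_mono) (use C in simp)
    then have "\<epsilon> * C * T * C ^ 3 \<le> 1 / 100" using \<epsilon>0 \<kappa>0 by simp
    note cl = spinor_closed_of_trace[OF AB(1-3) p per D T \<epsilon>pos this[unfolded C_def] \<tau> \<epsilon>(3)]
    show "\<exists>r\<in>{0<..<2 / \<epsilon>1}. \<exists>\<alpha> \<beta>. \<exists>n::nat. n > 0 \<and> spinor p (1 / r) \<alpha> \<beta> \<and> \<alpha> 0 = 1 \<and> \<beta> 0 = 0 \<and>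
         (\<forall>x. \<alpha> (x + real n * T) = - \<alpha> x \<and> \<beta> (x + real n * T) = - \<beta> x) \<and>
         (\<forall>x y. x < y \<and> y < x + real n * T \<and> \<alpha> x * \<beta> x = \<alpha> y * \<beta> y \<longrightarrow> cmod (\<alpha> x) \<noteq> cmod (\<alpha> y))"
    proof (intro bexI exI conjI allI impI; (elim conjE)?)
      have "1 / \<epsilon> \<le> 1 / \<epsilon>1" using \<epsilon> \<epsilon>1 by (simp add: frac_le)
      also have "\<dots> < 2 / \<epsilon>1" using \<epsilon>1 by (simp add: divide_strict_right_mono)
      finally show "1 / \<epsilon> \<in> {0<..<2 / \<epsilon>1}" using \<epsilon>pos by simp
      show "n > 0" using n by simp
      show "spinor p (1 / (1 / \<epsilon>)) (A \<epsilon>) (B \<epsilon>)" using AB by simp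
    qed (use AB cl in auto)
  qed
qed

section \<open>Arclength parametrization of a periodic graph\<close>

lemma deriv_on_works:
  assumes "f differentiable_on I" "x \<in> I"
  shows "(f has_vector_derivative deriv_on I f x) (at x within I)"
  using assms unfolding deriv_on_def differentiable_on_def by (simp add: vector_derivative_works)

lemma deriv_on_eqI:
  assumes "(f has_vector_derivative d) (at x within {a..b})" "a < b" "x \<in> {a..b}"
  shows "deriv_on {a..b} f x = d"
proof -
  have "at x within {a..b} \<noteq> bot" using assms(2,3) islimpt_Icc trivial_limit_within by blast
  then show ?thesis unfolding deriv_on_def using assms(1) by (rule vector_derivative_within)
qed

lemma velocity_eqI: "(f has_vector_derivative d) (at x) \<Longrightarrow> velocity f x = d"
  by (simp add: deriv_on_def vector_derivative_at)

lemma C1_onI: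
  assumes "a < b" "\<And>x. x \<in> {a..b} \<Longrightarrow> (f has_vector_derivative f' x) (at x within {a..b})"
    "continuous_on {a..b} f'"
  shows "C1_on {a..b} f"
proof -
  have "continuous_on {a..b} (deriv_on {a..b} f)"
    using assms(3)
  proof (rule continuous_on_eq)
    show "f' x = deriv_on {a..b} f x" if "x \<in> {a..b}" for x
      using deriv_on_eqI[OF assms(2)[OF that] assms(1) that] by simp
  qed
  moreover have "f differentiable_on {a..b}"
    unfolding differentiable_on_def using assms(2) differentiableI_vector by blast
  ultimately show ?thesis by (simp add: C1_on_def)
qed

lemma C2_onI:
  assumes "a < b" "\<And>x. x \<in> {a..b} \<Longrightarrow> (f has_vector_derivative f' x) (at x within {a..b})"
    "\<And>x. x \<in> {a..b} \<Longrightarrow> (f' has_vector_derivative f'' x) (at x within {a..b})"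
    "continuous_on {a..b} f''"
  shows "C2_on {a..b} f"
proof -
  have eq: "deriv_on {a..b} f x = f' x" if "x \<in> {a..b}" for x
    using assms that by (intro deriv_on_eqI) auto
  have "f differentiable_on {a..b}"
    unfolding differentiable_on_def using assms(2) differentiableI_vector by blast
  moreover have "C1_on {a..b} (deriv_on {a..b} f)"
    using assms(1) _ assms(4)
  proof (rule C1_onI)
    show "(deriv_on {a..b} f has_vector_derivative f'' x) (at x within {a..b})" if "x \<in> {a..b}" for x
      using assms(3)[OF that] that by (rule has_vector_derivative_transform[rotated 2]) (simp add: eq)
  qed
  ultimately show ?thesis by (simp add: C2_on_def)
qed

lemma vector2_eq_scaleR: "(vector [a, b] :: real^2) = a *\<^sub>R axis 1 1 + b *\<^sub>R axis 2 1"
  by (simp add: vec_eq_iff forall_2 axis_def)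

lemma has_vector_derivative_vector2:
  assumes "(a has_vector_derivative a') (at t within I)" "(b has_vector_derivative b') (at t within I)"
  shows "((\<lambda>t. vector [a t, b t] :: real^2) has_vector_derivative vector [a', b']) (at t within I)"
  unfolding vector2_eq_scaleR
  by (intro has_vector_derivative_add bounded_linear.has_vector_derivative[OF bounded_linear_scaleR_left] assms)

lemma continuous_on_vector2:
  assumes "continuous_on I a" "continuous_on I b"
  shows "continuous_on I (\<lambda>t. vector [a t, b t] :: real^2)"
  unfolding vector2_eq_scaleR using assms by (intro continuous_intros)

lemma norm_vector2: "norm (vector [a, b] :: real^2) = sqrt (a\<^sup>2 + b\<^sup>2)"
  by (simp add: norm_vec_def L2_set_def sum_2)

section \<open>Periodic extensions and their antiderivatives\<close>

definition periodic_extension :: "real \<Rightarrow> (real \<Rightarrow> 'a) \<Rightarrow> real \<Rightarrow> 'a" where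
  "periodic_extension T q x = q (x - of_int \<lfloor>x / T\<rfloor> * T)"

text \<open>The right end point is included: there the floor is already j + 1 and the extension
  takes the value q 0, which is q T by assumption.\<close>

lemma periodic_extension_eq:
  assumes "T > 0" "q 0 = q T" "of_int j * T \<le> x" "x \<le> (of_int j + 1) * T"
  shows "periodic_extension T q x = q (x - of_int j * T)"
proof (cases "x = (of_int j + 1) * T")
  case True
  then have "x / T = of_int (j + 1)" using assms by simp
  then have "\<lfloor>x / T\<rfloor> = j + 1" by (simp only: floor_of_int)
  then show ?thesis using assms True by (simp add: periodic_extension_def algebra_simps)
next
  case False
  then have "\<lfloor>x / T\<rfloor> = j"
    using assms by (intro floor_unique) (simp_all add: pos_le_divide_eq pos_divide_less_eq)
  then show ?thesis by (simp add: periodic_extension_def)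
qed

lemma periodic_extension_shift:
  assumes "T > 0"
  shows "periodic_extension T q (x + T) = periodic_extension T q x"
proof -
  have "(x + T) / T = x / T + 1" using assms by (simp add: add_divide_distrib)
  then have "\<lfloor>(x + T) / T\<rfloor> = \<lfloor>x / T\<rfloor> + 1" by simp
  then show ?thesis by (simp add: periodic_extension_def algebra_simps)
qed

lemma continuous_on_periodic_extension:
  fixes q :: "real \<Rightarrow> 'a::topological_space"
  assumes T: "T > 0" and q: "continuous_on {0..T} q" "q 0 = q T"
  shows "continuous_on UNIV (periodic_extension T q)"
proof -
  have piece: "continuous_on {of_int j * T..(of_int j + 1) * T} (periodic_extension T q)" for j :: int
  proof (rule continuous_on_eq)
    show "continuous_on {of_int j * T..(of_int j + 1) * T} (\<lambda>x. q (x - of_int j * T))"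
      by (rule continuous_on_compose2[OF q(1)]) (auto intro!: continuous_intros simp: algebra_simps)
  qed (use periodic_extension_eq[of T q, OF T q(2)] in auto)
  have "isCont (periodic_extension T q) x" for x
  proof -
    define j where "j = \<lfloor>x / T\<rfloor>"
    have x: "of_int j * T \<le> x" "x < (of_int j + 1) * T"
      using floor_correct[of "x / T"] T
      by (simp_all add: j_def pos_le_divide_eq[symmetric] pos_divide_less_eq[symmetric])
    \<comment> \<open>A multiple of T is an end point of its own period, so the preceding one is
      attached to make x an interior point.\<close>
    have "{of_int (j - 1) * T..(of_int (j - 1) + 1) * T} \<union> {of_int j * T..(of_int j + 1) * T}
        = {of_int (j - 1) * T..(of_int j + 1) * T}"
      using T ivl_disj_un_two_touch(4)[of "of_int (j - 1) * T" "of_int j * T" "(of_int j + 1) * T"]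
      by (simp add: algebra_simps)
    with continuous_on_closed_Un[OF _ _ piece[of "j - 1"] piece[of j]]
    have "continuous_on {of_int (j - 1) * T..(of_int j + 1) * T} (periodic_extension T q)" by auto
    moreover have "x \<in> interior {of_int (j - 1) * T..(of_int j + 1) * T}"
      using x T by (auto simp: algebra_simps)
    ultimately show ?thesis by (rule continuous_on_interior)
  qed
  then show ?thesis by (simp add: continuous_at_imp_continuous_on)
qed

lemma DERIV_eq_imp_diff_const:
  fixes F G :: "real \<Rightarrow> real"
  assumes "\<And>x. (F has_real_derivative h x) (at x)" "\<And>x. (G has_real_derivative h x) (at x)"
  shows "F x - G x = F y - G y"
  by (rule DERIV_isconst_all) (use DERIV_diff[OF assms] in auto)

text \<open>F (x + T) and F x have the same derivative, so they differ by the constant F T.\<close>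

lemma antiderivative_shift:
  fixes F :: "real \<Rightarrow> real"
  assumes F: "\<And>x. (F has_real_derivative h x) (at x)" "F 0 = 0" and h: "\<And>x. h (x + T) = h x"
  shows "F (x + of_int j * T) = F x + of_int j * F T"
proof -
  have "((\<lambda>x. F (x + T)) has_real_derivative h x) (at x)" for x
    using F(1)[of "x + T"] by (simp add: DERIV_shift h)
  note shifted = this
  have step: "F (x + T) = F x + F T" for x
    using DERIV_eq_imp_diff_const[OF shifted F(1), of x 0] by (simp add: F(2))
  show ?thesis
  proof (induction j arbitrary: x rule: int_induct[where k = 0])
    case (step1 i)
    then show ?case using step[of "x + of_int i * T"] by (simp add: algebra_simps)
  next
    case (step2 i)
    then show ?case using step[of "x + of_int (i - 1) * T"] by (simp add: algebra_simps)
  qed simp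
qed

section \<open>Arc length and its inverse\<close>

text \<open>S grows at least as fast as the identity. Hence it reaches every t between the arguments
  - |t - S 0| and |t - S 0|, which gives surjectivity.\<close>

lemma increasing_antiderivative_inverse:
  fixes S :: "real \<Rightarrow> real"
  assumes S: "\<And>x. (S has_real_derivative s x) (at x)" and s: "\<And>x. 1 \<le> s x"
  obtains X where "\<And>x. X (S x) = x" "\<And>t. S (X t) = t"
    "\<And>t. (X has_real_derivative inverse (s (X t))) (at t)" "strict_mono X" "strict_mono S"
proof -
  have mono: "S x < S y" if "x < y" for x y
    using that by (rule DERIV_pos_imp_increasing) (use S s in \<open>meson less_le_trans zero_less_one\<close>)
  then have smono: "strict_mono S" by (rule strict_monoI)
  have growth: "y - x \<le> S y - S x" if "x \<le> y" for x y
  proof -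
    have "norm (y - x) \<le> S y - S x"
      by (rule vector_derivative_bound[of x y "\<lambda>x. x" "\<lambda>_. 1" S s])
        (use S s that in \<open>auto intro!: derivative_eq_intros\<close>)
    then show ?thesis using that by simp
  qed
  have isCont: "isCont S x" for x using S DERIV_isCont by blast
  have "\<exists>x. S x = t" for t
  proof -
    define u where "u = \<bar>t - S 0\<bar>"
    have "S (- u) \<le> t" "t \<le> S u"
      using growth[of 0 u] growth[of "- u" 0] by (auto simp: u_def)
    then show ?thesis
      using IVT[of S "- u" t u] isCont by (auto simp: u_def)
  qed
  then have "surj S" by (metis surj_def)
  then have bij: "bij S" using strict_mono_imp_inj_on[OF smono] by (simp add: bij_def)
  define X where "X = inv S"
  have X: "X (S x) = x" "S (X t) = t" for x t
    using bij by (simp_all add: X_def bij_is_inj bij_is_surj surj_f_inv_f)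
  have "isCont X t" for t
    using isCont_inverse_function[of 1 "X t" X S] X isCont by simp
  then have "(X has_real_derivative inverse (s (X t))) (at t)" for t
    using DERIV_inverse_function[OF S, of X t "t - 1" "t + 1"] s[of "X t"] X by auto
  moreover have "strict_mono X"
    by (rule strict_monoI) (metis X(2) linorder_neqE_linordered_idom mono order_less_asym)
  ultimately show ?thesis using that X smono by blast
qed

text \<open>\<open>graph_curve\<close> is given by a choice operator, so it is accessible only
  through a fact about every admissible curve: the arc length of the graph up to its abscissa is
  t.\<close>

lemma arclength_param_graph_unique:
  fixes f :: "real \<Rightarrow> real"
  assumes f: "f differentiable_on {0..T}"
    and S: "\<And>x. (S has_real_derivative s x) (at x)" "S 0 = 0" "S T = graph_length T f"
    and smono: "strict_mono S" and l: "graph_length T f > 0"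
    and s: "continuous_on UNIV s" "\<And>x. x \<in> {0..T} \<Longrightarrow> s x = sqrt (1 + (deriv_on {0..T} f x)\<^sup>2)"
    and c: "arclength_param_graph T f c" and t: "t \<in> {0..graph_length T f}"
  shows "S (c t $ 1) = t" "c t $ 2 = f (c t $ 1)"
proof -
  define I where "I = {0..graph_length T f}"
  have cI: "C1_on I c" "\<And>t. t \<in> I \<Longrightarrow> norm (deriv_on I c t) = 1" "c 0 = vector [0, f 0]"
    "c ` I = (\<lambda>x. vector [x, f x]) ` {0..T}"
    using c by (auto simp: arclength_param_graph_def I_def Let_def)
  define a where "a t = c t $ 1" for t
  have graph: "a t \<in> {0..T}" "c t $ 2 = f (a t)" if "t \<in> I" for t
  proof -
    have "c t \<in> (\<lambda>x. vector [x, f x]) ` {0..T}" using that cI(4) by blast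
    then show "a t \<in> {0..T}" "c t $ 2 = f (a t)" by (auto simp: a_def)
  qed
  have a0: "a 0 = 0" by (simp add: a_def cI(3))
  define a' where "a' t = deriv_on I c t $ 1" for t
  have cd: "(c has_vector_derivative deriv_on I c t) (at t within I)" if "t \<in> I" for t
    using cI(1) that by (intro deriv_on_works) (auto simp: C1_on_def)
  have ad: "(a has_vector_derivative a' t) (at t within I)" if "t \<in> I" for t
    unfolding a_def a'_def using bounded_linear.has_vector_derivative[OF bounded_linear_vec_nth cd[OF that]] .
  have acont: "continuous_on I a"
    unfolding continuous_on_eq_continuous_within using has_vector_derivative_continuous[OF ad] by blast
  have a'cont: "continuous_on I a'"
    using cI(1) unfolding a'_def C1_on_def by (intro continuous_intros) auto
  have speed: "(a' t)\<^sup>2 * (s (a t))\<^sup>2 = 1" if t: "t \<in> I" for t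
  proof -
    define d where "d = deriv_on {0..T} f (a t)"
    have "(f has_vector_derivative d) (at (a t) within {0..T})"
      unfolding d_def using f graph[OF t] by (intro deriv_on_works)
    then have "(f has_vector_derivative d) (at (a t) within a ` I)"
      by (rule has_vector_derivative_within_subset) (use graph in auto)
    from vector_diff_chain_within[OF ad[OF t] this]
    have "((\<lambda>t. f (a t)) has_vector_derivative a' t * d) (at t within I)" by (simp add: o_def)
    moreover have "((\<lambda>t. f (a t)) has_vector_derivative deriv_on I c t $ 2) (at t within I)"
      using bounded_linear.has_vector_derivative[OF bounded_linear_vec_nth cd[OF t], of 2] t
      by (rule has_vector_derivative_transform[rotated 2]) (simp add: graph)
    ultimately have "deriv_on I c t $ 2 = a' t * d"
      using t l vector_derivative_unique_within[of t I] islimpt_Icc[OF l, of t]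
      by (auto simp: trivial_limit_within I_def)
    moreover have "(norm (deriv_on I c t))\<^sup>2 = (a' t)\<^sup>2 + (deriv_on I c t $ 2)\<^sup>2"
      by (simp add: norm_vec_def L2_set_def sum_2 a'_def)
    ultimately have "(a' t)\<^sup>2 + (a' t * d)\<^sup>2 = 1" using cI(2)[OF t] by simp
    moreover have "(s (a t))\<^sup>2 = 1 + d\<^sup>2" using s(2) graph[OF t] by (simp add: d_def)
    ultimately show ?thesis by (simp add: algebra_simps power_mult_distrib)
  qed
  \<comment> \<open>Unit speed makes this continuous function take only the values 1 and -1, so it
    is constant on the connected parameter interval.\<close>
  define \<sigma> where "\<sigma> t = a' t * s (a t)" for t
  have "\<sigma> t = 1 \<or> \<sigma> t = -1" if "t \<in> I" for t
    using speed[OF that] by (simp add: \<sigma>_def power_mult_distrib[symmetric] power2_eq_1_iff)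
  then have "\<sigma> ` I \<subseteq> {1, -1}" by auto
  then have fin: "finite (\<sigma> ` I)" using finite_subset by blast
  have "continuous_on I \<sigma>"
    unfolding \<sigma>_def
    by (intro continuous_intros a'cont continuous_on_compose2[OF s(1) acont]) auto
  then have "connected (\<sigma> ` I)" by (rule connected_continuous_image) (simp add: I_def)
  then obtain k where k: "\<sigma> ` I \<subseteq> {k}"
    using fin connected_finite_iff_sing by (metis subset_refl empty_subsetI)
  have I0: "0 \<in> I" "graph_length T f \<in> I" using l by (auto simp: I_def)
  have \<sigma>k: "\<sigma> t = k" if "t \<in> I" for t using k that by auto
  have Sa: "((\<lambda>t. S (a t) - k * t) has_vector_derivative 0) (at t within I)" if "t \<in> I" for t
  proof -
    have "(S has_vector_derivative s (a t)) (at (a t) within a ` I)"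
      using S(1)[of "a t"]
      by (simp add: has_real_derivative_iff_has_vector_derivative has_vector_derivative_at_within)
    from vector_diff_chain_within[OF ad[OF that] this]
    have "((\<lambda>t. S (a t)) has_vector_derivative \<sigma> t) (at t within I)" by (simp add: o_def \<sigma>_def)
    moreover have "((\<lambda>t. k * t) has_vector_derivative k) (at t within I)"
      by (auto intro!: derivative_eq_intros simp: has_real_derivative_iff_has_vector_derivative[symmetric])
    ultimately show ?thesis using has_vector_derivative_diff \<sigma>k[OF that] by fastforce
  qed
  have Sk: "S (a t) = k * t" if "t \<in> I" for t
  proof -
    obtain m where "\<And>t. t \<in> I \<Longrightarrow> S (a t) - k * t = m"
      using has_vector_derivative_zero_constant[OF convex_real_interval(5) Sa[unfolded I_def]] unfolding I_def
      by blast
    from this[OF that] this[OF I0(1)] show ?thesis by (simp add: a0 S)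
  qed
  \<comment> \<open>For k = -1 the arc length at the final parameter would be negative, although the
    abscissa stays in [0, T].\<close>
  have "k = 1"
  proof -
    have "k = 1 \<or> k = -1" using \<open>\<sigma> ` I \<subseteq> {1, -1}\<close> k I0 by blast
    moreover have "0 \<le> S (a (graph_length T f))"
      using graph(1)[OF I0(2)] strict_mono_less_eq[OF smono, of 0] S(2) by auto
    ultimately show ?thesis using Sk[OF I0(2)] l by auto
  qed
  then show "S (c t $ 1) = t" "c t $ 2 = f (c t $ 1)"
    using Sk graph t by (simp_all add: a_def I_def)
qed

text \<open>X inverts the arc length function of the extended slope p. The continuation by
  translates then agrees with the single formula in X and P, because antiderivatives of periodic
  functions change by a constant over each period and P T = f T - f 0.\<close>

lemma periodic_graph_curve_param:
  fixes f :: "real \<Rightarrow> real"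
  assumes T: "T > 0" and f: "C2_on {0..T} f"
    and f0: "deriv_on {0..T} f 0 = 0" and fT: "deriv_on {0..T} f T = 0"
  defines "p \<equiv> periodic_extension T (deriv_on {0..T} f)" and "l \<equiv> graph_length T f"
  obtains P X where "\<And>x. (P has_real_derivative p x) (at x)" "l > 0" "X 0 = 0"
    "\<And>t j. X (t + of_int j * l) = X t + of_int j * T"
    "\<And>t. (X has_real_derivative inverse (sqrt (1 + (p (X t))\<^sup>2))) (at t)"
    "strict_mono X" "\<And>t. periodic_graph_curve T f t = vector [X t, f 0 + P (X t)]"
proof -
  define F1 where "F1 = deriv_on {0..T} f"
  have fdiff: "f differentiable_on {0..T}" using f by (simp add: C2_on_def)
  have fd: "(f has_vector_derivative F1 x) (at x within {0..T})" if "x \<in> {0..T}" for x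
    unfolding F1_def using fdiff that by (rule deriv_on_works)
  have F1cont: "continuous_on {0..T} F1"
    using f unfolding C2_on_def C1_on_def F1_def by (auto intro: differentiable_imp_continuous_on)
  have F10: "F1 0 = F1 T" using f0 fT by (simp add: F1_def)
  have p: "continuous_on UNIV p"
    unfolding p_def using T F1cont F10 by (intro continuous_on_periodic_extension) (simp_all add: F1_def)
  have pper: "p (x + T) = p x" for x unfolding p_def using T by (rule periodic_extension_shift)
  have pF: "p x = F1 x" if "x \<in> {0..T}" for x
    using periodic_extension_eq[of T F1 0 x] T F10 that by (simp add: p_def F1_def)
  define s where "s x = sqrt (1 + (p x)\<^sup>2)" for x
  have s: "continuous_on UNIV s" "\<And>x. 1 \<le> s x" "\<And>x. s (x + T) = s x"
    unfolding s_def using p by (auto intro!: continuous_intros simp: pper)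
  obtain P where P: "P 0 = 0" "\<And>x. (P has_real_derivative p x) (at x)"
    using antiderivative_exists[OF p] by (metis has_real_derivative_iff_has_vector_derivative)
  obtain S where S: "S 0 = 0" "\<And>x. (S has_real_derivative s x) (at x)"
    using antiderivative_exists[OF s(1)] by (metis has_real_derivative_iff_has_vector_derivative)
  obtain X where X: "\<And>x. X (S x) = x" "\<And>t. S (X t) = t"
    "\<And>t. (X has_real_derivative inverse (s (X t))) (at t)" "strict_mono X" "strict_mono S"
    by (rule increasing_antiderivative_inverse[OF S(2) s(2)]) (rule that)
  have fP: "f x = f 0 + P x" if "x \<in> {0..T}" for x
  proof -
    have "((\<lambda>x. f x - P x) has_vector_derivative 0) (at x within {0..T})" if "x \<in> {0..T}" for x
      using has_vector_derivative_diff[OF fd[OF that], of P "p x"] P(2)[of x] pF[OF that]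
      by (simp add: has_real_derivative_iff_has_vector_derivative has_vector_derivative_at_within)
    then obtain m where "\<And>x. x \<in> {0..T} \<Longrightarrow> f x - P x = m"
      using has_vector_derivative_zero_constant[OF convex_real_interval(5)] by blast
    from this[OF that] this[of 0] show ?thesis using T P(1) by simp
  qed
  have ST: "S T = l"
  proof -
    have "(s has_integral S T - S 0) {0..T}"
      using S(2) T by (intro fundamental_theorem_of_calculus)
        (auto simp: has_real_derivative_iff_has_vector_derivative has_vector_derivative_at_within)
    then have "((\<lambda>x. sqrt (1 + (F1 x)\<^sup>2)) has_integral S T - S 0) {0..T}"
      by (rule has_integral_eq[rotated]) (simp add: s_def pF)
    then show ?thesis by (simp add: l_def graph_length_def F1_def integral_unique S)
  qed
  have l: "l > 0" using strict_mono_less[OF X(5), of 0 T] T by (simp add: S ST)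
  have X0: "X 0 = 0" using X(1)[of 0] by (simp add: S)
  have Xl: "X l = T" using X(1)[of T] by (simp add: ST)
  have Xper: "X (t + of_int j * l) = X t + of_int j * T" for t j
  proof -
    have "S (X t + of_int j * T) = t + of_int j * l"
      using antiderivative_shift[OF S(2,1) s(3)] by (simp add: X ST)
    then show ?thesis using X(1) by metis
  qed
  have Pper: "P (x + of_int j * T) = P x + of_int j * P T" for x j
    using antiderivative_shift[OF P(2,1) pper] .
  have XI: "X t \<in> {0..T}" if "t \<in> {0..l}" for t
    using that strict_mono_less_eq[OF X(4), of 0 t] strict_mono_less_eq[OF X(4), of t l]
    by (simp add: X0 Xl)
  define c where "c t = (vector [X t, f 0 + P (X t)] :: real^2)" for t
  have "arclength_param_graph T f c"
  proof -
    define c' where "c' t = (vector [inverse (s (X t)), inverse (s (X t)) * p (X t)] :: real^2)" for t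
    have cd: "(c has_vector_derivative c' t) (at t within I)" for t I
      unfolding c_def c'_def
    proof (rule has_vector_derivative_vector2)
      show "(X has_vector_derivative inverse (s (X t))) (at t within I)"
        using X(3) by (simp add: has_real_derivative_iff_has_vector_derivative has_vector_derivative_at_within)
      have "((\<lambda>t. f 0 + P (X t)) has_real_derivative 0 + p (X t) * inverse (s (X t))) (at t)"
        by (intro DERIV_add DERIV_const DERIV_chain2[OF P(2) X(3)])
      then show "((\<lambda>t. f 0 + P (X t)) has_vector_derivative inverse (s (X t)) * p (X t)) (at t within I)"
        by (simp add: has_real_derivative_iff_has_vector_derivative has_vector_derivative_at_within mult.commute)
    qed
    have Xc: "continuous_on I X" for I
      using X(3) DERIV_isCont continuous_at_imp_continuous_on by blast
    have sX: "continuous_on I (\<lambda>t. inverse (s (X t)))" for I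
      by (intro continuous_on_inverse continuous_on_compose2[OF s(1) Xc]) (auto, metis not_one_le_zero s(2))
    have C1: "C1_on {0..l} c"
      using l cd by (rule C1_onI)
        (simp add: c'_def, intro continuous_on_vector2 continuous_on_mult sX continuous_on_compose2[OF p Xc], auto)
    have "norm (deriv_on {0..l} c t) = 1" if "t \<in> {0..l}" for t
    proof -
      have sp: "s (X t) > 0" using s(2)[of "X t"] by simp
      have "(inverse (s (X t)))\<^sup>2 + (inverse (s (X t)) * p (X t))\<^sup>2 = (1 + (p (X t))\<^sup>2) / (s (X t))\<^sup>2"
        by (simp add: power_mult_distrib field_simps add_divide_distrib)
      also have "\<dots> = 1" using sp by (simp add: s_def add_nonneg_eq_0_iff)
      finally show ?thesis
        using deriv_on_eqI[OF cd l that] by (simp add: c'_def norm_vector2)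
    qed
    moreover have "inj_on c {0..l}"
    proof (rule inj_onI)
      fix t u assume "c t = c u"
      then have "c t $ 1 = c u $ 1" by simp
      then have "X t = X u" by (simp add: c_def)
      then show "t = u" using X(2) by metis
    qed
    moreover have "c 0 = vector [0, f 0]" by (simp add: c_def X0 P)
    moreover have "c ` {0..l} = (\<lambda>x. vector [x, f x]) ` {0..T}"
    proof -
      have "X ` {0..l} = {0..T}"
      proof (intro equalityI subsetI)
        fix x assume "x \<in> {0..T}"
        then have "S x \<in> {0..l}"
          using strict_mono_less_eq[OF X(5), of 0 x] strict_mono_less_eq[OF X(5), of x T]
          by (simp add: S ST)
        then show "x \<in> X ` {0..l}" using X(1) by (metis imageI)
      qed (use XI in auto)
      moreover have "c t = vector [X t, f (X t)]" if "t \<in> {0..l}" for t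
        using fP[OF XI[OF that]] by (simp add: c_def)
      ultimately show ?thesis by (metis (no_types, lifting) image_cong image_image)
    qed
    ultimately show ?thesis using C1 by (simp add: arclength_param_graph_def Let_def l_def)
  qed
  then have arc: "arclength_param_graph T f (graph_curve T f)"
    unfolding graph_curve_def by (rule someI[where P = "arclength_param_graph T f"])
  have gc: "graph_curve T f t = vector [X t, f 0 + P (X t)]" if "t \<in> {0..l}" for t
  proof -
    have "S (graph_curve T f t $ 1) = t" "graph_curve T f t $ 2 = f (graph_curve T f t $ 1)"
      using arclength_param_graph_unique[OF fdiff S(2,1) _ X(5) _ s(1) _ arc] ST l that
      by (simp_all add: l_def s_def pF F1_def)
    then have "graph_curve T f t $ 1 = X t" "graph_curve T f t $ 2 = f (X t)" using X(1) by metis+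
    then show ?thesis using fP[OF XI[OF that]] by (simp add: vec_eq_iff forall_2)
  qed
  have "periodic_graph_curve T f t = vector [X t, f 0 + P (X t)]" for t
  proof -
    define j where "j = \<lfloor>t / l\<rfloor>"
    obtain y where "0 \<le> y" "y < l" "t = y + of_int \<lfloor>t / l\<rfloor> * l"
      using floor_reduction[OF l] by blast
    then have y: "y \<in> {0..l}" "t = y + of_int j * l" by (auto simp: j_def)
    have ty: "t - of_int j * l = y" using y(2) by simp
    have "periodic_graph_curve T f t = graph_curve T f y + of_int j *\<^sub>R vector [T, f T - f 0]"
      by (simp add: periodic_graph_curve_def Let_def l_def[symmetric] j_def[symmetric] ty)
    also have "\<dots> = vector [X y + of_int j * T, f 0 + (P (X y) + of_int j * P T)]"
      using fP[of T] T by (simp add: gc[OF y(1)] vec_eq_iff forall_2)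
    also have "\<dots> = vector [X t, f 0 + P (X t)]"
      unfolding y(2) Xper Pper ..
    finally show ?thesis .
  qed
  with that[of P X] P l X0 Xper X(3,4) show ?thesis by (simp add: s_def)
qed

section \<open>Frames on the sphere\<close>

lemma vector3_eq_scaleR:
  "(vector [a, b, c] :: real^3) = a *\<^sub>R axis 1 1 + b *\<^sub>R axis 2 1 + c *\<^sub>R axis 3 1"
  by (simp add: vec_eq_iff forall_3 axis_def)

lemma has_vector_derivative_vector3:
  assumes "(a has_vector_derivative a') (at t within I)" "(b has_vector_derivative b') (at t within I)"
    "(c has_vector_derivative c') (at t within I)"
  shows "((\<lambda>t. vector [a t, b t, c t] :: real^3) has_vector_derivative vector [a', b', c']) (at t within I)"
  unfolding vector3_eq_scaleR
  by (intro has_vector_derivative_add bounded_linear.has_vector_derivative[OF bounded_linear_scaleR_left] assms)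

lemma inner_vector3:
  fixes x y z :: real
  shows "(vector [a, b, c] :: real^3) \<bullet> vector [x, y, z] = a * x + b * y + c * z"
  by (simp add: inner_vec_def sum_3)

lemma cross3_vector3:
  "cross3 (vector [a, b, c]) (vector [x, y, z]) = vector [b * z - c * y, c * x - a * z, a * y - b * x]"
  by (simp add: cross3_def)

text \<open>The images of the imaginary quaternions \<open>i\<close>, \<open>j\<close>, \<open>k\<close> under conjugation by the unit quaternion
  \<open>\<alpha> + \<beta> j\<close>. For a solution of the spinor equation, this is the frame of the unit sphere that rolls
  along the graph without slipping and twisting.\<close>

definition quat_i :: "complex \<Rightarrow> complex \<Rightarrow> real^3" where
  "quat_i \<alpha> \<beta> = vector [(cmod \<alpha>)\<^sup>2 - (cmod \<beta>)\<^sup>2, 2 * Im (\<alpha> * \<beta>), - 2 * Re (\<alpha> * \<beta>)]"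

definition quat_j :: "complex \<Rightarrow> complex \<Rightarrow> real^3" where
  "quat_j \<alpha> \<beta> = vector [2 * Im (\<alpha> * cnj \<beta>), Re (\<alpha>\<^sup>2 + \<beta>\<^sup>2), Im (\<alpha>\<^sup>2 + \<beta>\<^sup>2)]"

definition quat_k :: "complex \<Rightarrow> complex \<Rightarrow> real^3" where
  "quat_k \<alpha> \<beta> = vector [2 * Re (\<alpha> * cnj \<beta>), - Im (\<alpha>\<^sup>2 - \<beta>\<^sup>2), Re (\<alpha>\<^sup>2 - \<beta>\<^sup>2)]"

text \<open>The relations hold for all quaternions as polynomial identities, with the squared norm N
  as a factor on the right. Setting N = 1 only afterwards leaves pure ring arithmetic.\<close>

lemma quat_frame:
  assumes "(cmod \<alpha>)\<^sup>2 + (cmod \<beta>)\<^sup>2 = 1"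
  shows "quat_i \<alpha> \<beta> \<bullet> quat_i \<alpha> \<beta> = 1" "quat_j \<alpha> \<beta> \<bullet> quat_j \<alpha> \<beta> = 1" "quat_k \<alpha> \<beta> \<bullet> quat_k \<alpha> \<beta> = 1"
    "quat_i \<alpha> \<beta> \<bullet> quat_j \<alpha> \<beta> = 0" "quat_i \<alpha> \<beta> \<bullet> quat_k \<alpha> \<beta> = 0" "quat_j \<alpha> \<beta> \<bullet> quat_k \<alpha> \<beta> = 0"
    "cross3 (quat_i \<alpha> \<beta>) (quat_j \<alpha> \<beta>) = quat_k \<alpha> \<beta>"
    "cross3 (quat_i \<alpha> \<beta>) (quat_k \<alpha> \<beta>) = - quat_j \<alpha> \<beta>"
proof -
  obtain a b c d where ab: "\<alpha> = Complex a b" "\<beta> = Complex c d"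
    by (metis complex_surj)
  define N where "N = a\<^sup>2 + b\<^sup>2 + c\<^sup>2 + d\<^sup>2"
  have N: "N = 1" using assms by (simp add: ab cmod_power2 N_def)
  have i: "quat_i \<alpha> \<beta> = vector [a\<^sup>2 + b\<^sup>2 - c\<^sup>2 - d\<^sup>2, 2 * (a * d + b * c), - 2 * (a * c - b * d)]"
    by (simp add: quat_i_def ab cmod_power2 algebra_simps)
  have j: "quat_j \<alpha> \<beta> = vector [2 * (b * c - a * d), a\<^sup>2 - b\<^sup>2 + c\<^sup>2 - d\<^sup>2, 2 * (a * b + c * d)]"
    by (simp add: quat_j_def ab power2_eq_square algebra_simps)
  have k: "quat_k \<alpha> \<beta> = vector [2 * (a * c + b * d), 2 * (c * d - a * b), a\<^sup>2 - b\<^sup>2 - c\<^sup>2 + d\<^sup>2]"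
    by (simp add: quat_k_def ab power2_eq_square algebra_simps)
  have "quat_i \<alpha> \<beta> \<bullet> quat_i \<alpha> \<beta> = N * N" "quat_j \<alpha> \<beta> \<bullet> quat_j \<alpha> \<beta> = N * N" "quat_k \<alpha> \<beta> \<bullet> quat_k \<alpha> \<beta> = N * N"
    "quat_i \<alpha> \<beta> \<bullet> quat_j \<alpha> \<beta> = 0" "quat_i \<alpha> \<beta> \<bullet> quat_k \<alpha> \<beta> = 0" "quat_j \<alpha> \<beta> \<bullet> quat_k \<alpha> \<beta> = 0"
    unfolding i j k inner_vector3 N_def by (simp_all add: power2_eq_square algebra_simps)
  then show "quat_i \<alpha> \<beta> \<bullet> quat_i \<alpha> \<beta> = 1" "quat_j \<alpha> \<beta> \<bullet> quat_j \<alpha> \<beta> = 1" "quat_k \<alpha> \<beta> \<bullet> quat_k \<alpha> \<beta> = 1"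
    "quat_i \<alpha> \<beta> \<bullet> quat_j \<alpha> \<beta> = 0" "quat_i \<alpha> \<beta> \<bullet> quat_k \<alpha> \<beta> = 0" "quat_j \<alpha> \<beta> \<bullet> quat_k \<alpha> \<beta> = 0"
    by (simp_all add: N)
  have "cross3 (quat_i \<alpha> \<beta>) (quat_j \<alpha> \<beta>) = N *\<^sub>R quat_k \<alpha> \<beta>"
    unfolding i j k cross3_vector3 N_def
    by (simp add: vec_eq_iff forall_3 power2_eq_square algebra_simps)
  then show "cross3 (quat_i \<alpha> \<beta>) (quat_j \<alpha> \<beta>) = quat_k \<alpha> \<beta>" by (simp add: N)
  have "cross3 (quat_i \<alpha> \<beta>) (quat_k \<alpha> \<beta>) = - (N *\<^sub>R quat_j \<alpha> \<beta>)"
    unfolding i j k cross3_vector3 N_def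
    by (simp add: vec_eq_iff forall_3 power2_eq_square algebra_simps)
  then show "cross3 (quat_i \<alpha> \<beta>) (quat_k \<alpha> \<beta>) = - quat_j \<alpha> \<beta>" by (simp add: N)
qed

text \<open>\<open>quat_i\<close> is the Hopf map; its fibres are the orbits of (\<alpha>, \<beta>)
  under opposite phases, which preserve the product and the moduli.\<close>

lemma quat_i_eqD:
  assumes "(cmod \<alpha>)\<^sup>2 + (cmod \<beta>)\<^sup>2 = 1" "(cmod \<alpha>')\<^sup>2 + (cmod \<beta>')\<^sup>2 = 1"
    and eq: "quat_i \<alpha> \<beta> = quat_i \<alpha>' \<beta>'"
  shows "\<alpha> * \<beta> = \<alpha>' * \<beta>'" "cmod \<alpha> = cmod \<alpha>'"
proof -
  have "quat_i \<alpha> \<beta> $ m = quat_i \<alpha>' \<beta>' $ m" for m using eq by simp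
  from this[of 1] this[of 2] this[of 3]
  have *: "(cmod \<alpha>)\<^sup>2 - (cmod \<beta>)\<^sup>2 = (cmod \<alpha>')\<^sup>2 - (cmod \<beta>')\<^sup>2"
    "Im (\<alpha> * \<beta>) = Im (\<alpha>' * \<beta>')" "Re (\<alpha> * \<beta>) = Re (\<alpha>' * \<beta>')"
    by (simp_all add: quat_i_def del: times_complex.sel)
  then show "\<alpha> * \<beta> = \<alpha>' * \<beta>'" by (simp add: complex_eq_iff del: times_complex.sel)
  have "(cmod \<alpha>)\<^sup>2 = (cmod \<alpha>')\<^sup>2" using *(1) assms by linarith
  then show "cmod \<alpha> = cmod \<alpha>'" by (simp add: power2_eq_iff_nonneg)
qed

lemmas DERIV_imp_vector = has_real_derivative_iff_has_vector_derivative[THEN iffD1]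

text \<open>With Q = \<alpha> + \<beta> j the spinor equation reads Q' = (\<epsilon> / 2) Q (k - p
  j). So the image of an imaginary unit v has as derivative \<epsilon> / 2 times the image of the
  commutator of k - p j with v.\<close>

lemma spinor_frame_derivatives:
  assumes s: "spinor p \<epsilon> \<alpha> \<beta>"
  shows "((\<lambda>x. quat_i (\<alpha> x) (\<beta> x)) has_vector_derivative
      \<epsilon> *\<^sub>R (quat_j (\<alpha> x) (\<beta> x) + p x *\<^sub>R quat_k (\<alpha> x) (\<beta> x))) (at x)"
    and "((\<lambda>x. quat_j (\<alpha> x) (\<beta> x)) has_vector_derivative - \<epsilon> *\<^sub>R quat_i (\<alpha> x) (\<beta> x)) (at x)"
    and "((\<lambda>x. quat_k (\<alpha> x) (\<beta> x)) has_vector_derivative - (\<epsilon> * p x) *\<^sub>R quat_i (\<alpha> x) (\<beta> x)) (at x)"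
proof -
  define a b c d where "a x = Re (\<alpha> x)" and "b x = Im (\<alpha> x)" and "c x = Re (\<beta> x)" and "d x = Im (\<beta> x)" for x
  have "(a has_real_derivative \<epsilon> / 2 * (p x * c x - d x)) (at x)"
    "(b has_real_derivative \<epsilon> / 2 * (p x * d x + c x)) (at x)"
    "(c has_real_derivative \<epsilon> / 2 * (- b x - p x * a x)) (at x)"
    "(d has_real_derivative \<epsilon> / 2 * (a x - p x * b x)) (at x)"
    using bounded_linear.has_vector_derivative[OF bounded_linear_Re spinorD(1)[OF s, of x]]
      bounded_linear.has_vector_derivative[OF bounded_linear_Im spinorD(1)[OF s, of x]]
      bounded_linear.has_vector_derivative[OF bounded_linear_Re spinorD(2)[OF s, of x]]
      bounded_linear.has_vector_derivative[OF bounded_linear_Im spinorD(2)[OF s, of x]]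
    by (simp_all add: a_def[abs_def] b_def[abs_def] c_def[abs_def] d_def[abs_def]
        has_real_derivative_iff_has_vector_derivative algebra_simps add_divide_distrib diff_divide_distrib)
  note D = this
  have i: "quat_i (\<alpha> x) (\<beta> x) = vector [(a x)\<^sup>2 + (b x)\<^sup>2 - (c x)\<^sup>2 - (d x)\<^sup>2, 2 * (a x * d x + b x * c x),
      - 2 * (a x * c x - b x * d x)]" for x
    by (simp add: quat_i_def a_def b_def c_def d_def cmod_power2 algebra_simps)
  have j: "quat_j (\<alpha> x) (\<beta> x) = vector [2 * (b x * c x - a x * d x), (a x)\<^sup>2 - (b x)\<^sup>2 + (c x)\<^sup>2 - (d x)\<^sup>2,
      2 * (a x * b x + c x * d x)]" for x
    by (simp add: quat_j_def a_def b_def c_def d_def power2_eq_square algebra_simps)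
  have k: "quat_k (\<alpha> x) (\<beta> x) = vector [2 * (a x * c x + b x * d x), 2 * (c x * d x - a x * b x),
      (a x)\<^sup>2 - (b x)\<^sup>2 - (c x)\<^sup>2 + (d x)\<^sup>2]" for x
    by (simp add: quat_k_def a_def b_def c_def d_def power2_eq_square algebra_simps)
  show "((\<lambda>x. quat_i (\<alpha> x) (\<beta> x)) has_vector_derivative
      \<epsilon> *\<^sub>R (quat_j (\<alpha> x) (\<beta> x) + p x *\<^sub>R quat_k (\<alpha> x) (\<beta> x))) (at x)"
    unfolding i j k
    by (rule has_vector_derivative_eq_rhs[OF has_vector_derivative_vector3[OF
            DERIV_imp_vector DERIV_imp_vector DERIV_imp_vector]], (rule D derivative_eq_intros refl)+)
      (simp add: vec_eq_iff forall_3 power2_eq_square field_simps)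
  show "((\<lambda>x. quat_j (\<alpha> x) (\<beta> x)) has_vector_derivative - \<epsilon> *\<^sub>R quat_i (\<alpha> x) (\<beta> x)) (at x)"
    unfolding i j k
    by (rule has_vector_derivative_eq_rhs[OF has_vector_derivative_vector3[OF
            DERIV_imp_vector DERIV_imp_vector DERIV_imp_vector]], (rule D derivative_eq_intros refl)+)
      (simp add: vec_eq_iff forall_3 power2_eq_square field_simps)
  show "((\<lambda>x. quat_k (\<alpha> x) (\<beta> x)) has_vector_derivative - (\<epsilon> * p x) *\<^sub>R quat_i (\<alpha> x) (\<beta> x)) (at x)"
    unfolding i j k
    by (rule has_vector_derivative_eq_rhs[OF has_vector_derivative_vector3[OF
            DERIV_imp_vector DERIV_imp_vector DERIV_imp_vector]], (rule D derivative_eq_intros refl)+)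
      (simp add: vec_eq_iff forall_3 power2_eq_square field_simps)
qed

lemma orthonormal_cross3_expansion:
  fixes a b w :: "real^3"
  assumes "a \<bullet> a = 1" "b \<bullet> b = 1" "a \<bullet> b = 0"
  shows "w = (w \<bullet> a) *\<^sub>R a + (w \<bullet> b) *\<^sub>R b + (w \<bullet> cross3 a b) *\<^sub>R cross3 a b"
proof -
  define c where "c = cross3 a b"
  have cc: "c \<bullet> c = 1"
    using assms by (simp add: c_def dot_cross inner_commute)
  have ca: "cross3 c a = b" and cb: "cross3 c b = - a"
    using assms Lagrange[of a a b] Lagrange[of b a b] cross_skew[of c a] cross_skew[of c b]
    by (simp_all add: c_def inner_commute)
  have "cross3 c w = (a \<bullet> w) *\<^sub>R b - (b \<bullet> w) *\<^sub>R a"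
    using Lagrange[of w a b] cross_skew[of c w] by (simp add: c_def inner_commute)
  then have "cross3 c (cross3 c w) = - (a \<bullet> w) *\<^sub>R a - (b \<bullet> w) *\<^sub>R b"
    by (simp add: Cross3.right_diff_distrib cross_mult_right ca cb)
  moreover have "cross3 c (cross3 c w) = (c \<bullet> w) *\<^sub>R c - w"
    using Lagrange[of c c w] cc by simp
  ultimately show ?thesis
    by (simp add: c_def[symmetric] inner_commute algebra_simps)
qed

section \<open>Liftings of a periodic graph\<close>

text \<open>\<open>p_pieces\<close> concerns derivatives within closed periods, since p may have
  corners at the multiples of T; the curves are therefore only piecewise C2.\<close>

locale rolling_graph =
  fixes p P X :: "real \<Rightarrow> real" and l T r y0 :: real and \<alpha> \<beta> :: "real \<Rightarrow> complex"
  assumes p: "continuous_on UNIV p" "p 0 = 0"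
    and p_pieces: "\<And>j::int. \<exists>p'. continuous_on {of_int j * T..(of_int j + 1) * T} p' \<and>
      (\<forall>x\<in>{of_int j * T..(of_int j + 1) * T}.
        (p has_vector_derivative p' x) (at x within {of_int j * T..(of_int j + 1) * T}))"
    and P: "\<And>x. (P has_real_derivative p x) (at x)"
    and pos: "l > 0" "r > 0"
    and X0: "X 0 = 0" and Xper: "\<And>t j. X (t + of_int j * l) = X t + of_int j * T"
    and X: "\<And>t. (X has_real_derivative inverse (sqrt (1 + (p (X t))\<^sup>2))) (at t)" and Xmono: "strict_mono X"
    and spin: "spinor p (1 / r) \<alpha> \<beta>" "\<alpha> 0 = 1" "\<beta> 0 = 0"
begin

definition c where "c t = (vector [X t, y0 + P (X t)] :: real^2)"
text \<open>As p is the slope, \<open>c1\<close> and \<open>c2\<close> are the cosine and the sine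
  of the angle of the tangent.\<close>

definition c1 where "c1 t = inverse (sqrt (1 + (p (X t))\<^sup>2))"
definition c2 where "c2 t = c1 t * p (X t)"
definition E1 where "E1 t = quat_i (\<alpha> (X t)) (\<beta> (X t))"
definition E2 where "E2 t = quat_j (\<alpha> (X t)) (\<beta> (X t))"
definition E3 where "E3 t = quat_k (\<alpha> (X t)) (\<beta> (X t))"

lemma X_deriv: "(X has_vector_derivative c1 t) (at t within I)"
  using X[of t]
  by (simp add: c1_def has_real_derivative_iff_has_vector_derivative has_vector_derivative_at_within)

lemma X_cont: "continuous_on I X"
  by (rule continuous_at_imp_continuous_on) (use DERIV_isCont[OF X] in blast)

lemma unit_speed: "(c1 t)\<^sup>2 + (c2 t)\<^sup>2 = 1"
proof -
  have "1 + (p (X t))\<^sup>2 > 0" by (simp add: add_pos_nonneg)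
  then have "(c1 t)\<^sup>2 * (1 + (p (X t))\<^sup>2) = 1" by (simp add: c1_def power_inverse)
  then show ?thesis by (simp add: c2_def power_mult_distrib algebra_simps)
qed

lemma c_deriv: "(c has_vector_derivative vector [c1 t, c2 t]) (at t within I)"
  unfolding c_def
proof (rule has_vector_derivative_vector2[OF X_deriv])
  have "((\<lambda>t. y0 + P (X t)) has_real_derivative 0 + p (X t) * c1 t) (at t)"
    unfolding c1_def by (intro DERIV_add DERIV_const DERIV_chain2[OF P X])
  then show "((\<lambda>t. y0 + P (X t)) has_vector_derivative c2 t) (at t within I)"
    by (simp add: c2_def has_real_derivative_iff_has_vector_derivative has_vector_derivative_at_within mult.commute)
qed

lemma velocity_c: "velocity c = (\<lambda>t. vector [c1 t, c2 t])"
  by (rule ext) (rule velocity_eqI[OF c_deriv])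

lemma norm_velocity_c: "norm (velocity c t) = 1"
  using unit_speed by (simp add: velocity_c norm_vector2)

lemma c12_cont: "continuous_on I c1" "continuous_on I c2"
proof -
  have "continuous_on I (\<lambda>t. p (X t))"
    by (rule continuous_on_compose2[OF p(1) X_cont]) auto
  moreover have "sqrt (1 + (p (X t))\<^sup>2) \<noteq> 0" for t
    by (smt (verit) real_sqrt_eq_zero_cancel_iff zero_le_power2)
  ultimately show 1: "continuous_on I c1"
    unfolding c1_def by (intro continuous_intros) auto
  show "continuous_on I c2"
    unfolding c2_def by (intro continuous_intros 1 \<open>continuous_on I (\<lambda>t. p (X t))\<close>)
qed

lemma c12_0: "c1 0 = 1" "c2 0 = 0"
  by (simp_all add: c1_def c2_def X0 p)

lemma quat_norm: "(cmod (\<alpha> x))\<^sup>2 + (cmod (\<beta> x))\<^sup>2 = 1"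
  using spinor_norm[OF spin(1), of x] by (simp add: spin)

lemmas E_frame = quat_frame[OF quat_norm, of "X t" for t, folded E1_def E2_def E3_def]

lemma E_0: "E1 0 = vector [1, 0, 0]" "E2 0 = vector [0, 1, 0]" "E3 0 = vector [0, 0, 1]"
  by (simp_all add: E1_def E2_def E3_def quat_i_def quat_j_def quat_k_def X0 spin)

lemma E_deriv:
  "(E1 has_vector_derivative (1 / r) *\<^sub>R (c1 t *\<^sub>R E2 t + c2 t *\<^sub>R E3 t)) (at t within I)"
  "(E2 has_vector_derivative - (c1 t / r) *\<^sub>R E1 t) (at t within I)"
  "(E3 has_vector_derivative - (c2 t / r) *\<^sub>R E1 t) (at t within I)"
proof -
  note d = spinor_frame_derivatives[OF spin(1), of "X t", folded E1_def E2_def E3_def]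
  note ch = vector_diff_chain_within[OF X_deriv has_vector_derivative_at_within, of _ _ t, unfolded o_def]
  show "(E1 has_vector_derivative (1 / r) *\<^sub>R (c1 t *\<^sub>R E2 t + c2 t *\<^sub>R E3 t)) (at t within I)"
    unfolding E1_def[abs_def]
    by (rule has_vector_derivative_eq_rhs[OF ch[OF d(1)]]) (simp add: c2_def algebra_simps)
  show "(E2 has_vector_derivative - (c1 t / r) *\<^sub>R E1 t) (at t within I)"
    unfolding E2_def[abs_def]
    by (rule has_vector_derivative_eq_rhs[OF ch[OF d(2)]]) simp
  show "(E3 has_vector_derivative - (c2 t / r) *\<^sub>R E1 t) (at t within I)"
    unfolding E3_def[abs_def]
    by (rule has_vector_derivative_eq_rhs[OF ch[OF d(3)]]) (simp add: c2_def)
qed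

lemma E_cont: "continuous_on I E1" "continuous_on I E2" "continuous_on I E3"
  unfolding continuous_on_eq_continuous_within
  using has_vector_derivative_continuous[OF E_deriv(1)] has_vector_derivative_continuous[OF E_deriv(2)]
    has_vector_derivative_continuous[OF E_deriv(3)] by blast+

lemma c12_pieces:
  fixes j :: int
  defines "I \<equiv> {of_int j * l..(of_int j + 1) * l}"
  shows "\<exists>c1' c2'. continuous_on I c1' \<and> continuous_on I c2' \<and>
    (\<forall>t\<in>I. (c1 has_vector_derivative c1' t) (at t within I) \<and> (c2 has_vector_derivative c2' t) (at t within I))"
proof -
  define J where "J = {of_int j * T..(of_int j + 1) * T}"
  obtain p' where p': "continuous_on J p'" "\<And>x. x \<in> J \<Longrightarrow> (p has_vector_derivative p' x) (at x within J)"
    using p_pieces[of j] unfolding J_def by blast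
  have XJ: "X t \<in> J" if "t \<in> I" for t
    using that Xper[of 0 j] Xper[of 0 "j + 1"] strict_mono_less_eq[OF Xmono, of "of_int j * l" t]
      strict_mono_less_eq[OF Xmono, of t "(of_int j + 1) * l"]
    by (simp add: I_def J_def X0)
  define q' where "q' t = p' (X t) * c1 t" for t
  have q'_cont: "continuous_on I q'"
    unfolding q'_def
    by (intro continuous_on_mult c12_cont continuous_on_compose2[OF p'(1) X_cont]) (use XJ in auto)
  have q': "((\<lambda>t. p (X t)) has_vector_derivative q' t) (at t within I)" if "t \<in> I" for t
  proof -
    have "(p has_vector_derivative p' (X t)) (at (X t) within X ` I)"
      using p'(2)[OF XJ[OF that]] by (rule has_vector_derivative_within_subset) (use XJ in auto)
    from vector_diff_chain_within[OF X_deriv this] show ?thesis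
      by (simp add: o_def q'_def mult.commute)
  qed
  define h' where "h' z = - (z * inverse (sqrt (1 + z\<^sup>2)) ^ 3)" for z :: real
  have h: "((\<lambda>z. inverse (sqrt (1 + z\<^sup>2))) has_real_derivative h' z) (at z)" for z
  proof -
    have "1 + z\<^sup>2 > 0" by (simp add: add_pos_nonneg)
    then show ?thesis
      unfolding h'_def
      by (auto intro!: derivative_eq_intros simp: power3_eq_cube field_simps)
  qed
  have h'_cont: "continuous_on UNIV h'"
    unfolding h'_def by (intro continuous_intros) (smt (verit) real_sqrt_eq_zero_cancel_iff zero_le_power2)
  define c1' where "c1' t = q' t * h' (p (X t))" for t
  have pX: "continuous_on I (\<lambda>t. p (X t))"
    by (rule continuous_on_compose2[OF p(1) X_cont]) auto
  have c1'_cont: "continuous_on I c1'"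
    unfolding c1'_def by (intro continuous_on_mult q'_cont continuous_on_compose2[OF h'_cont pX]) auto
  have c1': "(c1 has_vector_derivative c1' t) (at t within I)" if "t \<in> I" for t
  proof -
    have "((\<lambda>z. inverse (sqrt (1 + z\<^sup>2))) has_vector_derivative h' (p (X t))) (at (p (X t)) within (\<lambda>t. p (X t)) ` I)"
      using h[of "p (X t)"]
      by (simp add: has_real_derivative_iff_has_vector_derivative has_vector_derivative_at_within)
    from vector_diff_chain_within[OF q'[OF that] this] show ?thesis
      by (simp add: o_def c1'_def c1_def[abs_def])
  qed
  define c2' where "c2' t = c1 t * q' t + c1' t * p (X t)" for t
  have "continuous_on I c2'"
    unfolding c2'_def by (intro continuous_on_add continuous_on_mult c12_cont q'_cont c1'_cont pX)
  moreover have "(c2 has_vector_derivative c2' t) (at t within I)" if "t \<in> I" for t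
    unfolding c2_def[abs_def] c2'_def by (rule has_vector_derivative_mult[OF c1'[OF that] q'[OF that]])
  ultimately show ?thesis using c1'_cont c1' by blast
qed

definition breaks :: "real set" where "breaks = range (\<lambda>j::int. of_int j * l)"

lemma finite_breaks: "finite (breaks \<inter> {a..b})"
proof (rule finite_subset)
  show "breaks \<inter> {a..b} \<subseteq> (\<lambda>j::int. of_int j * l) ` {\<lfloor>a / l\<rfloor>..\<lceil>b / l\<rceil>}"
  proof
    fix t assume "t \<in> breaks \<inter> {a..b}"
    then obtain j :: int where j: "t = of_int j * l" "a \<le> of_int j * l" "of_int j * l \<le> b"
      by (auto simp: breaks_def)
    then have "a / l \<le> of_int j" "of_int j \<le> b / l"
      using pos by (simp_all add: pos_divide_le_eq pos_le_divide_eq)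
    then have "j \<in> {\<lfloor>a / l\<rfloor>..\<lceil>b / l\<rceil>}" by (auto simp: floor_le_iff le_ceiling_iff)
    then show "t \<in> (\<lambda>j::int. of_int j * l) ` {\<lfloor>a / l\<rfloor>..\<lceil>b / l\<rceil>}" using j(1) by blast
  qed
qed simp

text \<open>Either end of the interval may be a break; the floor of a / l selects the piece to the
  right of a.\<close>

lemma piece_of_interval:
  assumes "a < b" "{a<..<b} \<inter> breaks = {}"
  obtains j :: int where "{a..b} \<subseteq> {of_int j * l..(of_int j + 1) * l}"
proof -
  define j where "j = \<lfloor>a / l\<rfloor>"
  have "of_int j \<le> a / l" "a / l < of_int j + 1"
    using floor_correct[of "a / l"] by (simp_all add: j_def)
  then have a: "of_int j * l \<le> a" "a < (of_int j + 1) * l"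
    using pos by (simp_all add: pos_le_divide_eq pos_divide_less_eq)
  have "(of_int j + 1) * l \<in> breaks"
    unfolding breaks_def using rangeI[of "\<lambda>j::int. of_int j * l" "j + 1"] by simp
  then have "b \<le> (of_int j + 1) * l" using assms a by force
  then show ?thesis using that[of j] a by auto
qed

lemma piece_interior:
  assumes "t \<notin> breaks"
  obtains j :: int where "t \<in> {of_int j * l<..<(of_int j + 1) * l}"
proof -
  define j where "j = \<lfloor>t / l\<rfloor>"
  have "of_int j \<le> t / l" "t / l < of_int j + 1"
    using floor_correct[of "t / l"] by (simp_all add: j_def)
  then have "of_int j * l \<le> t" "t < (of_int j + 1) * l"
    using pos by (simp_all add: pos_le_divide_eq pos_divide_less_eq)
  moreover have "of_int j * l \<noteq> t" using assms by (auto simp: breaks_def)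
  ultimately show ?thesis using that[of j] by simp
qed

lemma c_twice_differentiable:
  assumes "t \<notin> breaks"
  shows "twice_differentiable_at c t"
proof -
  obtain j :: int where t: "t \<in> {of_int j * l<..<(of_int j + 1) * l}" using piece_interior[OF assms] .
  obtain c1' c2' where c': "\<And>t. t \<in> {of_int j * l..(of_int j + 1) * l} \<Longrightarrow>
      (c1 has_vector_derivative c1' t) (at t within {of_int j * l..(of_int j + 1) * l})"
    "\<And>t. t \<in> {of_int j * l..(of_int j + 1) * l} \<Longrightarrow>
      (c2 has_vector_derivative c2' t) (at t within {of_int j * l..(of_int j + 1) * l})"
    using c12_pieces[of j] by blast
  have "((\<lambda>t. vector [c1 t, c2 t] :: real^2) has_vector_derivative vector [c1' t, c2' t])
      (at t within {of_int j * l..(of_int j + 1) * l})"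
    using t by (intro has_vector_derivative_vector2 c') auto
  moreover have "at t within {of_int j * l..(of_int j + 1) * l} = at t"
    by (rule at_within_interior) (use t in auto)
  ultimately have "velocity c differentiable at t"
    unfolding velocity_c by (auto intro: differentiableI_vector)
  then show ?thesis
    using differentiableI_vector[OF c_deriv] by (simp add: twice_differentiable_at_def)
qed

text \<open>A lifting has prescribed curvature wherever c is twice differentiable, which may include
  breaks, so no position of t is assumed. The orthogonality is the derivative of the unit speed
  relation.\<close>

lemma c_twice_differentiableD:
  assumes "twice_differentiable_at c t"
  obtains c1' c2' where "(c1 has_vector_derivative c1') (at t)" "(c2 has_vector_derivative c2') (at t)"
    "plane_curvature c t = c1 t * c2' - c2 t * c1'" "c1 t * c1' + c2 t * c2' = 0"
proof -
  have "velocity c differentiable at t" using assms by (simp add: twice_differentiable_at_def)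
  then obtain a where a: "(velocity c has_vector_derivative a) (at t)"
    using vector_derivative_works by blast
  have d: "(c1 has_vector_derivative a $ 1) (at t)" "(c2 has_vector_derivative a $ 2) (at t)"
    using bounded_linear.has_vector_derivative[OF bounded_linear_vec_nth[of 1] a]
      bounded_linear.has_vector_derivative[OF bounded_linear_vec_nth[of 2] a]
    by (simp_all add: velocity_c)
  have "((\<lambda>t. (c1 t)\<^sup>2 + (c2 t)\<^sup>2) has_vector_derivative 2 * (c1 t * a $ 1 + c2 t * a $ 2)) (at t)"
    unfolding power2_eq_square
    by (rule has_vector_derivative_eq_rhs[OF has_vector_derivative_add[OF
            has_vector_derivative_mult[OF d(1) d(1)] has_vector_derivative_mult[OF d(2) d(2)]]]) simp
  then have "((\<lambda>t. 1) has_vector_derivative 2 * (c1 t * a $ 1 + c2 t * a $ 2)) (at t)"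
    by (simp only: unit_speed)
  from vector_derivative_unique_at[OF this has_vector_derivative_const]
  have "c1 t * a $ 1 + c2 t * a $ 2 = 0" by simp
  moreover have "plane_curvature c t = c1 t * a $ 2 - c2 t * a $ 1"
    unfolding plane_curvature_def velocity_eqI[OF a] norm_velocity_c by (simp add: velocity_c)
  ultimately show ?thesis using that d by blast
qed

lemma sphere_curvature_unit:
  assumes "norm (velocity g t) = 1"
  shows "sphere_curvature r g t = acceleration g t \<bullet> cross3 (g t /\<^sub>R r) (velocity g t)"
  by (simp add: sphere_curvature_def assms)

text \<open>The frame E2, E3 is parallel: its derivatives point along E1. The tangent of the rolled
  curve has in it the coefficients c1, c2 that the tangent of c has in the plane, so the curvatures
  agree.\<close>

lemma rolled_curve_lifts: "r_lifting r c (\<lambda>t. r *\<^sub>R E1 t)"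
proof -
  define g where "g t = r *\<^sub>R E1 t" for t
  define w where "w t = c1 t *\<^sub>R E2 t + c2 t *\<^sub>R E3 t" for t
  have gd: "(g has_vector_derivative w t) (at t within I)" for t I
    unfolding g_def
    by (rule has_vector_derivative_eq_rhs[OF bounded_linear.has_vector_derivative[OF bounded_linear_scaleR_right E_deriv(1)]])
      (use pos in \<open>simp add: w_def\<close>)
  have wd: "(w has_vector_derivative c1' *\<^sub>R E2 t + c2' *\<^sub>R E3 t - (1 / r) *\<^sub>R E1 t) (at t within I)"
    if c': "(c1 has_vector_derivative c1') (at t within I)" "(c2 has_vector_derivative c2') (at t within I)"
    for t I c1' c2'
  proof -
    have c1: "(c1 has_field_derivative c1') (at t within I)" and c2: "(c2 has_field_derivative c2') (at t within I)"
      using c' by (simp_all add: has_real_derivative_iff_has_vector_derivative)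
    have u: "c1 t * (c1 t / r) + c2 t * (c2 t / r) = 1 / r"
      using unit_speed[of t] by (simp add: power2_eq_square add_divide_distrib[symmetric])
    have "(w has_vector_derivative (c1 t *\<^sub>R (- (c1 t / r) *\<^sub>R E1 t) + c1' *\<^sub>R E2 t)
        + (c2 t *\<^sub>R (- (c2 t / r) *\<^sub>R E1 t) + c2' *\<^sub>R E3 t)) (at t within I)"
      unfolding w_def[abs_def]
      by (intro has_vector_derivative_add has_vector_derivative_scaleR c1 c2 E_deriv)
    moreover have "(c1 t *\<^sub>R (- (c1 t / r) *\<^sub>R E1 t) + c1' *\<^sub>R E2 t) + (c2 t *\<^sub>R (- (c2 t / r) *\<^sub>R E1 t) + c2' *\<^sub>R E3 t)
      = c1' *\<^sub>R E2 t + c2' *\<^sub>R E3 t - (c1 t * (c1 t / r) + c2 t * (c2 t / r)) *\<^sub>R E1 t"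
      by (simp add: algebra_simps)
    ultimately show ?thesis by (simp only: u)
  qed
  have vg: "velocity g = w" by (rule ext) (rule velocity_eqI[OF gd])
  have nw: "norm (w t) = 1" for t
  proof -
    have "w t \<bullet> w t = 1"
      using unit_speed[of t] E_frame[of t]
      by (simp add: w_def inner_add_left inner_add_right inner_commute power2_eq_square)
    then show ?thesis by (simp add: norm_eq_sqrt_inner)
  qed
  have w_cont: "continuous_on I w" for I
    unfolding w_def by (intro continuous_intros c12_cont E_cont)
  show ?thesis
    unfolding r_lifting_def g_def[symmetric]
  proof (intro conjI allI impI)
    have "norm (E1 t) = 1" for t using E_frame(1)[of t] by (simp add: norm_eq_sqrt_inner)
    then show "range g \<subseteq> sphere 0 r" using pos by (auto simp: g_def)
    show "C1_on UNIV g"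
      unfolding C1_on_def vg differentiable_on_def
      using w_cont differentiableI_vector[OF gd] by blast
    show "piecewise_C2 g"
      unfolding piecewise_C2_def
    proof (intro exI[of _ breaks] conjI allI impI finite_breaks)
      fix a b :: real assume ab: "a < b" "{a<..<b} \<inter> breaks = {}"
      obtain j :: int where j: "{a..b} \<subseteq> {of_int j * l..(of_int j + 1) * l}"
        using piece_of_interval[OF ab] .
      obtain c1' c2' where c': "continuous_on {of_int j * l..(of_int j + 1) * l} c1'"
        "continuous_on {of_int j * l..(of_int j + 1) * l} c2'"
        "\<And>t. t \<in> {of_int j * l..(of_int j + 1) * l} \<Longrightarrow>
          (c1 has_vector_derivative c1' t) (at t within {of_int j * l..(of_int j + 1) * l})"
        "\<And>t. t \<in> {of_int j * l..(of_int j + 1) * l} \<Longrightarrow>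
          (c2 has_vector_derivative c2' t) (at t within {of_int j * l..(of_int j + 1) * l})"
        using c12_pieces[of j] by blast
      show "C2_on {a..b} g"
      proof (rule C2_onI[OF ab(1) gd])
        show "(w has_vector_derivative c1' t *\<^sub>R E2 t + c2' t *\<^sub>R E3 t - (1 / r) *\<^sub>R E1 t) (at t within {a..b})"
          if "t \<in> {a..b}" for t
          using that j by (intro wd has_vector_derivative_within_subset[OF c'(3) j]
              has_vector_derivative_within_subset[OF c'(4) j]) auto
        show "continuous_on {a..b} (\<lambda>t. c1' t *\<^sub>R E2 t + c2' t *\<^sub>R E3 t - (1 / r) *\<^sub>R E1 t)"
          by (intro continuous_intros E_cont continuous_on_subset[OF c'(1) j] continuous_on_subset[OF c'(2) j])
      qed
    qed
    show "g 0 = vector [r, 0, 0]" by (simp add: g_def E_0 vec_eq_iff forall_3)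
    show "\<exists>a. velocity g 0 = a *\<^sub>R vector [0, 1, 0]"
      by (rule exI[of _ 1]) (simp add: vg w_def c12_0 E_0)
    show "norm (velocity g t) = norm (velocity c t)" for t
      by (simp add: norm_velocity_c vg nw)
    fix t assume tw: "twice_differentiable_at c t"
    obtain c1' c2' where c': "(c1 has_vector_derivative c1') (at t)" "(c2 has_vector_derivative c2') (at t)"
      and k: "plane_curvature c t = c1 t * c2' - c2 t * c1'"
      using c_twice_differentiableD[OF tw] by blast
    show "twice_differentiable_at g t"
      unfolding twice_differentiable_at_def vg
      using differentiableI_vector[OF gd] differentiableI_vector[OF wd[OF c']] by simp
    have "acceleration g t = c1' *\<^sub>R E2 t + c2' *\<^sub>R E3 t - (1 / r) *\<^sub>R E1 t"
      unfolding vg by (rule velocity_eqI[OF wd[OF c']])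
    moreover have "cross3 (g t /\<^sub>R r) (w t) = c1 t *\<^sub>R E3 t - c2 t *\<^sub>R E2 t"
      using pos E_frame[of t] by (simp add: g_def w_def cross_add_right cross_mult_right)
    ultimately show "sphere_curvature r g t = plane_curvature c t"
      using E_frame[of t] nw[of t] unfolding k
      by (simp add: sphere_curvature_unit vg inner_add_left inner_add_right inner_diff_left inner_diff_right inner_commute)
  qed
qed

end

section \<open>Uniqueness of liftings up to a half-turn\<close>

text \<open>The identity for \<sigma> = 1 and the half-turn about the first axis for \<sigma> = -1,
  in one formula to treat both liftings at once.\<close>

definition turn :: "real \<Rightarrow> real^3 \<Rightarrow> real^3" where
  "turn \<sigma> z = vector [z $ 1, \<sigma> * z $ 2, \<sigma> * z $ 3]"

lemma inner_turn:
  assumes "\<sigma> * \<sigma> = 1"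
  shows "turn \<sigma> x \<bullet> turn \<sigma> y = x \<bullet> y"
proof -
  have "\<sigma> * a * (\<sigma> * b) = (\<sigma> * \<sigma>) * (a * b)" for a b by simp
  then have sq: "\<sigma> * a * (\<sigma> * b) = a * b" for a b by (simp only: assms mult_1)
  show ?thesis by (simp only: turn_def inner_vec_def sum_3 inner_real_def vector_3 sq)
qed

lemma bounded_linear_turn: "bounded_linear (turn \<sigma>)"
  unfolding linear_conv_bounded_linear[symmetric]
  by (rule linearI) (simp_all add: turn_def vec_eq_iff forall_3 algebra_simps)

lemma has_vector_derivative_inner:
  fixes f g :: "real \<Rightarrow> 'a::real_inner"
  assumes "(f has_vector_derivative f') (at t)" "(g has_vector_derivative g') (at t)"
  shows "((\<lambda>t. f t \<bullet> g t) has_vector_derivative f t \<bullet> g' + f' \<bullet> g t) (at t)"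
  using bounded_bilinear.has_vector_derivative[OF bounded_bilinear_inner assms] .

lemma has_vector_derivative_cross3:
  assumes "(f has_vector_derivative f') (at t)" "(g has_vector_derivative g') (at t)"
  shows "((\<lambda>t. cross3 (f t) (g t)) has_vector_derivative cross3 (f t) g' + cross3 f' (g t)) (at t)"
  using bounded_bilinear.has_vector_derivative[OF bilinear_cross[unfolded bilinear_conv_bounded_bilinear] assms] .

context rolling_graph
begin

text \<open>Both the given lifting and the rolled curve carry frames solving the same linear equation, so the
  sum of the inner products of corresponding vectors is constant; its initial value 3 is the maximum.\<close>

lemma lifting_eq_rolled:
  assumes g: "r_lifting r c g"
  obtains \<sigma> where "\<sigma> * \<sigma> = 1" "\<And>t. g t = r *\<^sub>R turn \<sigma> (E1 t)"
proof -
  define e1 where "e1 t = (1 / r) *\<^sub>R g t" for t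
  define e2 where "e2 = velocity g"
  define e3 where "e3 t = cross3 (e1 t) (e2 t)" for t
  have g_diff: "g differentiable_on UNIV" and e2_cont: "continuous_on UNIV e2"
    using g by (simp_all add: r_lifting_def C1_on_def e2_def)
  have gd: "(g has_vector_derivative e2 t) (at t)" for t
    using deriv_on_works[OF g_diff, of t] by (simp add: e2_def)
  have e1d: "(e1 has_vector_derivative (1 / r) *\<^sub>R e2 t) (at t)" for t
    unfolding e1_def using bounded_linear.has_vector_derivative[OF bounded_linear_scaleR_right gd] .
  have e1_cont: "continuous_on UNIV e1"
    unfolding continuous_on_eq_continuous_within
    using has_vector_derivative_continuous[OF e1d] continuous_at_imp_continuous_within by blast
  have g_norm: "norm (g t) = r" for t
  proof -
    have "range g \<subseteq> sphere 0 r" using g by (simp add: r_lifting_def)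
    then have "g t \<in> sphere 0 r" by blast
    then show ?thesis by simp
  qed
  have e1_norm: "e1 t \<bullet> e1 t = 1" for t
    using pos by (simp add: e1_def dot_square_norm g_norm power2_eq_square)
  have "norm (e2 t) = 1" for t
    using g norm_velocity_c by (simp add: r_lifting_def e2_def)
  then have e2_norm: "e2 t \<bullet> e2 t = 1" for t by (simp add: dot_square_norm)
  have e12: "e1 t \<bullet> e2 t = 0" for t
  proof -
    have "((\<lambda>t. 1) has_vector_derivative e1 t \<bullet> ((1 / r) *\<^sub>R e2 t) + ((1 / r) *\<^sub>R e2 t) \<bullet> e1 t) (at t)"
      using has_vector_derivative_inner[OF e1d e1d, of t] by (simp only: e1_norm)
    from vector_derivative_unique_at[OF this has_vector_derivative_const]
    show ?thesis using pos by (simp add: inner_commute)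
  qed
  have e3_frame: "e3 t \<bullet> e3 t = 1" "e1 t \<bullet> e3 t = 0" "e2 t \<bullet> e3 t = 0" "cross3 (e1 t) (e3 t) = - e2 t" for t
    using e1_norm e2_norm e12
    by (simp_all add: e3_def dot_cross dot_cross_self Lagrange inner_commute)
  \<comment> \<open>The frame e2, e3 turned back by the tangent angle of c; these are the vectors to
    be compared with E2 and E3.\<close>
  define u where "u t = c1 t *\<^sub>R e2 t - c2 t *\<^sub>R e3 t" for t
  define v where "v t = c2 t *\<^sub>R e2 t + c1 t *\<^sub>R e3 t" for t
  have e2_uv: "e2 t = c1 t *\<^sub>R u t + c2 t *\<^sub>R v t" for t
  proof -
    have "c1 t *\<^sub>R u t + c2 t *\<^sub>R v t = ((c1 t)\<^sup>2 + (c2 t)\<^sup>2) *\<^sub>R e2 t"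
      by (simp add: u_def v_def algebra_simps power2_eq_square)
    then show ?thesis by (simp add: unit_speed)
  qed
  have uv_norm: "u t \<bullet> u t = 1" "v t \<bullet> v t = 1" for t
    using unit_speed[of t] e3_frame[of t] e2_norm[of t]
    by (simp_all add: u_def v_def inner_add_left inner_add_right inner_diff_left inner_diff_right
        inner_commute power2_eq_square add.commute)
  have uv_deriv: "(u has_vector_derivative - (c1 t / r) *\<^sub>R e1 t) (at t)"
      "(v has_vector_derivative - (c2 t / r) *\<^sub>R e1 t) (at t)" if t: "t \<notin> breaks" for t
  proof -
    have tw: "twice_differentiable_at c t" using c_twice_differentiable[OF t] .
    obtain k1 k2 where k: "(c1 has_vector_derivative k1) (at t)" "(c2 has_vector_derivative k2) (at t)"
      "plane_curvature c t = c1 t * k2 - c2 t * k1" and k0: "c1 t * k1 + c2 t * k2 = 0"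
      using c_twice_differentiableD[OF tw] by blast
    have c12: "(c1 has_field_derivative k1) (at t)" "(c2 has_field_derivative k2) (at t)"
      using k by (simp_all add: has_real_derivative_iff_has_vector_derivative)
    have "e2 differentiable at t" and curv: "sphere_curvature r g t = plane_curvature c t"
      using g tw by (auto simp: r_lifting_def twice_differentiable_at_def e2_def)
    then obtain w where w: "(e2 has_vector_derivative w) (at t)"
      using vector_derivative_works by blast
    define \<kappa> where "\<kappa> = c1 t * k2 - c2 t * k1"
    have "w \<bullet> e3 t = \<kappa>"
      using curv sphere_curvature_unit[of g t] \<open>norm (e2 t) = 1\<close> velocity_eqI[OF w] k(3)
      by (simp add: e2_def[symmetric] e3_def e1_def \<kappa>_def inverse_eq_divide)
    moreover have "w \<bullet> e2 t = 0"
    proof -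
      have "((\<lambda>t. 1) has_vector_derivative e2 t \<bullet> w + w \<bullet> e2 t) (at t)"
        using has_vector_derivative_inner[OF w w] by (simp only: e2_norm)
      from vector_derivative_unique_at[OF this has_vector_derivative_const]
      show ?thesis by (simp add: inner_commute)
    qed
    moreover have "w \<bullet> e1 t = - (1 / r)"
    proof -
      have "((\<lambda>t. 0) has_vector_derivative e1 t \<bullet> w + ((1 / r) *\<^sub>R e2 t) \<bullet> e2 t) (at t)"
        using has_vector_derivative_inner[OF e1d w] by (simp only: e12)
      from vector_derivative_unique_at[OF this has_vector_derivative_const]
      show ?thesis by (simp add: inner_commute e2_norm)
    qed
    ultimately have w_eq: "w = - (1 / r) *\<^sub>R e1 t + \<kappa> *\<^sub>R e3 t"
      using orthonormal_cross3_expansion[OF e1_norm[of t] e2_norm[of t] e12[of t], of w] by (simp add: e3_def)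
    have e3d: "(e3 has_vector_derivative - \<kappa> *\<^sub>R e2 t) (at t)"
    proof -
      have "cross3 (e1 t) w + cross3 ((1 / r) *\<^sub>R e2 t) (e2 t) = - \<kappa> *\<^sub>R e2 t"
        by (simp add: w_eq cross_add_right Cross3.right_diff_distrib cross_mult_right cross_mult_left e3_frame)
      then show ?thesis
        unfolding e3_def[abs_def] using has_vector_derivative_cross3[OF e1d w] by simp
    qed
    \<comment> \<open>The vector (k1, k2) is orthogonal to the unit vector (c1, c2), hence \<kappa>
      times (- c2, c1). This removes the tangential terms from the derivatives of u and v.\<close>
    have \<kappa>: "\<kappa> * c2 t = - k1" "\<kappa> * c1 t = k2"
    proof -
      have "\<kappa> * c2 t = c1 t * (c2 t * k2) - (c2 t)\<^sup>2 * k1"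
        by (simp add: \<kappa>_def power2_eq_square algebra_simps)
      also have "c2 t * k2 = - (c1 t * k1)" using k0 by simp
      also have "c1 t * - (c1 t * k1) - (c2 t)\<^sup>2 * k1 = - (((c1 t)\<^sup>2 + (c2 t)\<^sup>2) * k1)"
        by (simp add: power2_eq_square algebra_simps)
      finally show "\<kappa> * c2 t = - k1" by (simp add: unit_speed)
      have "\<kappa> * c1 t = (c1 t)\<^sup>2 * k2 - c2 t * (c1 t * k1)"
        by (simp add: \<kappa>_def power2_eq_square algebra_simps)
      also have "c1 t * k1 = - (c2 t * k2)" using k0 by simp
      also have "(c1 t)\<^sup>2 * k2 - c2 t * - (c2 t * k2) = ((c1 t)\<^sup>2 + (c2 t)\<^sup>2) * k2"
        by (simp add: power2_eq_square algebra_simps)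
      finally show "\<kappa> * c1 t = k2" by (simp add: unit_speed)
    qed
    have "(u has_vector_derivative (c1 t *\<^sub>R w + k1 *\<^sub>R e2 t) - (c2 t *\<^sub>R (- \<kappa> *\<^sub>R e2 t) + k2 *\<^sub>R e3 t)) (at t)"
      unfolding u_def[abs_def]
      by (intro has_vector_derivative_diff has_vector_derivative_scaleR c12 w e3d)
    moreover have "(c1 t *\<^sub>R w + k1 *\<^sub>R e2 t) - (c2 t *\<^sub>R (- \<kappa> *\<^sub>R e2 t) + k2 *\<^sub>R e3 t)
        = - (c1 t / r) *\<^sub>R e1 t + (k1 + \<kappa> * c2 t) *\<^sub>R e2 t + (\<kappa> * c1 t - k2) *\<^sub>R e3 t"
      by (simp add: w_eq algebra_simps)
    ultimately show "(u has_vector_derivative - (c1 t / r) *\<^sub>R e1 t) (at t)" by (simp add: \<kappa>)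
    have "(v has_vector_derivative (c2 t *\<^sub>R w + k2 *\<^sub>R e2 t) + (c1 t *\<^sub>R (- \<kappa> *\<^sub>R e2 t) + k1 *\<^sub>R e3 t)) (at t)"
      unfolding v_def[abs_def]
      by (intro has_vector_derivative_add has_vector_derivative_scaleR c12 w e3d)
    moreover have "(c2 t *\<^sub>R w + k2 *\<^sub>R e2 t) + (c1 t *\<^sub>R (- \<kappa> *\<^sub>R e2 t) + k1 *\<^sub>R e3 t)
        = - (c2 t / r) *\<^sub>R e1 t + (k2 - \<kappa> * c1 t) *\<^sub>R e2 t + (\<kappa> * c2 t + k1) *\<^sub>R e3 t"
      by (simp add: w_eq algebra_simps)
    ultimately show "(v has_vector_derivative - (c2 t / r) *\<^sub>R e1 t) (at t)" by (simp add: \<kappa>)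
  qed
  obtain \<sigma> where \<sigma>: "e2 0 = \<sigma> *\<^sub>R vector [0, 1, 0]"
    using g by (auto simp: r_lifting_def e2_def)
  have \<sigma>\<sigma>: "\<sigma> * \<sigma> = 1"
    using e2_norm[of 0] by (simp add: \<sigma> inner_vector3)
  have e1_0: "e1 0 = vector [1, 0, 0]"
    using g pos by (simp add: r_lifting_def e1_def vec_eq_iff forall_3)
  have e3_0: "e3 0 = \<sigma> *\<^sub>R vector [0, 0, 1]"
    by (simp add: e3_def e1_0 \<sigma> cross_mult_right cross3_vector3)
  define Q where "Q t = e1 t \<bullet> turn \<sigma> (E1 t) + u t \<bullet> turn \<sigma> (E2 t) + v t \<bullet> turn \<sigma> (E3 t)" for t
  note turn_linear = bounded_linear.linear[OF bounded_linear_turn]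
  note turn_simps = linear_add[OF turn_linear] linear_cmul[OF turn_linear]
  have Q_deriv: "(Q has_vector_derivative 0) (at t)" if "t \<notin> breaks" for t
  proof -
    note td = bounded_linear.has_vector_derivative[OF bounded_linear_turn[of \<sigma>]]
    note d = has_vector_derivative_add[OF has_vector_derivative_add[OF
          has_vector_derivative_inner[OF e1d td[OF E_deriv(1)]]
          has_vector_derivative_inner[OF uv_deriv(1)[OF that] td[OF E_deriv(2)]]]
          has_vector_derivative_inner[OF uv_deriv(2)[OF that] td[OF E_deriv(3)]]]
    show ?thesis
      unfolding Q_def[abs_def]
    proof (rule has_vector_derivative_eq_rhs[OF d])
      show "e1 t \<bullet> turn \<sigma> ((1 / r) *\<^sub>R (c1 t *\<^sub>R E2 t + c2 t *\<^sub>R E3 t)) + (1 / r) *\<^sub>R e2 t \<bullet> turn \<sigma> (E1 t) +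
        (u t \<bullet> turn \<sigma> (- (c1 t / r) *\<^sub>R E1 t) + - (c1 t / r) *\<^sub>R e1 t \<bullet> turn \<sigma> (E2 t)) +
        (v t \<bullet> turn \<sigma> (- (c2 t / r) *\<^sub>R E1 t) + - (c2 t / r) *\<^sub>R e1 t \<bullet> turn \<sigma> (E3 t)) = 0"
        by (subst e2_uv)
          (simp only: turn_simps inner_add_left inner_add_right inner_scaleR_left inner_scaleR_right,
            simp add: algebra_simps)
    qed
  qed
  have e3_cont: "continuous_on UNIV e3"
    unfolding e3_def
    using bounded_bilinear.continuous_on[OF bilinear_cross[unfolded bilinear_conv_bounded_bilinear] e1_cont e2_cont] .
  have Q_cont: "continuous_on UNIV Q"
    unfolding Q_def u_def v_def
    by (intro continuous_intros e1_cont e2_cont e3_cont c12_cont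
        bounded_linear.continuous_on[OF bounded_linear_turn] E_cont)
  \<comment> \<open>The derivative of Q is known only off the breaks; continuity of Q and local
    finiteness of the breaks bridge them.\<close>
  have Q3: "Q t = 3" for t
  proof (rule has_derivative_zero_unique_strong_connected[where f = Q and x = t and y = 3 and c = 0 and S = "ball 0 (\<bar>t\<bar> + 1)"
        and K = "breaks \<inter> {- (\<bar>t\<bar> + 1)..\<bar>t\<bar> + 1}"])
    show "connected (ball (0::real) (\<bar>t\<bar> + 1))" "open (ball (0::real) (\<bar>t\<bar> + 1))" by auto
    show "finite (breaks \<inter> {- (\<bar>t\<bar> + 1)..\<bar>t\<bar> + 1})" by (rule finite_breaks)
    show "continuous_on (ball (0::real) (\<bar>t\<bar> + 1)) Q" using Q_cont by (rule continuous_on_subset) simp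
    show "0 \<in> ball (0::real) (\<bar>t\<bar> + 1)" "t \<in> ball (0::real) (\<bar>t\<bar> + 1)" by auto
    show "Q 0 = 3"
      by (simp add: Q_def u_def v_def E_0 e1_0 e3_0 \<sigma> c12_0 turn_def inner_vector3 \<sigma>\<sigma>)
    show "(Q has_derivative (\<lambda>h. 0)) (at x within ball (0::real) (\<bar>t\<bar> + 1))"
      if "x \<in> ball (0::real) (\<bar>t\<bar> + 1) - breaks \<inter> {- (\<bar>t\<bar> + 1)..\<bar>t\<bar> + 1}" for x
    proof -
      have "x \<notin> breaks" using that by auto
      from Q_deriv[OF this] show ?thesis
        by (simp add: has_vector_derivative_def has_derivative_at_withinI)
    qed
  qed
  \<comment> \<open>Three inner products of unit vectors add up to 3, so each of them is 1.\<close>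
  have "e1 t = turn \<sigma> (E1 t)" for t
  proof -
    have le: "x \<bullet> y \<le> 1" if "x \<bullet> x = 1" "y \<bullet> y = 1" for x y :: "real^3"
      using norm_cauchy_schwarz[of x y] that by (simp add: norm_eq_sqrt_inner)
    have "e1 t \<bullet> turn \<sigma> (E1 t) = 1"
      using Q3[of t] le[OF e1_norm, of "turn \<sigma> (E1 t)" t] le[OF uv_norm(1), of "turn \<sigma> (E2 t)" t]
        le[OF uv_norm(2), of "turn \<sigma> (E3 t)" t] E_frame(1-3)[of t]
      by (simp add: Q_def inner_turn[OF \<sigma>\<sigma>])
    then have "(e1 t - turn \<sigma> (E1 t)) \<bullet> (e1 t - turn \<sigma> (E1 t)) = 0"
      using e1_norm[of t] E_frame(1)[of t]
      by (simp add: inner_diff_left inner_diff_right inner_commute inner_turn[OF \<sigma>\<sigma>])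
    then show ?thesis by simp
  qed
  then have "g t = r *\<^sub>R turn \<sigma> (E1 t)" for t
    using pos by (simp flip: \<open>\<And>t. e1 t = turn \<sigma> (E1 t)\<close> add: e1_def)
  with \<sigma>\<sigma> show ?thesis by (rule that)
qed

text \<open>The period is n times the length of the graph: the sign change of the spinor is
  invisible on the sphere because \<open>quat_i\<close> is quadratic.\<close>

lemma lifting_simple_closed:
  fixes n :: nat
  assumes n: "n > 0"
    and neg: "\<And>x. \<alpha> (x + real n * T) = - \<alpha> x" "\<And>x. \<beta> (x + real n * T) = - \<beta> x"
    and inj: "\<And>x y. x < y \<Longrightarrow> y < x + real n * T \<Longrightarrow> \<alpha> x * \<beta> x = \<alpha> y * \<beta> y \<Longrightarrow> cmod (\<alpha> x) \<noteq> cmod (\<alpha> y)"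
    and g: "r_lifting r c g"
  shows "simple_closed g"
proof -
  obtain \<sigma> where \<sigma>: "\<sigma> * \<sigma> = 1" "\<And>t. g t = r *\<^sub>R turn \<sigma> (E1 t)"
    by (rule lifting_eq_rolled[OF g]) (rule that)
  have X_shift: "X (t + real n * l) = X t + real n * T" for t using Xper[of t "int n"] by simp
  have "g (t + real n * l) = g t" for t
    by (simp add: \<sigma>(2) E1_def X_shift neg quat_i_def)
  moreover have "g t \<noteq> g u" if "0 \<le> t" "t < u" "u < real n * l" for t u
  proof
    assume "g t = g u"
    then have "turn \<sigma> (E1 t) = turn \<sigma> (E1 u)" using pos by (simp add: \<sigma>(2))
    then have "(turn \<sigma> (E1 t - E1 u)) \<bullet> turn \<sigma> (E1 t - E1 u) = 0"
      by (simp add: linear_diff[OF bounded_linear.linear[OF bounded_linear_turn]])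
    then have "E1 t = E1 u" by (simp add: inner_turn[OF \<sigma>(1)])
    then have "\<alpha> (X t) * \<beta> (X t) = \<alpha> (X u) * \<beta> (X u)" "cmod (\<alpha> (X t)) = cmod (\<alpha> (X u))"
      using quat_i_eqD[OF quat_norm[of "X t"] quat_norm[of "X u"]] unfolding E1_def by blast+
    moreover have "X t < X u" "X u < X t + real n * T"
      using strict_mono_less[OF Xmono, of t u] strict_mono_less[OF Xmono, of u "t + real n * l"] that
      by (simp_all add: X_shift)
    ultimately show False using inj[of "X t" "X u"] by blast
  qed
  then have "inj_on g {0..<real n * l}"
    by (intro linorder_inj_onI) auto
  moreover have "real n * l > 0" using n pos by simp
  ultimately show ?thesis unfolding simple_closed_def by blast
qed

end

section \<open>Application to a given function\<close>

text \<open>The suprema are informative only for bounded sets, which compactness of the interval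
  provides; the other two summands are then nonnegative.\<close>

lemma abs_deriv_le_C2_norm:
  assumes f: "C2_on {0..T} f" and x: "x \<in> {0..T}"
  shows "\<bar>deriv_on {0..T} f x\<bar> \<le> C2_norm {0..T} f"
proof -
  define F1 F2 where "F1 = deriv_on {0..T} f" and "F2 = deriv_on {0..T} F1"
  have "continuous_on {0..T} f" "continuous_on {0..T} F1" "continuous_on {0..T} F2"
    using f by (auto simp: C2_on_def C1_on_def F1_def F2_def intro: differentiable_imp_continuous_on)
  then have bdd: "bdd_above ((\<lambda>x. \<bar>h x\<bar>) ` {0..T})" if "h \<in> {f, F1, F2}" for h
    using that by (intro bounded_imp_bdd_above compact_imp_bounded compact_continuous_image)
      (auto intro!: continuous_intros)
  have "0 \<le> (SUP x\<in>{0..T}. \<bar>h x\<bar>)" if "h \<in> {f, F1, F2}" for h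
    by (rule cSUP_upper2[OF bdd[OF that] x]) simp
  then have "0 \<le> (SUP x\<in>{0..T}. \<bar>f x\<bar>)" "0 \<le> (SUP x\<in>{0..T}. \<bar>F2 x\<bar>)" by blast+
  moreover have "\<bar>F1 x\<bar> \<le> (SUP x\<in>{0..T}. \<bar>F1 x\<bar>)"
    by (rule cSUP_upper[OF x bdd]) simp
  ultimately show ?thesis by (simp add: C2_norm_def F1_def F2_def)
qed

lemma periodic_extension_pieces:
  fixes q :: "real \<Rightarrow> real" and j :: int
  assumes T: "T > 0" and q: "C1_on {0..T} q" "q 0 = q T"
  defines "I \<equiv> {of_int j * T..(of_int j + 1) * T}"
  shows "\<exists>p'. continuous_on I p' \<and>
    (\<forall>x\<in>I. (periodic_extension T q has_vector_derivative p' x) (at x within I))"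
proof (intro exI conjI ballI)
  have sub: "x - of_int j * T \<in> {0..T}" if "x \<in> I" for x using that by (simp add: I_def algebra_simps)
  show "continuous_on I (\<lambda>x. deriv_on {0..T} q (x - of_int j * T))"
    using q(1) unfolding C1_on_def
    by (intro continuous_on_compose2[of "{0..T}" "deriv_on {0..T} q" I "\<lambda>x. x - of_int j * T"] continuous_intros)
      (use sub in auto)
  fix x assume x: "x \<in> I"
  have "(q has_vector_derivative deriv_on {0..T} q (x - of_int j * T))
      (at (x - of_int j * T) within (\<lambda>x. x - of_int j * T) ` I)"
    using q(1) sub[OF x] unfolding C1_on_def
    by (intro has_vector_derivative_within_subset[OF deriv_on_works]) (use sub in auto)
  moreover have "((\<lambda>x. x - of_int j * T) has_vector_derivative 1) (at x within I)"
    by (auto intro!: derivative_eq_intros)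
  ultimately have "((\<lambda>x. q (x - of_int j * T)) has_vector_derivative deriv_on {0..T} q (x - of_int j * T)) (at x within I)"
    using vector_diff_chain_within[of "\<lambda>x. x - of_int j * T" 1 x I q] by (simp add: o_def)
  then show "(periodic_extension T q has_vector_derivative deriv_on {0..T} q (x - of_int j * T)) (at x within I)"
    using x periodic_extension_eq[OF T q(2), of j]
    by (rule_tac has_vector_derivative_transform[rotated 2]) (auto simp: I_def)
qed

theorem theorem7:
  fixes T D :: real
  assumes "T > 0" and "D > 0"
  shows "\<exists>\<rho>>0. \<forall>f :: real \<Rightarrow> real.
           C2_on {0..T} f \<and> deriv_on {0..T} f 0 = 0 \<and> deriv_on {0..T} f T = 0 \<and>
           C2_norm {0..T} f < D \<longrightarrow>
           (\<exists>r\<in>{0<..<\<rho>}.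
              (\<exists>g. r_lifting r (periodic_graph_curve T f) g) \<and>
              (\<forall>g. r_lifting r (periodic_graph_curve T f) g \<longrightarrow> simple_closed g))"
proof -
  obtain \<rho> where \<rho>: "\<rho> > 0" and closed:
    "\<forall>p. continuous_on UNIV p \<and> (\<forall>x. p (x + T) = p x) \<and> (\<forall>x. \<bar>p x\<bar> \<le> D) \<longrightarrow>
      (\<exists>r\<in>{0<..<\<rho>}. \<exists>\<alpha> \<beta>. \<exists>n::nat. n > 0 \<and> spinor p (1 / r) \<alpha> \<beta> \<and> \<alpha> 0 = 1 \<and> \<beta> 0 = 0 \<and>
        (\<forall>x. \<alpha> (x + real n * T) = - \<alpha> x \<and> \<beta> (x + real n * T) = - \<beta> x) \<and>
        (\<forall>x y. x < y \<and> y < x + real n * T \<and> \<alpha> x * \<beta> x = \<alpha> y * \<beta> y \<longrightarrow> cmod (\<alpha> x) \<noteq> cmod (\<alpha> y)))"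
    using spinor_closed[OF assms] by blast
  show ?thesis
  proof (intro exI[of _ \<rho>] conjI \<rho> allI impI, elim conjE)
    fix f :: "real \<Rightarrow> real"
    assume f: "C2_on {0..T} f" and f0: "deriv_on {0..T} f 0 = 0" and fT: "deriv_on {0..T} f T = 0"
      and norm: "C2_norm {0..T} f < D"
    define F1 where "F1 = deriv_on {0..T} f"
    define p where "p = periodic_extension T F1"
    have F1: "C1_on {0..T} F1" "F1 0 = F1 T" using f f0 fT by (simp_all add: C2_on_def F1_def)
    have p: "continuous_on UNIV p"
      unfolding p_def using assms(1) F1
      by (intro continuous_on_periodic_extension differentiable_imp_continuous_on) (auto simp: C1_on_def)
    have bound: "\<bar>p x\<bar> \<le> D" for x
    proof -
      obtain y where "0 \<le> y" "y < T" "x = y + of_int \<lfloor>x / T\<rfloor> * T"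
        using floor_reduction[OF assms(1)] by blast
      then have "x - of_int \<lfloor>x / T\<rfloor> * T = y" "y \<in> {0..T}" by auto
      then have "p x = F1 y" "y \<in> {0..T}" by (simp_all only: p_def periodic_extension_def)
      then show ?thesis using abs_deriv_le_C2_norm[OF f, of y] norm by (simp add: F1_def)
    qed
    have per: "p (x + T) = p x" for x unfolding p_def using assms(1) by (rule periodic_extension_shift)
    obtain r \<alpha> \<beta> and n :: nat where r: "r \<in> {0<..<\<rho>}"
      and *: "n > 0 \<and> spinor p (1 / r) \<alpha> \<beta> \<and> \<alpha> 0 = 1 \<and> \<beta> 0 = 0 \<and>
        (\<forall>x. \<alpha> (x + real n * T) = - \<alpha> x \<and> \<beta> (x + real n * T) = - \<beta> x) \<and>
        (\<forall>x y. x < y \<and> y < x + real n * T \<and> \<alpha> x * \<beta> x = \<alpha> y * \<beta> y \<longrightarrow> cmod (\<alpha> x) \<noteq> cmod (\<alpha> y))"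
    proof -
      have "\<exists>r\<in>{0<..<\<rho>}. \<exists>\<alpha> \<beta>. \<exists>n::nat. n > 0 \<and> spinor p (1 / r) \<alpha> \<beta> \<and> \<alpha> 0 = 1 \<and> \<beta> 0 = 0 \<and>
        (\<forall>x. \<alpha> (x + real n * T) = - \<alpha> x \<and> \<beta> (x + real n * T) = - \<beta> x) \<and>
        (\<forall>x y. x < y \<and> y < x + real n * T \<and> \<alpha> x * \<beta> x = \<alpha> y * \<beta> y \<longrightarrow> cmod (\<alpha> x) \<noteq> cmod (\<alpha> y))"
        by (rule closed[THEN spec, THEN mp]) (simp add: p per bound)
      then show ?thesis by (elim bexE exE) (rule that)
    qed
    then have n: "n > 0" and spin: "spinor p (1 / r) \<alpha> \<beta>" "\<alpha> 0 = 1" "\<beta> 0 = 0"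
      and neg: "\<And>x. \<alpha> (x + real n * T) = - \<alpha> x" "\<And>x. \<beta> (x + real n * T) = - \<beta> x"
      and inj: "\<And>x y. x < y \<Longrightarrow> y < x + real n * T \<Longrightarrow> \<alpha> x * \<beta> x = \<alpha> y * \<beta> y \<Longrightarrow> cmod (\<alpha> x) \<noteq> cmod (\<alpha> y)"
      by blast+
    obtain P X where PX: "\<And>x. (P has_real_derivative p x) (at x)" "graph_length T f > 0" "X 0 = 0"
      "\<And>t j. X (t + of_int j * graph_length T f) = X t + of_int j * T"
      "\<And>t. (X has_real_derivative inverse (sqrt (1 + (p (X t))\<^sup>2))) (at t)"
      "strict_mono X" "\<And>t. periodic_graph_curve T f t = vector [X t, f 0 + P (X t)]"
      by (rule periodic_graph_curve_param[OF assms(1) f f0 fT, folded F1_def, folded p_def]) (rule that)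
    interpret rolling_graph p P X "graph_length T f" T r "f 0" \<alpha> \<beta>
    proof
      \<comment> \<open>The initial tangent of the plane curve is (1, 0), so the rolled curve starts
        in the direction of E2, the prescribed (0, 1, 0).\<close>
      show "p 0 = 0" using f0 by (simp add: p_def periodic_extension_def F1_def)
      show "\<exists>p'. continuous_on {of_int j * T..(of_int j + 1) * T} p' \<and>
          (\<forall>x\<in>{of_int j * T..(of_int j + 1) * T}.
            (p has_vector_derivative p' x) (at x within {of_int j * T..(of_int j + 1) * T}))" for j :: int
        unfolding p_def using assms(1) F1 by (rule periodic_extension_pieces)
    qed (use p PX r spin in auto)
    have c: "periodic_graph_curve T f = c" by (rule ext) (simp add: PX(7) c_def)
    show "\<exists>r\<in>{0<..<\<rho>}.
        (\<exists>g. r_lifting r (periodic_graph_curve T f) g) \<and>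
        (\<forall>g. r_lifting r (periodic_graph_curve T f) g \<longrightarrow> simple_closed g)"
      unfolding c
    proof (intro bexI[OF _ r] conjI allI impI)
      show "\<exists>g. r_lifting r c g" using rolled_curve_lifts by blast
    qed (rule lifting_simple_closed[OF n neg inj])
  qed
qed

end
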